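(* Two different optimally dense admissible horoball arrangements $\mathcal{B}_{436}^i$ $(i=3,4)$ (described in the context) exist for the cubic Coxeter tiling $(4,3,6)$, which share the optimum density $\delta(\mathcal{B}_{436}^i)\approx 0.85327609$. Here optimally dense means that the arrangement has the maximal density $\delta$ among all admissible horoball arrangements in the cell $P_{436}$.
   Context: $\mathbb{H}^3$ is hyperbolic 3-space of curvature $-1$. The Coxeter tiling $(4,3,6)$ is the regular face-to-face tiling of $\mathbb{H}^3$ by congruent regular ideal cubes $P_{436}$ (all 8 vertices on $\partial\mathbb{H}^3$, dihedral angle $2\pi/6$). An admissible horoball arrangement $\mathcal{B}_{436}$ in $P_{436}$ consists of one horoball $B_i$ centered at each vertex $E_i$ such that (i) the horoballs have pairwise disjoint interiors (tangency is allowed), and (ii) the interior of $B_i$ does not meet any face of $P_{436}$ not incident with $E_i$. Its density is $$\delta(\mathcal{B}_{436})=\frac{\sum_{i} \mathrm{Vol}(B_i\cap P_{436})}{\mathrm{Vol}(P_{436})}.$$ Two horoballs centered at vertices of the cell are of the same type if a symmetry of the cell carries one to the other. The arrangements: $\mathcal{B}_{436}^3$: split the 8 vertices of the cube into its two complementary tetrahedral sets of 4 pairwise non-adjacent vertices; within each set the horoballs are of the same type; the four (large) horoballs centered at one set are pairwise tangent at the "midpoints" (feet of the perpendiculars from the center of the cube) of the diagonals of the cube's faces; each of the other four horoballs is tangent to the large horoballs at the adjacent vertices. $\mathcal{B}_{436}^4$: one horoball, centered at a vertex $E_3$, is tangent to all faces of the cube not incident with $E_3$, and each of the other seven horoballs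 is tangent to this large horoball. *)

theory Defs
  imports "HOL-Analysis.Analysis"
begin

section \<open>Hyperbolic 3-space in the Cayley--Klein model\<close>

text \<open>
  The points of hyperbolic 3-space of curvature -1 are those of the open unit ball, the ideal
  points are those of the unit sphere, and geodesics and hyperbolic planes are the intersections of
  Euclidean lines and planes with the ball. In particular convex hulls are Euclidean convex hulls.
\<close>

definition hspace :: "(real^3) set" where
  "hspace = ball 0 1"

definition hdist :: "real^3 \<Rightarrow> real^3 \<Rightarrow> real" where
  "hdist x y = arcosh ((1 - x \<bullet> y) / (sqrt (1 - x \<bullet> x) * sqrt (1 - y \<bullet> y)))"

definition hisometry :: "(real^3 \<Rightarrow> real^3) \<Rightarrow> bool" where
  "hisometry f \<longleftrightarrow> bij_betw f hspace hspace \<and>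
     (\<forall>x\<in>hspace. \<forall>y\<in>hspace. hdist (f x) (f y) = hdist x y)"

text \<open>
  The density is the volume element of the Riemannian metric of \<^const>\<open>hdist\<close>: at distance
  \<open>r\<close> from the origin the metric has length factor \<open>1 / (1 - r\<^sup>2)\<close> in the radial direction and
  \<open>1 / sqrt (1 - r\<^sup>2)\<close> in the two orthogonal directions.
\<close>

definition hvolume :: "(real^3) measure" where
  "hvolume = density lborel (\<lambda>x. ennreal (indicator hspace x / (1 - x \<bullet> x)\<^sup>2))"

abbreviation hvol :: "(real^3) set \<Rightarrow> real" where
  "hvol S \<equiv> measure hvolume S"


section \<open>Horoballs\<close>

text \<open>Busemann function of the ideal point \<open>\<xi>\<close>, normalised to vanish at the origin.\<close>

definition busemann :: "real^3 \<Rightarrow> real^3 \<Rightarrow> real" where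
  "busemann \<xi> x = Lim (at_left 1) (\<lambda>r. hdist x (r *\<^sub>R \<xi>) - hdist 0 (r *\<^sub>R \<xi>))"

definition horoball :: "real^3 \<Rightarrow> real \<Rightarrow> (real^3) set" where
  "horoball \<xi> c = {x \<in> hspace. busemann \<xi> x \<le> c}"

lemma busemann_tendsto:
  fixes \<xi> x :: "real^3"
  assumes xi: "norm \<xi> = 1" and x: "x \<in> hspace"
  shows "((\<lambda>r. hdist x (r *\<^sub>R \<xi>) - hdist 0 (r *\<^sub>R \<xi>)) \<longlongrightarrow>
            ln ((1 - x \<bullet> \<xi>) / sqrt (1 - x \<bullet> x))) (at_left 1)"
proof -
  define q where "q = sqrt (1 - x \<bullet> x)"
  define a where "a r = (1 - r * (x \<bullet> \<xi>)) / q" for r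
  have nx: "norm x < 1" using x by (simp add: hspace_def)
  hence xx: "x \<bullet> x < 1"
    by (simp add: dot_square_norm abs_square_less_1)
  hence q: "q > 0" by (simp add: q_def)
  have xxi: "\<bar>x \<bullet> \<xi>\<bar> < 1"
    using Cauchy_Schwarz_ineq2[of x \<xi>] nx xi by simp
  have a1: "a 1 > 0" using xxi q by (simp add: a_def)
  have ca: "(a \<longlongrightarrow> a 1) (at_left 1)"
    unfolding a_def using q by (intro tendsto_intros) auto
  have pos: "\<forall>\<^sub>F r in at_left 1. a r > 0"
    using order_tendstoD(1)[OF ca a1] .
  have rr: "\<forall>\<^sub>F r in at_left (1::real). 0 < r \<and> r < 1"
    unfolding eventually_at_left_field by (intro exI[of _ 0]) auto
  have lt: "(1 - r * r) \<le> (a r)\<^sup>2" if "0 < r" "r < 1" for r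
  proof -
    let ?t = "x \<bullet> \<xi>"
    have t2: "?t * ?t \<le> x \<bullet> x"
      using Cauchy_Schwarz_ineq[of x \<xi>] xi by (simp add: power2_eq_square norm_eq_1)
    have "(1 - r * r) * (1 - x \<bullet> x) \<le> (1 - r * r) * (1 - ?t * ?t)"
      using that t2 by (intro mult_left_mono) (auto intro!: mult_le_one)
    also have "\<dots> = (1 - r * ?t)\<^sup>2 - (r - ?t)\<^sup>2" by (simp add: power2_eq_square algebra_simps)
    also have "\<dots> \<le> (1 - r * ?t)\<^sup>2" by simp
    finally show ?thesis
      using xx by (simp add: a_def q_def power_divide pos_le_divide_eq)
  qed
  have ev: "\<forall>\<^sub>F r in at_left 1. ln ((a r + sqrt ((a r)\<^sup>2 - (1 - r * r))) / (1 + r)) =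
      hdist x (r *\<^sub>R \<xi>) - hdist 0 (r *\<^sub>R \<xi>)"
    using pos rr
  proof eventually_elim
    case (elim r)
    define s where "s = sqrt (1 - r * r)"
    have "r * r < 1 * 1" using elim by (intro mult_strict_mono) auto
    hence s: "s > 0" "s\<^sup>2 = 1 - r * r" by (auto simp: s_def)
    have arc: "arcosh (b / s) = ln (b + sqrt (b\<^sup>2 - s\<^sup>2)) - ln s"
      if b: "b > 0" "s\<^sup>2 \<le> b\<^sup>2" for b
    proof -
      have sb: "s \<le> b" using b by (auto intro: power2_le_imp_le)
      have "arcosh (b / s) = ln (b / s + sqrt ((b / s)\<^sup>2 - 1))"
        using sb s(1) by (simp add: arcosh_real_def)
      also have "(b / s)\<^sup>2 - 1 = (b\<^sup>2 - s\<^sup>2) / s\<^sup>2"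
        using s(1) by (simp add: power_divide diff_divide_distrib)
      also have "sqrt \<dots> = sqrt (b\<^sup>2 - s\<^sup>2) / s" using s(1) by (simp add: real_sqrt_divide)
      also have "b / s + \<dots> = (b + sqrt (b\<^sup>2 - s\<^sup>2)) / s" by (simp add: add_divide_distrib)
      also have "ln \<dots> = ln (b + sqrt (b\<^sup>2 - s\<^sup>2)) - ln s"
        using b s(1) by (intro ln_divide_pos) (auto intro: add_pos_nonneg)
      finally show ?thesis .
    qed
    have xi2: "\<xi> \<bullet> \<xi> = 1" using xi by (simp add: norm_eq_1)
    have "hdist x (r *\<^sub>R \<xi>) = arcosh (a r / s)"
      by (simp add: hdist_def a_def s_def q_def xi2)
    also have "\<dots> = ln (a r + sqrt ((a r)\<^sup>2 - s\<^sup>2)) - ln s"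
      using elim lt s by (intro arc) auto
    finally have h1: "hdist x (r *\<^sub>R \<xi>) = ln (a r + sqrt ((a r)\<^sup>2 - s\<^sup>2)) - ln s" .
    have "hdist 0 (r *\<^sub>R \<xi>) = arcosh (1 / s)"
      by (simp add: hdist_def s_def xi2)
    also have "\<dots> = ln (1 + sqrt (1\<^sup>2 - s\<^sup>2)) - ln s"
      using s by (intro arc) auto
    also have "sqrt (1\<^sup>2 - s\<^sup>2) = r" using elim s by simp
    finally have h2: "hdist 0 (r *\<^sub>R \<xi>) = ln (1 + r) - ln s" .
    have n: "0 < a r + sqrt ((a r)\<^sup>2 - s\<^sup>2)"
      using elim lt s by (intro add_pos_nonneg) auto
    have "ln ((a r + sqrt ((a r)\<^sup>2 - s\<^sup>2)) / (1 + r)) = ln (a r + sqrt ((a r)\<^sup>2 - s\<^sup>2)) - ln (1 + r)"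
      using n elim by (intro ln_divide_pos) auto
    thus ?case using h1 h2 s by simp
  qed
  have "((\<lambda>r. ln ((a r + sqrt ((a r)\<^sup>2 - (1 - r * r))) / (1 + r))) \<longlongrightarrow>
          ln ((a 1 + sqrt ((a 1)\<^sup>2 - (1 - 1 * 1))) / (1 + 1))) (at_left 1)"
    using a1 by (intro tendsto_intros ca) auto
  also have "(a 1 + sqrt ((a 1)\<^sup>2 - (1 - 1 * 1))) / (1 + 1) = a 1"
    using a1 by simp
  also have "a 1 = (1 - x \<bullet> \<xi>) / sqrt (1 - x \<bullet> x)"
    by (simp add: a_def q_def)
  finally show ?thesis
    using ev by (rule Lim_transform_eventually)
qed

lemma busemann_eq:
  fixes \<xi> x :: "real^3"
  assumes "norm \<xi> = 1" "x \<in> hspace"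
  shows "busemann \<xi> x = ln ((1 - x \<bullet> \<xi>) / sqrt (1 - x \<bullet> x))"
  unfolding busemann_def by (intro tendsto_Lim busemann_tendsto assms) simp


section \<open>The cell of the tiling (4,3,6)\<close>

text \<open>
  A regular ideal cube centred at the origin of the model; all cells of the tiling are congruent to
  it. Two planes \<open>x \<bullet> u = c\<close>, \<open>x \<bullet> v = d\<close> with outer unit normals \<open>u\<close>, \<open>v\<close> enclose the dihedral
  angle \<open>arccos ((c * d - u \<bullet> v) / (sqrt (1 - c\<^sup>2) * sqrt (1 - d\<^sup>2)))\<close>. For adjacent faces
  \<open>u \<bullet> v = 0\<close> and \<open>c = d = 1 / sqrt 3\<close>, so the angle is \<open>arccos (1/2) = 2 * pi / 6\<close>.
\<close>

definition verts436 :: "(real^3) set" where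
  "verts436 = {E. \<forall>i. \<bar>E $ i\<bar> = 1 / sqrt 3}"

text \<open>The cube with its ideal vertices included; its faces are those of this Euclidean polytope.\<close>

definition cube436 :: "(real^3) set" where
  "cube436 = convex hull verts436"

definition P436 :: "(real^3) set" where
  "P436 = cube436 \<inter> hspace"

definition adjacent436 :: "real^3 \<Rightarrow> real^3 \<Rightarrow> bool" where
  "adjacent436 E F \<longleftrightarrow> closed_segment E F edge_of cube436"

definition symmetry436 :: "(real^3 \<Rightarrow> real^3) \<Rightarrow> bool" where
  "symmetry436 f \<longleftrightarrow> hisometry f \<and> f ` P436 = P436"

definition same_type :: "(real^3) set \<Rightarrow> (real^3) set \<Rightarrow> bool" where
  "same_type A A' \<longleftrightarrow> (\<exists>f. symmetry436 f \<and> f ` A = A')"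


section \<open>Horoball arrangements and their density\<close>

text \<open>
  An arrangement assigns a horoball to each vertex; its values elsewhere are irrelevant. The
  Euclidean and hyperbolic topologies agree on the open unit ball, so \<^const>\<open>interior\<close> is the
  interior in hyperbolic space.
\<close>

definition admissible436 :: "(real^3 \<Rightarrow> (real^3) set) \<Rightarrow> bool" where
  "admissible436 B \<longleftrightarrow>
     (\<forall>E\<in>verts436. \<exists>c. B E = horoball E c) \<and>
     (\<forall>E\<in>verts436. \<forall>F\<in>verts436. E \<noteq> F \<longrightarrow> interior (B E) \<inter> interior (B F) = {}) \<and>
     (\<forall>E\<in>verts436. \<forall>\<Phi>. \<Phi> facet_of cube436 \<and> E \<notin> \<Phi> \<longrightarrow> interior (B E) \<inter> \<Phi> = {})"

definition density436 :: "(real^3 \<Rightarrow> (real^3) set) \<Rightarrow> real" where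
  "density436 B = (\<Sum>E\<in>verts436. hvol (B E \<inter> P436)) / hvol P436"

definition optimally_dense436 :: "(real^3 \<Rightarrow> (real^3) set) \<Rightarrow> bool" where
  "optimally_dense436 B \<longleftrightarrow>
     admissible436 B \<and> (\<forall>B'. admissible436 B' \<longrightarrow> density436 B' \<le> density436 B)"

definition equivalent436 :: "(real^3 \<Rightarrow> (real^3) set) \<Rightarrow> (real^3 \<Rightarrow> (real^3) set) \<Rightarrow> bool" where
  "equivalent436 B B' \<longleftrightarrow>
     (\<exists>f. symmetry436 f \<and> (\<lambda>E. f ` B E) ` verts436 = B' ` verts436)"


section \<open>The two arrangements\<close>

text \<open>
  Horoballs are strictly convex bodies in the Klein model, so two horoballs with different centres
  (or a horoball and a plane) are tangent at \<open>p\<close> iff \<open>p\<close> is their only common point.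
\<close>

definition tangent_at :: "(real^3) set \<Rightarrow> (real^3) set \<Rightarrow> real^3 \<Rightarrow> bool" where
  "tangent_at A S p \<longleftrightarrow> A \<inter> S = {p}"

definition tangent :: "(real^3) set \<Rightarrow> (real^3) set \<Rightarrow> bool" where
  "tangent A S \<longleftrightarrow> (\<exists>p. tangent_at A S p)"

definition tangent_face :: "(real^3) set \<Rightarrow> (real^3) set \<Rightarrow> bool" where
  "tangent_face A \<Phi> \<longleftrightarrow> (\<exists>p\<in>\<Phi>. tangent_at A (affine hull \<Phi>) p)"

definition tetrahedral436 :: "(real^3) set \<Rightarrow> bool" where
  "tetrahedral436 T \<longleftrightarrow>
     T \<subseteq> verts436 \<and> card T = 4 \<and> (\<forall>E\<in>T. \<forall>F\<in>T. \<not> adjacent436 E F)"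

text \<open>
  \<open>T\<close> carries the large horoballs. Any two vertices of \<open>T\<close> span a diagonal of a face of the cube.
  As the cube is centred at the origin of the model, the foot of the hyperbolic perpendicular from
  its centre to this diagonal is the Euclidean midpoint.
\<close>

definition arrangement436_3 :: "(real^3 \<Rightarrow> (real^3) set) \<Rightarrow> bool" where
  "arrangement436_3 B \<longleftrightarrow> admissible436 B \<and>
     (\<exists>T. tetrahedral436 T \<and> tetrahedral436 (verts436 - T) \<and>
        (\<forall>E\<in>T. \<forall>F\<in>T. same_type (B E) (B F)) \<and>
        (\<forall>E\<in>verts436 - T. \<forall>F\<in>verts436 - T. same_type (B E) (B F)) \<and>
        (\<forall>E\<in>T. \<forall>F\<in>T. E \<noteq> F \<longrightarrow> tangent_at (B E) (B F) (midpoint E F)) \<and>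
        (\<forall>E\<in>verts436 - T. \<forall>F\<in>T. adjacent436 E F \<longrightarrow> tangent (B E) (B F)))"

definition arrangement436_4 :: "(real^3 \<Rightarrow> (real^3) set) \<Rightarrow> bool" where
  "arrangement436_4 B \<longleftrightarrow> admissible436 B \<and>
     (\<exists>E\<in>verts436.
        (\<forall>\<Phi>. \<Phi> facet_of cube436 \<and> E \<notin> \<Phi> \<longrightarrow> tangent_face (B E) \<Phi>) \<and>
        (\<forall>F\<in>verts436 - {E}. tangent (B F) (B E)))"

end

theory Submission
  imports Defs
begin

text \<open>
  Write \<open>a = exp c\<close> for the radius of a horoball \<open>{x. (1 - x \<bullet> E)\<^sup>2 \<le> a\<^sup>2 * (1 - x \<bullet> x)}\<close> at a vertex
  \<open>E\<close>. Two horoballs with radii \<open>a\<close>, \<open>b\<close> at \<open>E\<close>, \<open>F\<close> have disjoint interiors iff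
  \<open>a * b \<le> (1 - E \<bullet> F) / 2\<close>, with equality iff they touch, and a horoball stays away from the
  opposite faces iff \<open>a\<^sup>2 \<le> 2\<close>. Then it meets the cube in a cone of volume \<open>3 * sqrt 3 / 4 * a\<^sup>2\<close>, so
  the sum of the eight numbers \<open>a\<^sup>2\<close> is to be maximised; the maximum is \<open>10 / 3\<close>, attained by both
  arrangements.

  In projective coordinates centred at a vertex the volume of the cube is
  \<open>3 * sqrt 3 / 2\<close> times the integral of \<open>ln ((1 + t) * (2 + t) / (t * (1 - t))) / (1 + t + t\<^sup>2)\<close> over the
  unit interval. The Moebius substitutions \<open>(1 - t) / (1 + 2 * t)\<close>, \<open>t / (1 + t)\<close>, \<open>1 / (1 + t)\<close> and the
  substitution \<open>t\<^sup>2\<close> reduce this integral to \<open>5 / 2 * s\<close>, where \<open>s\<close> is the integral of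
  \<open>- ln t / (1 + t + t\<^sup>2)\<close>; hence the optimal density is \<open>2 / (3 * s)\<close>. Polynomial approximation of
  \<open>1 / (1 + t + t\<^sup>2)\<close> gives \<open>s\<close> numerically.

  The arrangements are inequivalent because some horoball of the second meets all the others, whereas
  no horoball of the first meets the one at the antipodal vertex.
\<close>

section \<open>Volumes in projective coordinates centred at a vertex\<close>

text \<open>Dihedral angles of 60 degrees give every vertex a Euclidean equilateral triangle as
  link, so a horoball that does not reach past the opposite faces cuts off a cusp, and its volume
  scales like the area of that triangle. The obstacle is the maximum, attained by two different
  configurations whose largest squared radii are \<open>2\<close> and \<open>2 / 3\<close>. Adding
  up bounds along disjoint edges is sharp only while no squared radius exceeds \<open>2 / 3\<close>.
  Beyond that, all constraints are read off from one vertex with squared radius \<open>m\<close>,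
  and \<open>(m - 2) * (m - 2 / 3) \<le> 0\<close> is the inequality that is sharp for both
  configurations. The factor \<open>5 / 2\<close> has a geometric source: the cube splits into five
  regular ideal tetrahedra, each of volume \<open>3 * sqrt 3 / 4 * s\<close>. The integrals are
  taken in the extended nonnegative reals. This spares integrability proofs for the singular
  logarithms but rules out subtraction, so the relations between them are stated as sums with
  integer multiples.\<close>

definition coords3 :: "3 \<Rightarrow> 3 \<Rightarrow> 3 \<Rightarrow> real \<Rightarrow> real \<Rightarrow> real \<Rightarrow> real^3" where
  "coords3 i j k u v w = (\<chi> l. if l = i then u else if l = j then v else w)"

text \<open>An arbitrary order of the axes is kept so that one computation covers all six chambers
  into which the cube is cut later.\<close>

definition is_perm3 :: "3 \<Rightarrow> 3 \<Rightarrow> 3 \<Rightarrow> bool" where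
  "is_perm3 i j k \<longleftrightarrow> i \<noteq> j \<and> j \<noteq> k \<and> i \<noteq> k"

lemma is_perm3_UNIV:
  assumes "is_perm3 i j k"
  shows "(UNIV :: 3 set) = {i, j, k}"
proof -
  have "card {i, j, k} = CARD(3)" using assms by (auto simp: is_perm3_def)
  thus ?thesis by (metis card_subset_eq finite subset_UNIV)
qed

lemma sum_perm3:
  assumes "is_perm3 i j k"
  shows "sum f (UNIV :: 3 set) = f i + (f j + (f k :: 'b :: comm_monoid_add))"
  unfolding is_perm3_UNIV[OF assms] using assms by (auto simp: is_perm3_def)

lemma prod_perm3:
  assumes "is_perm3 i j k"
  shows "prod f (UNIV :: 3 set) = f i * (f j * (f k :: 'b :: comm_monoid_mult))"
  unfolding is_perm3_UNIV[OF assms] using assms by (auto simp: is_perm3_def)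

lemma all_perm3:
  assumes "is_perm3 i j k"
  shows "(\<forall>l. P l) \<longleftrightarrow> P i \<and> P j \<and> P (k :: 3)"
  using is_perm3_UNIV[OF assms] by (metis UNIV_I empty_iff insert_iff)

lemma coords3_nth:
  assumes "is_perm3 i j k"
  shows "coords3 i j k u v w $ i = u" "coords3 i j k u v w $ j = v" "coords3 i j k u v w $ k = w"
  using assms by (auto simp: coords3_def is_perm3_def)

lemma coords3_measurable [measurable]:
  assumes [measurable]: "f \<in> borel_measurable M" "g \<in> borel_measurable M" "h \<in> borel_measurable M"
  shows "(\<lambda>x. coords3 i j k (f x) (g x) (h x)) \<in> borel_measurable M"
proof -
  have "continuous_on UNIV (\<lambda>(u, v, w). coords3 i j k u v w)"
    unfolding coords3_def case_prod_beta
    by (intro continuous_on_vec_lambda) (rename_tac l, case_tac "l = i"; case_tac "l = j"; simp; intro continuous_intros)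
  hence [measurable]: "(\<lambda>(u, v, w). coords3 i j k u v w) \<in> borel_measurable borel"
    by (rule borel_measurable_continuous_onI)
  have "(\<lambda>x. (f x, g x, h x)) \<in> borel_measurable M" by measurable
  from measurable_compose[OF this, of "\<lambda>(u, v, w). coords3 i j k u v w"]
  show ?thesis by simp
qed

lemma prod_Basis_vec3:
  fixes x :: "real^3"
  assumes "is_perm3 i j k"
  shows "(\<Prod>b\<in>Basis. x \<bullet> b) = x $ i * (x $ j * x $ k)"
proof -
  have "(\<Prod>b\<in>Basis. x \<bullet> b) = (\<Prod>l\<in>(UNIV :: 3 set). x $ l)"
    unfolding Basis_vec_def
    by (subst prod.reindex_cong[of "\<lambda>l. axis l (1::real)" UNIV])
       (auto simp: inj_on_def axis_eq_axis inner_axis)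
  thus ?thesis by (simp add: prod_perm3[OF assms])
qed

lemma sigma_finite_lborel2: "sigma_finite_measure (lborel \<Otimes>\<^sub>M lborel :: (real \<times> real) measure)"
  by (simp add: lborel_prod sigma_finite_lborel)

lemma lborel_coords3:
  assumes p: "is_perm3 i j k"
  shows "(lborel :: (real^3) measure) =
    distr (lborel \<Otimes>\<^sub>M (lborel \<Otimes>\<^sub>M lborel)) borel (\<lambda>(u, v, w). coords3 i j k u v w)"
proof (rule lborel_eqI)
  fix l u :: "real^3" assume le: "\<And>b. b \<in> Basis \<Longrightarrow> l \<bullet> b \<le> u \<bullet> b"
  have le': "l $ m \<le> u $ m" for m using le[of "axis m 1"] by (auto simp: inner_axis Basis_vec_def)
  have pre: "(\<lambda>(a, b, c). coords3 i j k a b c) -` box l u =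
     box (l $ i) (u $ i) \<times> box (l $ j) (u $ j) \<times> box (l $ k) (u $ k)"
    by (auto simp: mem_box_cart all_perm3[OF p] coords3_nth[OF p] mem_box_real)
  have "emeasure (distr (lborel \<Otimes>\<^sub>M (lborel \<Otimes>\<^sub>M lborel)) borel (\<lambda>(u, v, w). coords3 i j k u v w)) (box l u)
     = emeasure (lborel \<Otimes>\<^sub>M (lborel \<Otimes>\<^sub>M lborel)) (box (l $ i) (u $ i) \<times> box (l $ j) (u $ j) \<times> box (l $ k) (u $ k))"
    by (subst emeasure_distr) (auto simp: pre space_pair_measure)
  also have "\<dots> = ennreal (u $ i - l $ i) * (ennreal (u $ j - l $ j) * ennreal (u $ k - l $ k))"
    using le' by (simp add: sigma_finite_measure.emeasure_pair_measure_Times[OF sigma_finite_lborel2] lborel.emeasure_pair_measure_Times box_real del: lborel_prod)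
  also have "\<dots> = (\<Prod>b\<in>Basis. (u - l) \<bullet> b)"
    using le' by (subst prod_Basis_vec3[OF p]) (simp add: ennreal_mult)
  finally show "emeasure (distr (lborel \<Otimes>\<^sub>M (lborel \<Otimes>\<^sub>M lborel)) borel (\<lambda>(u, v, w). coords3 i j k u v w)) (box l u)
      = ennreal (\<Prod>b\<in>Basis. (u - l) \<bullet> b)" .
qed simp

lemma nn_integral_coords3:
  assumes p: "is_perm3 i j k" and [measurable]: "f \<in> borel_measurable borel"
  shows "(\<integral>\<^sup>+x. f x \<partial>lborel) = (\<integral>\<^sup>+u. \<integral>\<^sup>+v. \<integral>\<^sup>+w. f (coords3 i j k u v w) \<partial>lborel \<partial>lborel \<partial>lborel)"
proof -
  have "(\<integral>\<^sup>+x. f x \<partial>lborel) = (\<integral>\<^sup>+x. f (case x of (u, v, w) \<Rightarrow> coords3 i j k u v w)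
      \<partial>(lborel \<Otimes>\<^sub>M (lborel \<Otimes>\<^sub>M lborel)))"
    by (subst lborel_coords3[OF p], subst nn_integral_distr) auto
  also have "\<dots> = (\<integral>\<^sup>+u. \<integral>\<^sup>+y. f (case y of (v, w) \<Rightarrow> coords3 i j k u v w) \<partial>(lborel \<Otimes>\<^sub>M lborel) \<partial>lborel)"
    by (subst sigma_finite_measure.nn_integral_fst[OF sigma_finite_lborel2, symmetric]) (auto simp: case_prod_beta)
  also have "\<dots> = (\<integral>\<^sup>+u. \<integral>\<^sup>+v. \<integral>\<^sup>+w. f (coords3 i j k u v w) \<partial>lborel \<partial>lborel \<partial>lborel)"
    by (subst lborel.nn_integral_fst[symmetric]) (auto simp: case_prod_beta)
  finally show ?thesis .
qed

text \<open>For fixed \<open>y\<close> and \<open>w\<close> this runs along a ray from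
  \<open>E\<close>, a geodesic ending at the ideal vertex. The numbers \<open>z\<close>,
  \<open>z * y\<close>, \<open>z * w\<close> are the depths below the three faces through
  \<open>E\<close>, scaled so that the opposite faces have depth \<open>2\<close>.\<close>

definition cone_pt :: "3 \<Rightarrow> 3 \<Rightarrow> 3 \<Rightarrow> real^3 \<Rightarrow> real \<Rightarrow> real \<Rightarrow> real \<Rightarrow> real^3" where
  "cone_pt i j k E z y w = coords3 i j k (E $ i * (1 - z)) (E $ j * (1 - z * y)) (E $ k * (1 - z * w))"

lemma cone_pt_measurable [measurable]:
  assumes [measurable]: "f \<in> borel_measurable M" "g \<in> borel_measurable M" "h \<in> borel_measurable M"
  shows "(\<lambda>x. cone_pt i j k E (f x) (g x) (h x)) \<in> borel_measurable M"
  unfolding cone_pt_def by measurable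

lemma vert_nth:
  assumes "E \<in> verts436"
  shows "\<bar>E $ l\<bar> = 1 / sqrt 3" "E $ l * E $ l = 1 / 3" "E $ l \<noteq> 0"
proof -
  show *: "\<bar>E $ l\<bar> = 1 / sqrt 3" using assms by (simp add: verts436_def)
  have "E $ l * E $ l = \<bar>E $ l\<bar> * \<bar>E $ l\<bar>" by (rule abs_mult_self_eq[symmetric])
  thus "E $ l * E $ l = 1 / 3" unfolding * by simp
  thus "E $ l \<noteq> 0" by auto
qed

lemma ennreal_mult_assoc:
  assumes "0 \<le> a" "0 \<le> b"
  shows "ennreal a * (ennreal b * c) = ennreal (a * b) * c"
  using assms by (simp add: mult.assoc ennreal_mult)

text \<open>The substitution is affine in one variable at a time, so the Jacobian is a product of
  three scale factors. The order of integration is then changed because the density has a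
  closed-form integral along each ray.\<close>

lemma nn_integral_cone_pt:
  assumes E: "E \<in> verts436" and p: "is_perm3 i j k" and [measurable]: "f \<in> borel_measurable borel"
  shows "(\<integral>\<^sup>+x. f x \<partial>lborel) =
    (\<integral>\<^sup>+y. \<integral>\<^sup>+w. \<integral>\<^sup>+z. ennreal (z\<^sup>2 / (3 * sqrt 3)) * f (cone_pt i j k E z y w) \<partial>lborel \<partial>lborel \<partial>lborel)"
proof -
  note E' = vert_nth[OF E]
  let ?f = "\<lambda>z y w. f (cone_pt i j k E z y w)"
  have "(\<integral>\<^sup>+x. f x \<partial>lborel) = (\<integral>\<^sup>+u. \<integral>\<^sup>+v. \<integral>\<^sup>+w. f (coords3 i j k u v w) \<partial>lborel \<partial>lborel \<partial>lborel)"
    by (rule nn_integral_coords3[OF p]) simp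
  also have "\<dots> = ennreal \<bar>- E $ i\<bar> * (\<integral>\<^sup>+z. \<integral>\<^sup>+v. \<integral>\<^sup>+w. f (coords3 i j k (E $ i + (- E $ i) * z) v w) \<partial>lborel \<partial>lborel \<partial>lborel)"
    using E' by (subst nn_integral_real_affine[where t = "E $ i" and c = "- E $ i"]) auto
  also have "(\<integral>\<^sup>+z. \<integral>\<^sup>+v. \<integral>\<^sup>+w. f (coords3 i j k (E $ i + (- E $ i) * z) v w) \<partial>lborel \<partial>lborel \<partial>lborel) =
    (\<integral>\<^sup>+z. ennreal (z\<^sup>2 / 3) * (\<integral>\<^sup>+y. \<integral>\<^sup>+w. ?f z y w \<partial>lborel \<partial>lborel) \<partial>lborel)"
  \<comment> \<open>The scale factors of the two inner substitutions vanish at \<open>z = 0\<close>,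
    which is a null set.\<close>
  proof (rule nn_integral_cong_AE, rule AE_mp[OF AE_lborel_singleton[of 0]], rule AE_I2, rule impI)
    fix z :: real assume z: "z \<noteq> 0"
    have "(\<integral>\<^sup>+v. \<integral>\<^sup>+w. f (coords3 i j k (E $ i + (- E $ i) * z) v w) \<partial>lborel \<partial>lborel)
      = ennreal \<bar>- E $ j * z\<bar> * (\<integral>\<^sup>+y. \<integral>\<^sup>+w. f (coords3 i j k (E $ i + (- E $ i) * z) (E $ j + (- E $ j * z) * y) w) \<partial>lborel \<partial>lborel)"
      using E' z by (subst nn_integral_real_affine[where t = "E $ j" and c = "- E $ j * z"]) auto
    also have "\<dots> = ennreal \<bar>- E $ j * z\<bar> * (\<integral>\<^sup>+y. ennreal \<bar>- E $ k * z\<bar> * (\<integral>\<^sup>+w. f (coords3 i j k (E $ i + (- E $ i) * z) (E $ j + (- E $ j * z) * y) (E $ k + (- E $ k * z) * w)) \<partial>lborel) \<partial>lborel)"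
      using E' z by (subst (2) nn_integral_real_affine[where t = "E $ k" and c = "- E $ k * z"]) auto
    also have "\<dots> = ennreal \<bar>- E $ j * z\<bar> * (ennreal \<bar>- E $ k * z\<bar> * (\<integral>\<^sup>+y. (\<integral>\<^sup>+w. f (coords3 i j k (E $ i + (- E $ i) * z) (E $ j + (- E $ j * z) * y) (E $ k + (- E $ k * z) * w)) \<partial>lborel) \<partial>lborel))"
      by (subst nn_integral_cmult) auto
    also have "(\<lambda>y w. f (coords3 i j k (E $ i + (- E $ i) * z) (E $ j + (- E $ j * z) * y) (E $ k + (- E $ k * z) * w))) = ?f z"
      by (simp add: cone_pt_def algebra_simps)
    also have "ennreal \<bar>- E $ j * z\<bar> * (ennreal \<bar>- E $ k * z\<bar> * I) = ennreal (z\<^sup>2 / 3) * I" for I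
    proof -
      have "\<bar>- E $ j * z\<bar> * \<bar>- E $ k * z\<bar> = (1 / sqrt 3 * 1 / sqrt 3) * (\<bar>z\<bar> * \<bar>z\<bar>)"
        using E' by (simp add: abs_mult)
      also have "\<dots> = z\<^sup>2 / 3" by (simp add: power2_eq_square)
      finally show ?thesis by (simp only: ennreal_mult_assoc abs_ge_zero)
    qed
    finally show "(\<integral>\<^sup>+v. \<integral>\<^sup>+w. f (coords3 i j k (E $ i + (- E $ i) * z) v w) \<partial>lborel \<partial>lborel) =
      ennreal (z\<^sup>2 / 3) * (\<integral>\<^sup>+y. \<integral>\<^sup>+w. ?f z y w \<partial>lborel \<partial>lborel)" .
  qed
  also have "ennreal \<bar>- E $ i\<bar> * \<dots> = (\<integral>\<^sup>+z. \<integral>\<^sup>+y. \<integral>\<^sup>+w. ennreal (z\<^sup>2 / (3 * sqrt 3)) * ?f z y w \<partial>lborel \<partial>lborel \<partial>lborel)"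
  proof -
    have "ennreal (z\<^sup>2 / (3 * sqrt 3)) = ennreal \<bar>- E $ i\<bar> * ennreal (z\<^sup>2 / 3)" for z
      using E' by (subst ennreal_mult[symmetric]) (simp_all add: mult.commute)
    thus ?thesis by (simp only: mult.assoc) (simp add: nn_integral_cmult)
  qed
  also have "\<dots> = (\<integral>\<^sup>+y. \<integral>\<^sup>+z. \<integral>\<^sup>+w. ennreal (z\<^sup>2 / (3 * sqrt 3)) * ?f z y w \<partial>lborel \<partial>lborel \<partial>lborel)"
    by (rule lborel_pair.Fubini') measurable
  also have "\<dots> = (\<integral>\<^sup>+y. \<integral>\<^sup>+w. \<integral>\<^sup>+z. ennreal (z\<^sup>2 / (3 * sqrt 3)) * ?f z y w \<partial>lborel \<partial>lborel \<partial>lborel)"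
    by (intro nn_integral_cong lborel_pair.Fubini') measurable
  finally show ?thesis .
qed

lemma cone_pt_in_cube:
  assumes E: "E \<in> verts436" and p: "is_perm3 i j k"
  shows "(\<forall>l. \<bar>cone_pt i j k E z y w $ l\<bar> \<le> 1 / sqrt 3) \<longleftrightarrow>
     0 \<le> z \<and> z \<le> 2 \<and> 0 \<le> z * y \<and> z * y \<le> 2 \<and> 0 \<le> z * w \<and> z * w \<le> 2"
proof -
  have *: "\<bar>E $ l * (1 - t)\<bar> \<le> 1 / sqrt 3 \<longleftrightarrow> 0 \<le> t \<and> t \<le> 2" for l t
  proof -
    have "\<bar>E $ l * (1 - t)\<bar> = \<bar>1 - t\<bar> / sqrt 3"
      using vert_nth(1)[OF E, of l] by (simp add: abs_mult)
    also have "\<dots> \<le> 1 / sqrt 3 \<longleftrightarrow> \<bar>1 - t\<bar> \<le> 1" by (simp add: divide_le_cancel)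
    finally show ?thesis by auto
  qed
  show ?thesis
    unfolding all_perm3[OF p] cone_pt_def coords3_nth[OF p] * by blast
qed

lemma cone_pt_level:
  assumes E: "E \<in> verts436" and p: "is_perm3 i j k"
  shows "1 - cone_pt i j k E z y w \<bullet> E = z * (1 + y + w) / 3"
proof -
  have *: "E $ l * (1 - t) * E $ l = (1 - t) / 3" for l t
    using vert_nth(2)[OF E, of l] by (simp add: algebra_simps)
  show ?thesis
    unfolding inner_vec_def sum_perm3[OF p] cone_pt_def coords3_nth[OF p] inner_real_def *
    by (simp add: field_simps)
qed

text \<open>As a function of \<open>z\<close> this is a quadratic with one root at the ideal vertex;
  the other root is where the line leaves the ball.\<close>

lemma cone_pt_norm:
  assumes E: "E \<in> verts436" and p: "is_perm3 i j k"
  shows "1 - cone_pt i j k E z y w \<bullet> cone_pt i j k E z y w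
    = z * (2 * (1 + y + w) - z * (1 + y\<^sup>2 + w\<^sup>2)) / 3"
proof -
  have *: "E $ l * (1 - t) * (E $ l * (1 - t)) = (1 - t)\<^sup>2 / 3" for l t
    using vert_nth(2)[OF E, of l] by (simp add: algebra_simps power2_eq_square)
  show ?thesis
    unfolding inner_vec_def sum_perm3[OF p] cone_pt_def coords3_nth[OF p] inner_real_def *
    by (simp add: field_simps power2_eq_square)
qed

lemma cone_pt_coord:
  assumes E: "E \<in> verts436" and p: "is_perm3 i j k"
  shows "1 - 3 * (E $ i * cone_pt i j k E z y w $ i) = z"
    "1 - 3 * (E $ j * cone_pt i j k E z y w $ j) = z * y"
    "1 - 3 * (E $ k * cone_pt i j k E z y w $ k) = z * w"
proof -
  have *: "E $ l * (E $ l * (1 - t)) = (1 - t) / 3" for l t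
    using vert_nth(2)[OF E, of l] by (simp add: algebra_simps)
  show "1 - 3 * (E $ i * cone_pt i j k E z y w $ i) = z"
    "1 - 3 * (E $ j * cone_pt i j k E z y w $ j) = z * y"
    "1 - 3 * (E $ k * cone_pt i j k E z y w $ k) = z * w"
    unfolding cone_pt_def coords3_nth[OF p] * by (simp_all add: field_simps)
qed

lemma hspace_iff: "x \<in> hspace \<longleftrightarrow> x \<bullet> x < 1"
  by (simp add: hspace_def dot_square_norm abs_square_less_1)

lemma hspace_borel [measurable]: "hspace \<in> sets borel"
  by (simp add: hspace_def)

lemma emeasure_hvolume:
  assumes [measurable]: "S \<in> sets borel"
  shows "emeasure hvolume S = (\<integral>\<^sup>+x. ennreal (1 / (1 - x \<bullet> x)\<^sup>2) * indicator (S \<inter> hspace) x \<partial>lborel)"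
  unfolding hvolume_def
  by (subst emeasure_density) (auto intro!: nn_integral_cong split: split_indicator)

text \<open>The factor \<open>z\<^sup>2\<close> of the Jacobian cancels the double zero of
  \<open>(1 - x \<bullet> x)\<^sup>2\<close> at the ideal vertex, which leaves the reciprocal of the
  square of a linear function of \<open>z\<close>.\<close>

lemma emeasure_hvolume_cone:
  assumes E: "E \<in> verts436" and p: "is_perm3 i j k" and [measurable]: "S \<in> sets borel"
  shows "emeasure hvolume S = (\<integral>\<^sup>+y. \<integral>\<^sup>+w. \<integral>\<^sup>+z.
     ennreal (sqrt 3 / (2 * (1 + y + w) - z * (1 + y\<^sup>2 + w\<^sup>2))\<^sup>2) *
       indicator (S \<inter> hspace) (cone_pt i j k E z y w) \<partial>lborel \<partial>lborel \<partial>lborel)"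
proof -
  have "emeasure hvolume S = (\<integral>\<^sup>+y. \<integral>\<^sup>+w. \<integral>\<^sup>+z. ennreal (z\<^sup>2 / (3 * sqrt 3)) *
     (ennreal (1 / (1 - cone_pt i j k E z y w \<bullet> cone_pt i j k E z y w)\<^sup>2) *
       indicator (S \<inter> hspace) (cone_pt i j k E z y w)) \<partial>lborel \<partial>lborel \<partial>lborel)"
    by (subst emeasure_hvolume, simp, subst nn_integral_cone_pt[OF E p]) simp_all
  also have "\<dots> = (\<integral>\<^sup>+y. \<integral>\<^sup>+w. \<integral>\<^sup>+z.
     ennreal (sqrt 3 / (2 * (1 + y + w) - z * (1 + y\<^sup>2 + w\<^sup>2))\<^sup>2) *
       indicator (S \<inter> hspace) (cone_pt i j k E z y w) \<partial>lborel \<partial>lborel \<partial>lborel)"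
  proof (rule nn_integral_cong, rule nn_integral_cong, rule nn_integral_cong_AE,
      rule AE_mp[OF AE_lborel_singleton[of 0]], rule AE_I2, rule impI)
    fix y w z :: real assume z: "z \<noteq> 0"
    define q where "q = 2 * (1 + y + w) - z * (1 + y\<^sup>2 + w\<^sup>2)"
    have s3: "sqrt 3 * sqrt 3 = (3::real)" by simp
    have "z\<^sup>2 / (3 * sqrt 3) * (1 / (z * q / 3)\<^sup>2) = 3 / (sqrt 3 * q\<^sup>2)"
      using z by (simp add: power2_eq_square)
    also have "\<dots> = sqrt 3 / q\<^sup>2"
      using s3 by (cases "q = 0") (simp_all add: field_simps)
    finally have eq: "z\<^sup>2 / (3 * sqrt 3) * (1 / (z * q / 3)\<^sup>2) = sqrt 3 / q\<^sup>2" .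
    show "ennreal (z\<^sup>2 / (3 * sqrt 3)) *
     (ennreal (1 / (1 - cone_pt i j k E z y w \<bullet> cone_pt i j k E z y w)\<^sup>2) *
       indicator (S \<inter> hspace) (cone_pt i j k E z y w)) =
       ennreal (sqrt 3 / (2 * (1 + y + w) - z * (1 + y\<^sup>2 + w\<^sup>2))\<^sup>2) *
       indicator (S \<inter> hspace) (cone_pt i j k E z y w)"
      unfolding cone_pt_norm[OF E p] q_def[symmetric]
      by (subst ennreal_mult_assoc, simp, simp, simp only: eq)
  qed
  finally show ?thesis .
qed

text \<open>The antiderivative used is the one that vanishes at \<open>z = 0\<close>; the condition
  on \<open>R\<close> says that the segment ends before the ray leaves the ball.\<close>

lemma cone_kernel_integral:
  fixes m n R :: real
  assumes m: "m > 0" and R: "0 \<le> R" "R * n < 2 * m" and n: "n \<ge> 0"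
  shows "(\<integral>\<^sup>+z. ennreal (sqrt 3 / (2 * m - z * n)\<^sup>2) * indicator {0..R} z \<partial>lborel)
     = ennreal (sqrt 3 * (R / (2 * m * (2 * m - R * n))))"
proof -
  have pos: "2 * m - z * n > 0" if "z \<in> {0..R}" for z
  proof -
    have "z * n \<le> R * n" using that n by (intro mult_right_mono) auto
    thus ?thesis using R by simp
  qed
  have "(\<integral>\<^sup>+z. ennreal (sqrt 3 / (2 * m - z * n)\<^sup>2) * indicator {0..R} z \<partial>lborel)
     = ennreal (sqrt 3 * (R / (2 * m * (2 * m - R * n))) - sqrt 3 * (0 / (2 * m * (2 * m - 0 * n))))"
  proof (rule nn_integral_FTC_Icc)
    fix z assume z: "z \<in> {0..R}"
    have q: "2 * m - z * n \<noteq> 0" using pos[OF z] by simp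
    have "((\<lambda>z. sqrt 3 * (z / (2 * m * (2 * m - z * n)))) has_real_derivative
        sqrt 3 * ((2 * m * (2 * m - z * n) + z * (2 * m * n)) / (2 * m * (2 * m - z * n))\<^sup>2)) (at z)"
      using m q by (auto intro!: derivative_eq_intros simp: power2_eq_square algebra_simps)
    also have "sqrt 3 * ((2 * m * (2 * m - z * n) + z * (2 * m * n)) / (2 * m * (2 * m - z * n))\<^sup>2)
      = sqrt 3 / (2 * m - z * n)\<^sup>2"
    proof -
      have "2 * m * (2 * m - z * n) + z * (2 * m * n) = (2 * m)\<^sup>2"
        by (simp add: power2_eq_square algebra_simps)
      thus ?thesis using m by (simp add: power_mult_distrib)
    qed
    finally show "((\<lambda>z. sqrt 3 * (z / (2 * m * (2 * m - z * n)))) has_real_derivative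
       sqrt 3 / (2 * m - z * n)\<^sup>2) (at z)" .
  qed (use R in auto)
  thus ?thesis by simp
qed

section \<open>The piece of the cube inside one horoball\<close>

definition solid436 :: "(real^3) set" where
  "solid436 = {x. \<forall>l. \<bar>x $ l\<bar> \<le> 1 / sqrt 3}"

text \<open>The parameter \<open>A\<close> is the square of the radius, which keeps the defining
  inequality polynomial.\<close>

definition hball :: "real^3 \<Rightarrow> real \<Rightarrow> (real^3) set" where
  "hball E A = {x \<in> hspace. (1 - x \<bullet> E)\<^sup>2 \<le> A * (1 - x \<bullet> x)}"

lemma solid436_borel [measurable]: "solid436 \<in> sets borel"
proof -
  have "solid436 = cbox (\<chi> i. - (1 / sqrt 3)) (\<chi> i. 1 / sqrt 3)"
    by (auto simp: solid436_def mem_box_cart abs_le_iff minus_le_iff)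
  thus ?thesis by (metis borel_closed closed_cbox)
qed

lemma hball_borel [measurable]: "hball E A \<in> sets borel"
proof -
  have "hball E A = hspace \<inter> {x. (1 - x \<bullet> E)\<^sup>2 \<le> A * (1 - x \<bullet> x)}"
    by (auto simp: hball_def)
  also have "\<dots> \<in> sets borel" by (intro sets.Int hspace_borel) measurable
  finally show ?thesis .
qed

text \<open>This keeps a horoball with \<open>A \<le> 2\<close> from leaving the cube through the
  opposite face whose depth is measured by \<open>c\<close>. The difference of the sides is a sum of
  squares vanishing for \<open>a = b\<close>, \<open>c = 4 * a\<close>, the direction in which the
  horoball with \<open>A = 2\<close> touches that face.\<close>

lemma cone_coord_bound:
  fixes a b c :: real
  shows "6 * ((a + b + c) * c - (a\<^sup>2 + b\<^sup>2 + c\<^sup>2)) \<le> (a + b + c)\<^sup>2"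
proof -
  have "(a + b + c)\<^sup>2 - 6 * ((a + b + c) * c - (a\<^sup>2 + b\<^sup>2 + c\<^sup>2)) = (2 * (a + b) - c)\<^sup>2 + 3 * (a - b)\<^sup>2"
    by (simp add: power2_eq_square algebra_simps)
  thus ?thesis by (smt (verit) zero_le_power2)
qed

text \<open>\<open>R\<close> is the nonzero root of the quadratic in \<open>z\<close> that bounds
  the horoball on the ray. Up to \<open>R\<close> the ray reaches neither an opposite face nor the
  sphere, so inside the octant of positive \<open>y\<close> and \<open>w\<close> the cube imposes no
  further condition.\<close>

lemma hball_cone_iff:
  assumes E: "E \<in> verts436" and p: "is_perm3 i j k" and A: "0 < A" "A \<le> 2"
    and z: "z > 0" and yw: "y > 0" "w > 0"
  defines "m \<equiv> 1 + y + w" and "n \<equiv> 1 + y\<^sup>2 + w\<^sup>2"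
  defines "R \<equiv> 6 * A * m / (m\<^sup>2 + 3 * A * n)"
  shows "cone_pt i j k E z y w \<in> hball E A \<inter> solid436 \<longleftrightarrow> z \<le> R"
proof -
  have m: "m > 0" and n: "n > 0" using yw by (auto simp: m_def n_def add_pos_nonneg)
  have D: "m\<^sup>2 + 3 * A * n > 0" using A m n by (intro add_pos_pos) auto
  have lev: "(z * m / 3)\<^sup>2 \<le> A * (z * (2 * m - z * n) / 3) \<longleftrightarrow> z \<le> R"
  proof -
    have "(z * m / 3)\<^sup>2 \<le> A * (z * (2 * m - z * n) / 3) \<longleftrightarrow>
       (z / 9) * (z * m\<^sup>2) \<le> (z / 9) * (3 * A * (2 * m - z * n))"
    proof -
      have "(z * m / 3)\<^sup>2 = (z / 9) * (z * m\<^sup>2)"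
        "A * (z * (2 * m - z * n) / 3) = (z / 9) * (3 * A * (2 * m - z * n))"
        by (simp_all add: power2_eq_square field_simps)
      thus ?thesis by (simp only:)
    qed
    also have "\<dots> \<longleftrightarrow> z * m\<^sup>2 \<le> 3 * A * (2 * m - z * n)"
      using z by (intro mult_le_cancel_left_pos) simp
    also have "\<dots> \<longleftrightarrow> z * (m\<^sup>2 + 3 * A * n) \<le> 6 * A * m" by (simp add: algebra_simps)
    also have "\<dots> \<longleftrightarrow> z \<le> R" using D by (simp add: R_def pos_le_divide_eq)
    finally show ?thesis .
  qed
  have hs: "2 * m - z * n > 0" if "z \<le> R"
  proof -
    have "z * (m\<^sup>2 + 3 * A * n) \<le> 6 * A * m" using that D by (simp add: R_def pos_le_divide_eq)
    moreover have "z * m\<^sup>2 > 0" using z m by simp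
    ultimately have "3 * A * (z * n) < 3 * A * (2 * m)" by (simp add: algebra_simps)
    thus ?thesis using A by (simp add: mult_less_cancel_left mult.commute)
  qed
  have cb: "z * c \<le> 2" if c: "6 * (m * c - n) \<le> m\<^sup>2" "c > 0" and zR: "z \<le> R" for c
  proof -
    have "A * (6 * (m * c - n)) \<le> 2 * m\<^sup>2"
    proof (cases "m * c - n \<ge> 0")
      case True
      hence "A * (6 * (m * c - n)) \<le> 2 * (6 * (m * c - n))" using A by (intro mult_right_mono) auto
      thus ?thesis using c by simp
    next
      case False
      hence "A * (6 * (m * c - n)) \<le> 0" using A by (intro mult_nonneg_nonpos) auto
      thus ?thesis by (smt (verit) zero_le_power2)
    qed
    hence "6 * A * m * c \<le> 2 * (m\<^sup>2 + 3 * A * n)" by (simp add: algebra_simps)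
    hence "R * c \<le> 2" using D by (simp add: R_def pos_divide_le_eq)
    moreover have "z * c \<le> R * c" using zR c by (intro mult_right_mono) auto
    ultimately show ?thesis by linarith
  qed
  have c1: "6 * (m * 1 - n) \<le> m\<^sup>2" using cone_coord_bound[of y w 1] by (simp add: m_def n_def add_ac)
  have c2: "6 * (m * y - n) \<le> m\<^sup>2" using cone_coord_bound[of 1 w y] by (simp add: m_def n_def add_ac)
  have c3: "6 * (m * w - n) \<le> m\<^sup>2" using cone_coord_bound[of 1 y w] by (simp add: m_def n_def add_ac)
  have sp: "x \<in> hspace \<longleftrightarrow> 1 - x \<bullet> x > 0" for x :: "real^3" by (simp add: hspace_iff)
  have "cone_pt i j k E z y w \<in> hball E A \<longleftrightarrow> 0 < z * (2 * m - z * n) / 3 \<and> z \<le> R"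
    unfolding hball_def mem_Collect_eq sp cone_pt_norm[OF E p] cone_pt_level[OF E p]
    using lev by (simp add: m_def n_def)
  also have "\<dots> \<longleftrightarrow> z \<le> R" using hs z by (auto simp: zero_less_mult_iff)
  finally have 1: "cone_pt i j k E z y w \<in> hball E A \<longleftrightarrow> z \<le> R" .
  have "cone_pt i j k E z y w \<in> solid436" if "z \<le> R"
    unfolding solid436_def mem_Collect_eq cone_pt_in_cube[OF E p]
    using cb[OF c1 _ that] cb[OF c2 _ that] cb[OF c3 _ that] z yw by simp
  thus ?thesis using 1 by blast
qed

lemma deriv_inverse_square:
  fixes t c :: real
  assumes "t > 0"
  shows "((\<lambda>t. - (c / t\<^sup>2)) has_real_derivative 2 * c / t ^ 3) (at t)"
  using assms by (auto intro!: derivative_eq_intros simp: divide_simps power_eq_if)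

text \<open>Because \<open>2 * m - R * n = 2 * m ^ 3 / (m\<^sup>2 + 3 * A * n)\<close>, the
  denominator of \<open>R\<close> cancels in the integral along a ray. What remains is
  \<open>3 * sqrt 3 * A / (2 * m ^ 3)\<close>, linear in \<open>A\<close>, with elementary integrals
  over \<open>w\<close> and then \<open>y\<close>.\<close>

lemma emeasure_hball:
  assumes E: "E \<in> verts436" and A: "0 < A" "A \<le> 2"
  shows "emeasure hvolume (hball E A \<inter> solid436) = ennreal (3 * sqrt 3 / 4 * A)"
proof -
  have p: "is_perm3 1 2 3" by (simp add: is_perm3_def)
  let ?pt = "cone_pt 1 2 3 E"
  let ?S = "hball E A \<inter> solid436"
  have SH: "?S \<inter> hspace = ?S" by (auto simp: hball_def)
  have inner: "(\<integral>\<^sup>+z. ennreal (sqrt 3 / (2 * (1 + y + w) - z * (1 + y\<^sup>2 + w\<^sup>2))\<^sup>2) *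
       indicator (?S \<inter> hspace) (?pt z y w) \<partial>lborel)
     = ennreal (3 * sqrt 3 * A / (2 * (1 + y + w) ^ 3)) * indicator {0..} y * indicator {0..} w"
    if y0: "y \<noteq> 0" and w0: "w \<noteq> 0" for y w
  proof (cases "y > 0 \<and> w > 0")
    case True
    define m n where "m = 1 + y + w" and "n = 1 + y\<^sup>2 + w\<^sup>2"
    define R where "R = 6 * A * m / (m\<^sup>2 + 3 * A * n)"
    have m: "m > 0" and n: "n > 0" using True by (auto simp: m_def n_def add_pos_nonneg)
    have D: "m\<^sup>2 + 3 * A * n > 0" using A m n by (intro add_pos_pos) auto
    have R0: "R \<ge> 0" using A m D by (simp add: R_def)
    have Rn: "2 * m - R * n = 2 * m ^ 3 / (m\<^sup>2 + 3 * A * n)"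
      using D by (simp add: R_def field_simps power2_eq_square power3_eq_cube)
    have Rn': "R * n < 2 * m"
    proof -
      have "2 * m ^ 3 / (m\<^sup>2 + 3 * A * n) > 0" using m D by (intro divide_pos_pos) auto
      thus ?thesis unfolding Rn[symmetric] by simp
    qed
    have "(\<integral>\<^sup>+z. ennreal (sqrt 3 / (2 * m - z * n)\<^sup>2) * indicator ?S (?pt z y w) \<partial>lborel)
       = (\<integral>\<^sup>+z. ennreal (sqrt 3 / (2 * m - z * n)\<^sup>2) * indicator {0..R} z \<partial>lborel)"
    proof (rule nn_integral_cong_AE, rule AE_mp[OF AE_lborel_singleton[of 0]], rule AE_I2, rule impI)
      fix z :: real assume z: "z \<noteq> 0"
      have "?pt z y w \<in> ?S \<longleftrightarrow> z \<in> {0..R}"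
      proof (cases "z > 0")
        case True
        thus ?thesis using hball_cone_iff[OF E p A True] \<open>y > 0 \<and> w > 0\<close>
          by (simp add: R_def m_def n_def)
      next
        case False
        hence "?pt z y w \<notin> solid436" unfolding solid436_def mem_Collect_eq cone_pt_in_cube[OF E p]
          using z by linarith
        thus ?thesis using False z by auto
      qed
      thus "ennreal (sqrt 3 / (2 * m - z * n)\<^sup>2) * indicator ?S (?pt z y w) =
        ennreal (sqrt 3 / (2 * m - z * n)\<^sup>2) * indicator {0..R} z"
        by (simp add: indicator_def)
    qed
    also have "\<dots> = ennreal (sqrt 3 * (R / (2 * m * (2 * m - R * n))))"
      by (rule cone_kernel_integral) (use m n R0 Rn' in auto)
    also have "R / (2 * m * (2 * m - R * n)) = 3 * A / (2 * m ^ 3)"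
    proof -
      have "6 * A * m / d / (2 * m * (2 * m ^ 3 / d)) = 3 * A / (2 * m ^ 3)" if "d > 0" for d
        using m that by (simp add: field_simps)
      from this[OF D] show ?thesis unfolding Rn by (simp add: R_def)
    qed
    finally show ?thesis using True unfolding SH by (simp add: m_def n_def mult_ac)
  next
    case False
    hence yw: "y < 0 \<or> w < 0" using y0 w0 by auto
    have "(\<integral>\<^sup>+z. ennreal (sqrt 3 / (2 * (1 + y + w) - z * (1 + y\<^sup>2 + w\<^sup>2))\<^sup>2) *
       indicator (?S \<inter> hspace) (?pt z y w) \<partial>lborel) = (\<integral>\<^sup>+(z::real). 0 \<partial>lborel)"
    proof (rule nn_integral_cong_AE, rule AE_mp[OF AE_lborel_singleton[of 0]], rule AE_I2, rule impI)
      fix z :: real assume z: "z \<noteq> 0"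
      have "?pt z y w \<notin> solid436" unfolding solid436_def mem_Collect_eq cone_pt_in_cube[OF E p]
        using z yw by (smt (verit) mult_pos_neg)
      thus "ennreal (sqrt 3 / (2 * (1 + y + w) - z * (1 + y\<^sup>2 + w\<^sup>2))\<^sup>2) *
       indicator (?S \<inter> hspace) (?pt z y w) = 0" by simp
    qed
    thus ?thesis using yw by auto
  qed
  have w_int: "(\<integral>\<^sup>+w. ennreal (3 * sqrt 3 * A / (2 * (1 + y + w) ^ 3)) * indicator {0..} w \<partial>lborel)
      = ennreal (3 * sqrt 3 * A / (4 * (1 + y)\<^sup>2))" if y: "y \<ge> 0" for y :: real
  proof -
    have "(\<integral>\<^sup>+w. ennreal (3 * sqrt 3 * A / (2 * (1 + y + w) ^ 3)) * indicator {0..} w \<partial>lborel)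
      = ennreal (0 - (- (3 * sqrt 3 * A / (4 * (1 + y + 0)\<^sup>2))))"
    proof (rule nn_integral_FTC_atLeast)
      fix w :: real assume w: "0 \<le> w"
      show "((\<lambda>w. - (3 * sqrt 3 * A / (4 * (1 + y + w)\<^sup>2))) has_real_derivative
         3 * sqrt 3 * A / (2 * (1 + y + w) ^ 3)) (at w)"
      proof -
        have "((\<lambda>t. - (3 * sqrt 3 * A / 4 / t\<^sup>2)) has_real_derivative
           2 * (3 * sqrt 3 * A / 4) / (1 + y + w) ^ 3) (at (w + (1 + y)))"
          using deriv_inverse_square[of "1 + y + w" "3 * sqrt 3 * A / 4"] y w by (simp add: add_ac)
        thus ?thesis unfolding DERIV_shift by (simp add: add_ac mult_ac)
      qed
      show "0 \<le> 3 * sqrt 3 * A / (2 * (1 + y + w) ^ 3)" using A y w by simp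
    next
      have "filterlim (\<lambda>w. (1 + y) + w) at_top at_top"
        by (intro filterlim_tendsto_add_at_top[OF tendsto_const] filterlim_ident)
      hence "filterlim (\<lambda>w. 4 * (1 + y + w)\<^sup>2) at_top at_top"
        by (intro filterlim_tendsto_pos_mult_at_top[OF tendsto_const] filterlim_pow_at_top) auto
      hence "((\<lambda>w. 3 * sqrt 3 * A / (4 * (1 + y + w)\<^sup>2)) \<longlongrightarrow> 0) at_top"
        by (intro real_tendsto_divide_at_top[OF tendsto_const])
      thus "((\<lambda>w. - (3 * sqrt 3 * A / (4 * (1 + y + w)\<^sup>2))) \<longlongrightarrow> 0) at_top"
        using tendsto_minus by fastforce
    qed simp
    thus ?thesis by simp
  qed
  have "emeasure hvolume ?S = (\<integral>\<^sup>+y. \<integral>\<^sup>+w. ennreal (3 * sqrt 3 * A / (2 * (1 + y + w) ^ 3))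
      * indicator {0..} y * indicator {0..} w \<partial>lborel \<partial>lborel)"
  proof (subst emeasure_hvolume_cone[OF E p], simp, rule nn_integral_cong_AE,
      rule AE_mp[OF AE_lborel_singleton[of 0]], rule AE_I2, rule impI, rule nn_integral_cong_AE,
      rule AE_mp[OF AE_lborel_singleton[of 0]], rule AE_I2, rule impI)
  qed (rule inner)
  also have "\<dots> = (\<integral>\<^sup>+y. ennreal (3 * sqrt 3 * A / (4 * (1 + y)\<^sup>2)) * indicator {0..} y \<partial>lborel)"
    using w_int by (auto intro!: nn_integral_cong split: split_indicator)
  also have "\<dots> = ennreal (0 - (- (3 * sqrt 3 * A / (4 * (1 + 0)))))"
  proof (rule nn_integral_FTC_atLeast)
    fix w :: real assume w: "0 \<le> w"
    show "((\<lambda>w. - (3 * sqrt 3 * A / (4 * (1 + w)))) has_real_derivative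
       3 * sqrt 3 * A / (4 * (1 + w)\<^sup>2)) (at w)"
      using w by (auto intro!: derivative_eq_intros simp: power2_eq_square divide_simps algebra_simps)
    show "0 \<le> 3 * sqrt 3 * A / (4 * (1 + w)\<^sup>2)" using A w by simp
  next
    have "filterlim (\<lambda>w. 1 + w) at_top (at_top :: real filter)"
      by (intro filterlim_tendsto_add_at_top[OF tendsto_const] filterlim_ident)
    hence "filterlim (\<lambda>w. 4 * (1 + w)) at_top (at_top :: real filter)"
      by (intro filterlim_tendsto_pos_mult_at_top[OF tendsto_const]) auto
    hence "((\<lambda>w. 3 * sqrt 3 * A / (4 * (1 + w))) \<longlongrightarrow> 0) at_top"
      by (intro real_tendsto_divide_at_top[OF tendsto_const])
    thus "((\<lambda>w. - (3 * sqrt 3 * A / (4 * (1 + w)))) \<longlongrightarrow> 0) at_top"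
      using tendsto_minus by fastforce
  qed simp
  finally show ?thesis by simp
qed

section \<open>The volume of the cube as a single integral\<close>

definition ordered_region :: "3 \<Rightarrow> 3 \<Rightarrow> 3 \<Rightarrow> real^3 \<Rightarrow> (real^3) set" where
  "ordered_region i j k E = {x \<in> solid436. E $ i * x $ i < E $ j * x $ j \<and> E $ j * x $ j < E $ k * x $ k}"

lemma ordered_region_borel [measurable]: "ordered_region i j k E \<in> sets borel"
proof -
  have "ordered_region i j k E = solid436 \<inter>
      ({x. E $ i * x $ i < E $ j * x $ j} \<inter> {x. E $ j * x $ j < E $ k * x $ k})"
    by (auto simp: ordered_region_def)
  also have "\<dots> \<in> sets borel"
    by (intro sets.Int solid436_borel borel_open open_Collect_less continuous_intros)
  finally show ?thesis .
qed

lemma square_less_self: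
  fixes u :: real
  assumes "0 < u" "u < 1"
  shows "u\<^sup>2 < u"
  using mult_strict_left_mono[OF assms(2,1)] by (simp add: power2_eq_square)

text \<open>In this chamber the depths \<open>z\<close>, \<open>z * y\<close>, \<open>z * w\<close>
  decrease, and \<open>w = y * t\<close> turns the chamber into a product of intervals. Of the
  opposite faces only \<open>z \<le> 2\<close> remains as a condition, and the ray stays inside the
  ball up to there.\<close>

lemma cone_pt_ordered_iff:
  assumes E: "E \<in> verts436" and p: "is_perm3 i j k" and z: "z \<noteq> 0" and y: "y \<noteq> 0" and t: "t \<noteq> 0"
  shows "cone_pt i j k E z y (y * t) \<in> ordered_region i j k E \<inter> hspace \<longleftrightarrow>
     0 < z \<and> z \<le> 2 \<and> 0 < y \<and> y < 1 \<and> 0 < t \<and> t < 1"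
proof -
  let ?x = "cone_pt i j k E z y (y * t)"
  have eq_third: "a = (1 - b) / 3" if "1 - 3 * a = b" for a b :: real
    using that by simp
  have 1: "E $ i * ?x $ i = (1 - z) / 3" "E $ j * ?x $ j = (1 - z * y) / 3"
     "E $ k * ?x $ k = (1 - z * (y * t)) / 3"
    by (rule eq_third, rule cone_pt_coord[OF E p])+
  have 2: "?x \<in> ordered_region i j k E \<longleftrightarrow> 0 \<le> z \<and> z \<le> 2 \<and> 0 \<le> z * y \<and> z * y \<le> 2 \<and>
      0 \<le> z * (y * t) \<and> z * (y * t) \<le> 2 \<and> z * y < z \<and> z * (y * t) < z * y"
    unfolding ordered_region_def solid436_def mem_Collect_eq cone_pt_in_cube[OF E p] 1 by auto
  show ?thesis
  proof
    assume "?x \<in> ordered_region i j k E \<inter> hspace"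
    hence *: "0 \<le> z" "z \<le> 2" "0 \<le> z * y" "0 \<le> z * (y * t)" "z * y < z" "z * (y * t) < z * y"
      using 2 by auto
    have z0: "z > 0" using * z by simp
    moreover have y0: "y > 0" using * z0 y by (simp add: zero_le_mult_iff)
    moreover have "t > 0" using * z0 y0 t by (simp add: zero_le_mult_iff)
    moreover have "y < 1" using *(5) z0 by simp
    moreover have "t < 1" using *(6) z0 y0 by simp
    ultimately show "0 < z \<and> z \<le> 2 \<and> 0 < y \<and> y < 1 \<and> 0 < t \<and> t < 1" using * by simp
  next
    assume *: "0 < z \<and> z \<le> 2 \<and> 0 < y \<and> y < 1 \<and> 0 < t \<and> t < 1"
    have yt: "y * t < 1" using * mult_strict_mono[of y 1 t 1] by simp
    have "z * y \<le> 2 * 1" "z * (y * t) \<le> 2 * 1" using * yt by (intro mult_mono; simp)+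
    hence "?x \<in> ordered_region i j k E" unfolding 2 using * by simp
    moreover have "?x \<in> hspace"
    proof -
      have "z * (1 + y\<^sup>2 + (y * t)\<^sup>2) \<le> 2 * (1 + y\<^sup>2 + (y * t)\<^sup>2)"
        using * by (intro mult_right_mono) (auto intro!: add_nonneg_nonneg)
      also have "\<dots> < 2 * (1 + y + y * t)"
      proof -
        have "y\<^sup>2 < y" using * by (intro square_less_self) auto
        moreover have "(y * t)\<^sup>2 < y * t" using * yt by (intro square_less_self) auto
        ultimately show ?thesis by simp
      qed
      finally have "0 < z * (2 * (1 + y + y * t) - z * (1 + y\<^sup>2 + (y * t)\<^sup>2)) / 3" using * by simp
      thus ?thesis unfolding cone_pt_norm[OF E p, symmetric] hspace_iff by simp
    qed
    ultimately show "?x \<in> ordered_region i j k E \<inter> hspace" by blast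
  qed
qed

text \<open>At \<open>z = 2\<close> the denominator contains \<open>m - n\<close>, which has the
  factor \<open>y\<close>; the Jacobian of \<open>w = y * t\<close> removes it. The interval for
  \<open>y\<close> is closed to suit the fundamental theorem of calculus, the one for
  \<open>t\<close> open because the logarithms below need \<open>0 < t < 1\<close>.\<close>

lemma ordered_region_inner:
  fixes y t :: real
  assumes E: "E \<in> verts436" and p: "is_perm3 i j k" and y: "y \<notin> {0, 1}" and t: "t \<notin> {0, 1}"
  shows "ennreal \<bar>y\<bar> * (\<integral>\<^sup>+z. ennreal (sqrt 3 / (2 * (1 + y + y * t) - z * (1 + y\<^sup>2 + (y * t)\<^sup>2))\<^sup>2) *
       indicator (ordered_region i j k E \<inter> hspace) (cone_pt i j k E z y (y * t)) \<partial>lborel)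
    = ennreal (sqrt 3 / 2 * (1 / ((1 + (1 + t) * y) * (1 + t - (1 + t\<^sup>2) * y)))) *
        indicator {0..1} y * indicator {0<..<1} t"
proof -
  define m n where "m = 1 + y + y * t" and "n = 1 + y\<^sup>2 + (y * t)\<^sup>2"
  have "(\<integral>\<^sup>+z. ennreal (sqrt 3 / (2 * m - z * n)\<^sup>2) *
       indicator (ordered_region i j k E \<inter> hspace) (cone_pt i j k E z y (y * t)) \<partial>lborel)
     = (\<integral>\<^sup>+z. (ennreal (sqrt 3 / (2 * m - z * n)\<^sup>2) * indicator {0..2} z) *
          (indicator {0..1} y * indicator {0<..<1} t) \<partial>lborel)"
  proof (rule nn_integral_cong_AE, rule AE_mp[OF AE_lborel_singleton[of 0]], rule AE_I2, rule impI)
    fix z :: real assume z: "z \<noteq> 0"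
    have "cone_pt i j k E z y (y * t) \<in> ordered_region i j k E \<inter> hspace \<longleftrightarrow>
        z \<in> {0..2} \<and> y \<in> {0..1} \<and> t \<in> {0<..<1}"
      using cone_pt_ordered_iff[OF E p z, of y t] y t z by fastforce
    thus "ennreal (sqrt 3 / (2 * m - z * n)\<^sup>2) *
       indicator (ordered_region i j k E \<inter> hspace) (cone_pt i j k E z y (y * t)) =
      (ennreal (sqrt 3 / (2 * m - z * n)\<^sup>2) * indicator {0..2} z) *
          (indicator {0..1} y * indicator {0<..<1} t)"
      by (simp add: indicator_def)
  qed
  also have "\<dots> = (\<integral>\<^sup>+z. (ennreal (sqrt 3 / (2 * m - z * n)\<^sup>2) * indicator {0..2} z) \<partial>lborel) *
      (indicator {0..1} y * indicator {0<..<1} t)"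
    by (rule nn_integral_multc) simp
  also have "ennreal \<bar>y\<bar> * \<dots> =
     ennreal (sqrt 3 / 2 * (1 / ((1 + (1 + t) * y) * (1 + t - (1 + t\<^sup>2) * y)))) *
        indicator {0..1} y * indicator {0<..<1} t"
  proof (cases "0 < y \<and> y < 1 \<and> 0 < t \<and> t < 1")
    case True
    have yt: "0 < y * t" "y * t < 1" using True mult_strict_mono[of y 1 t 1] by simp_all
    have m: "m > 0" and n: "n > 0" using True yt by (auto simp: m_def n_def add_pos_nonneg)
    have y2: "y\<^sup>2 < y" using True by (intro square_less_self) auto
    have yt2: "(y * t)\<^sup>2 < y * t" using yt by (intro square_less_self) auto
    have mn: "n < m" using y2 yt2 by (simp add: m_def n_def)
    have mne: "m - n = y * (1 + t - (1 + t\<^sup>2) * y)"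
      by (simp add: m_def n_def power2_eq_square algebra_simps)
    have me: "m = 1 + (1 + t) * y" by (simp add: m_def algebra_simps)
    define c where "c = 1 + t - (1 + t\<^sup>2) * y"
    have "0 < y * c" using mn mne by (simp add: c_def)
    hence c: "c > 0" using True by (simp add: zero_less_mult_iff)
    have "(\<integral>\<^sup>+z. (ennreal (sqrt 3 / (2 * m - z * n)\<^sup>2) * indicator {0..2} z) \<partial>lborel)
      = ennreal (sqrt 3 * (2 / (2 * m * (2 * m - 2 * n))))"
      by (rule cone_kernel_integral) (use m n mn in auto)
    also have "2 * m - 2 * n = 2 * (y * c)" using mne by (simp add: c_def)
    also have "ennreal \<bar>y\<bar> * ennreal (sqrt 3 * (2 / (2 * m * (2 * (y * c))))) =
       ennreal (y * (sqrt 3 * (2 / (2 * m * (2 * (y * c))))))"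
      using True by (simp add: ennreal_mult'[symmetric])
    also have "y * (sqrt 3 * (2 / (2 * m * (2 * (y * c))))) = sqrt 3 / 2 * (1 / (m * c))"
      using True m c by (simp add: field_simps)
    finally show ?thesis using True by (simp add: me c_def)
  next
    case False
    hence "y \<notin> {0..1} \<or> t \<notin> {0<..<1}" using y t by auto
    thus ?thesis by auto
  qed
  finally show ?thesis by (simp add: m_def n_def)
qed

text \<open>Partial fractions in \<open>y\<close>, with \<open>a = 1 + t\<close> and
  \<open>b = 1 + t\<^sup>2\<close>: the quadratic comes from
  \<open>a\<^sup>2 + b = 2 * (1 + t + t\<^sup>2)\<close>, and the singular logarithms come from the
  value \<open>a - b = t * (1 - t)\<close> at \<open>y = 1\<close>.\<close>

lemma ln_kernel_integral:
  fixes t :: real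
  assumes t: "0 < t" "t < 1"
  shows "(\<integral>\<^sup>+y. ennreal (sqrt 3 / 2 * (1 / ((1 + (1 + t) * y) * (1 + t - (1 + t\<^sup>2) * y)))) * indicator {0..1} y \<partial>lborel)
     = ennreal (sqrt 3 / 4 * ((ln (1 + t) + ln (2 + t) - ln t - ln (1 - t)) / (1 + t + t\<^sup>2)))"
proof -
  define a b where "a = 1 + t" and "b = 1 + t\<^sup>2"
  have ab: "a > 0" "b > 0" "a > b" "a\<^sup>2 + b = 2 * (1 + t + t\<^sup>2)"
    using t by (auto simp: a_def b_def power2_eq_square algebra_simps add_pos_nonneg)
  have abn: "a\<^sup>2 + b \<noteq> 0" using ab by (smt (verit) zero_le_power2)
  let ?F = "\<lambda>y. sqrt 3 / 2 * ((ln (1 + a * y) - ln (a - b * y)) / (a\<^sup>2 + b))"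
  have "(\<integral>\<^sup>+y. ennreal (sqrt 3 / 2 * (1 / ((1 + a * y) * (a - b * y)))) * indicator {0..1} y \<partial>lborel)
     = ennreal (?F 1 - ?F 0)"
  proof (rule nn_integral_FTC_Icc)
    fix y :: real assume y: "y \<in> {0..1}"
    have 1: "1 + a * y > 0" using y ab by (simp add: add_pos_nonneg)
    have "b * y \<le> b * 1" using y ab(2) by (intro mult_left_mono) auto
    hence 2: "a - b * y > 0" using ab(3) by linarith
    have "(?F has_real_derivative sqrt 3 / 2 * ((a / (1 + a * y) - (- b) / (a - b * y)) / (a\<^sup>2 + b))) (at y)"
      using 1 2 abn by (auto intro!: derivative_eq_intros)
    also have "a / (1 + a * y) - (- b) / (a - b * y) = (a\<^sup>2 + b) / ((1 + a * y) * (a - b * y))"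
      using 1 2 by (simp add: divide_simps) (simp add: power2_eq_square algebra_simps)
    also have "(a\<^sup>2 + b) / ((1 + a * y) * (a - b * y)) / (a\<^sup>2 + b) = 1 / ((1 + a * y) * (a - b * y))"
      using abn by simp
    finally show "(?F has_real_derivative sqrt 3 / 2 * (1 / ((1 + a * y) * (a - b * y)))) (at y)" .
    show "0 \<le> sqrt 3 / 2 * (1 / ((1 + a * y) * (a - b * y)))" using 1 2 by simp
  qed auto
  also have "?F 1 - ?F 0 = sqrt 3 / 2 * ((ln (1 + a) - ln (a - b) + ln a) / (a\<^sup>2 + b))"
    by (simp add: diff_divide_distrib add_divide_distrib algebra_simps)
  also have "ln (a - b) = ln t + ln (1 - t)"
    using t by (subst ln_mult_pos[symmetric]) (auto simp: a_def b_def power2_eq_square algebra_simps)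
  also have "a\<^sup>2 + b = 2 * (1 + t + t\<^sup>2)" by (rule ab)
  also have "ln (1 + a) - (ln t + ln (1 - t)) + ln a = ln (1 + t) + ln (2 + t) - ln t - ln (1 - t)"
    by (simp add: a_def)
  also have "sqrt 3 / 2 * (x / (2 * k)) = sqrt 3 / 4 * (x / k)" for x k :: real
    by simp
  finally show ?thesis unfolding a_def b_def .
qed

definition cube_integrand :: "real \<Rightarrow> real" where
  "cube_integrand t = (ln (1 + t) + ln (2 + t) - ln t - ln (1 - t)) / (1 + t + t\<^sup>2)"

lemma cube_integrand_measurable [measurable]: "cube_integrand \<in> borel_measurable borel"
  unfolding cube_integrand_def by measurable

lemma emeasure_ordered_region:
  assumes E: "E \<in> verts436" and p: "is_perm3 i j k"
  shows "emeasure hvolume (ordered_region i j k E) =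
    (\<integral>\<^sup>+t. ennreal (sqrt 3 / 4 * cube_integrand t) * indicator {0<..<1} t \<partial>lborel)"
proof -
  let ?K = "\<lambda>y w z. ennreal (sqrt 3 / (2 * (1 + y + w) - z * (1 + y\<^sup>2 + w\<^sup>2))\<^sup>2) *
       indicator (ordered_region i j k E \<inter> hspace) (cone_pt i j k E z y w)"
  let ?k = "\<lambda>y t. ennreal (sqrt 3 / 2 * (1 / ((1 + (1 + t) * y) * (1 + t - (1 + t\<^sup>2) * y)))) *
        indicator {0..1} y * indicator {0<..<1} (t :: real)"
  have ne: "AE y in lborel. y \<notin> {0, 1 :: real}"
    using AE_lborel_singleton[of "0::real"] AE_lborel_singleton[of "1::real"] by eventually_elim auto
  have "emeasure hvolume (ordered_region i j k E) = (\<integral>\<^sup>+y. \<integral>\<^sup>+w. \<integral>\<^sup>+z. ?K y w z \<partial>lborel \<partial>lborel \<partial>lborel)"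
    by (rule emeasure_hvolume_cone[OF E p]) simp
  also have "\<dots> = (\<integral>\<^sup>+y. \<integral>\<^sup>+t. ?k y t \<partial>lborel \<partial>lborel)"
  proof (rule nn_integral_cong_AE, rule AE_mp[OF ne], rule AE_I2, rule impI)
    fix y :: real assume y: "y \<notin> {0, 1}"
    have "(\<integral>\<^sup>+w. \<integral>\<^sup>+z. ?K y w z \<partial>lborel \<partial>lborel) = ennreal \<bar>y\<bar> * (\<integral>\<^sup>+t. \<integral>\<^sup>+z. ?K y (0 + y * t) z \<partial>lborel \<partial>lborel)"
      using y by (subst nn_integral_real_affine[where t = 0 and c = y]) auto
    also have "\<dots> = (\<integral>\<^sup>+t. ennreal \<bar>y\<bar> * (\<integral>\<^sup>+z. ?K y (y * t) z \<partial>lborel) \<partial>lborel)"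
      by (simp add: nn_integral_cmult)
    also have "\<dots> = (\<integral>\<^sup>+t. ?k y t \<partial>lborel)"
      by (rule nn_integral_cong_AE, rule AE_mp[OF ne], rule AE_I2, rule impI)
         (rule ordered_region_inner[OF E p y])
    finally show "(\<integral>\<^sup>+w. \<integral>\<^sup>+z. ?K y w z \<partial>lborel \<partial>lborel) = (\<integral>\<^sup>+t. ?k y t \<partial>lborel)" .
  qed
  also have "\<dots> = (\<integral>\<^sup>+t. \<integral>\<^sup>+y. ?k y t \<partial>lborel \<partial>lborel)"
    by (rule lborel_pair.Fubini') measurable
  also have "\<dots> = (\<integral>\<^sup>+t. ennreal (sqrt 3 / 4 * cube_integrand t) * indicator {0<..<1} t \<partial>lborel)"
  proof (rule nn_integral_cong)
    fix t :: real
    show "(\<integral>\<^sup>+y. ?k y t \<partial>lborel) = ennreal (sqrt 3 / 4 * cube_integrand t) * indicator {0<..<1} t"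
      using ln_kernel_integral[of t] by (cases "t \<in> {0<..<1}") (auto simp: cube_integrand_def)
  qed
  finally show ?thesis .
qed

text \<open>Makes the walls between the six chambers negligible.\<close>

lemma AE_inner_neq:
  fixes a :: "'a :: euclidean_space"
  assumes "a \<noteq> 0"
  shows "AE x in lborel. a \<bullet> x \<noteq> c"
proof -
  have "{x. a \<bullet> x = c} \<in> null_sets lebesgue"
    using negligible_hyperplane[of a c] assms by (simp add: negligible_iff_null_sets)
  hence "{x. a \<bullet> x = c} \<in> null_sets lborel"
    using null_sets_completion_iff[of "{x. a \<bullet> x = c}" lborel]
    by (simp add: borel_closed closed_hyperplane)
  thus ?thesis by (rule AE_I'[where N = "{x. a \<bullet> x = c}"]) auto
qed

text \<open>The volume of a chamber does not depend on the order of the axes, so the constant is six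
  times \<open>sqrt 3 / 4\<close>.\<close>

lemma emeasure_solid436:
  "emeasure hvolume solid436 = ennreal (3 * sqrt 3 / 2) * (\<integral>\<^sup>+t. ennreal (cube_integrand t) * indicator {0<..<1} t \<partial>lborel)"
proof -
  define E :: "real^3" where "E = (\<chi> i. 1 / sqrt 3)"
  have E: "E \<in> verts436" by (simp add: E_def verts436_def)
  let ?d = "\<lambda>x :: real^3. ennreal (1 / (1 - x \<bullet> x)\<^sup>2)"
  let ?R = "\<lambda>i j k. ordered_region i j k E \<inter> hspace"
  let ?I = "\<integral>\<^sup>+t. ennreal (sqrt 3 / 4 * cube_integrand t) * indicator {0<..<1} t \<partial>lborel"
  have R: "(\<integral>\<^sup>+x. ?d x * indicator (?R i j k) x \<partial>lborel) = ?I" if "is_perm3 i j k" for i j k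
    by (subst emeasure_hvolume[symmetric]) (simp_all add: emeasure_ordered_region[OF E that])
  have ne: "AE x in lborel. E $ i * x $ i \<noteq> E $ j * x $ j" if "i \<noteq> j" for i j :: 3
  proof -
    have "axis i (E $ i) - axis j (E $ j) \<noteq> 0"
      using that by (auto simp: vec_eq_iff axis_def E_def)
    from AE_inner_neq[OF this, of 0] show ?thesis
      by (simp add: inner_diff_left inner_axis' )
  qed
  have "emeasure hvolume solid436 = (\<integral>\<^sup>+x. ?d x * indicator (solid436 \<inter> hspace) x \<partial>lborel)"
    by (rule emeasure_hvolume) simp
  also have "\<dots> = (\<integral>\<^sup>+x. ?d x * indicator (?R 1 2 3) x + (?d x * indicator (?R 1 3 2) x +
      (?d x * indicator (?R 2 1 3) x + (?d x * indicator (?R 2 3 1) x +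
      (?d x * indicator (?R 3 1 2) x + ?d x * indicator (?R 3 2 1) x)))) \<partial>lborel)"
  proof (rule nn_integral_cong_AE)
    have "AE x :: real^3 in lborel. E $ 1 * x $ 1 \<noteq> E $ 2 * x $ 2 \<and> E $ 2 * x $ 2 \<noteq> E $ 3 * x $ 3 \<and> E $ 1 * x $ 1 \<noteq> E $ 3 * x $ 3"
      using ne[of 1 2] ne[of 2 3] ne[of 1 3] by auto
    thus "AE x in lborel. ?d x * indicator (solid436 \<inter> hspace) x = ?d x * indicator (?R 1 2 3) x + (?d x * indicator (?R 1 3 2) x +
      (?d x * indicator (?R 2 1 3) x + (?d x * indicator (?R 2 3 1) x +
      (?d x * indicator (?R 3 1 2) x + ?d x * indicator (?R 3 2 1) x))))"
    proof eventually_elim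
      case (elim x)
      consider "E $ 1 * x $ 1 < E $ 2 * x $ 2" "E $ 2 * x $ 2 < E $ 3 * x $ 3"
        | "E $ 1 * x $ 1 < E $ 3 * x $ 3" "E $ 3 * x $ 3 < E $ 2 * x $ 2"
        | "E $ 2 * x $ 2 < E $ 1 * x $ 1" "E $ 1 * x $ 1 < E $ 3 * x $ 3"
        | "E $ 2 * x $ 2 < E $ 3 * x $ 3" "E $ 3 * x $ 3 < E $ 1 * x $ 1"
        | "E $ 3 * x $ 3 < E $ 1 * x $ 1" "E $ 1 * x $ 1 < E $ 2 * x $ 2"
        | "E $ 3 * x $ 3 < E $ 2 * x $ 2" "E $ 2 * x $ 2 < E $ 1 * x $ 1"
        using elim by linarith
      thus ?case by cases (auto simp: ordered_region_def indicator_def)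
    qed
  qed
  also have "\<dots> = ?I + (?I + (?I + (?I + (?I + ?I))))"
    by (simp add: nn_integral_add R is_perm3_def)
  also have "?I = ennreal (sqrt 3 / 4) * (\<integral>\<^sup>+t. ennreal (cube_integrand t) * indicator {0<..<1} t \<partial>lborel)"
  proof -
    have "ennreal (sqrt 3 / 4 * c) = ennreal (sqrt 3 / 4) * ennreal c" for c
      by (rule ennreal_mult') simp
    thus ?thesis by (simp only: mult.assoc) (rule nn_integral_cmult, measurable)
  qed
  finally show ?thesis
    by (simp add: distrib_right[symmetric] ennreal_plus[symmetric] del: ennreal_plus)
qed

section \<open>Evaluation of the integral\<close>

text \<open>Precomposition with negation reduces this to an increasing substitution. The integrands
  need to match only inside the interval, because the logarithmic identities may fail at its end
  points.\<close>

lemma nn_integral_substitution_antimono: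
  fixes f :: "real \<Rightarrow> ennreal"
  assumes f: "f \<in> borel_measurable borel"
    and deriv: "\<And>x. x \<in> {a..b} \<Longrightarrow> (g has_real_derivative - g' x) (at x)"
    and cont: "continuous_on {a..b} g'"
    and nonneg: "\<And>x. x \<in> {a..b} \<Longrightarrow> 0 \<le> g' x"
    and ab: "a < b"
    and h: "h \<in> borel_measurable borel"
    and eq: "\<And>x. x \<in> {a<..<b} \<Longrightarrow> f (g x) * ennreal (g' x) = h x"
  shows "(\<integral>\<^sup>+x. f x * indicator {g b..g a} x \<partial>lborel) = (\<integral>\<^sup>+x. h x * indicator {a..b} x \<partial>lborel)"
proof -
  note [measurable] = h
  have "(\<integral>\<^sup>+x. f x * indicator {g (- (- b))..g (- (- a))} x \<partial>lborel)
      = (\<integral>\<^sup>+x. f (g (- x)) * ennreal (g' (- x)) * indicator {- b..- a} x \<partial>lborel)"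
  proof (rule nn_integral_substitution_aux[OF f, where g = "\<lambda>x. g (- x)" and g' = "\<lambda>x. g' (- x)"])
    fix x assume x: "x \<in> {- b..- a}"
    have "((\<lambda>x. g (- x)) has_real_derivative (- g' (- x)) * (- 1)) (at x)"
      by (rule DERIV_chain2[OF deriv]) (use x in \<open>auto intro!: derivative_eq_intros\<close>)
    thus "((\<lambda>x. g (- x)) has_real_derivative g' (- x)) (at x)" by simp
    show "0 \<le> g' (- x)" using x by (intro nonneg) auto
  next
    show "continuous_on {- b..- a} (\<lambda>x. g' (- x))"
      by (rule continuous_on_compose2[OF cont]) (auto intro!: continuous_intros)
  qed (use ab in auto)
  also have "\<dots> = (\<integral>\<^sup>+x. h (- x) * indicator {- b..- a} x \<partial>lborel)"
  proof (rule nn_integral_cong_AE)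
    show "AE x in lborel. f (g (- x)) * ennreal (g' (- x)) * indicator {- b..- a} x = h (- x) * indicator {- b..- a} x"
      using AE_lborel_singleton[of "- a"] AE_lborel_singleton[of "- b"]
    proof eventually_elim
      case (elim x)
      show ?case
      proof (cases "x \<in> {- b..- a}")
        case True
        hence "- x \<in> {a<..<b}" using elim by auto
        from eq[OF this] show ?thesis by simp
      qed simp
    qed
  qed
  also have "\<dots> = (\<integral>\<^sup>+x. h x * indicator {a..b} x \<partial>lborel)"
  proof -
    have "indicator {a..b} (0 + - 1 * x) = (indicator {- b..- a} x :: ennreal)" for x
      by (auto split: split_indicator)
    thus ?thesis
      using nn_integral_real_affine[of "\<lambda>x. h x * indicator {a..b} x" "- 1" 0] by simp
  qed
  finally show ?thesis by simp
qed

lemma nn_integral_substitution_mono: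
  fixes f :: "real \<Rightarrow> ennreal"
  assumes f: "f \<in> borel_measurable borel"
    and deriv: "\<And>x. x \<in> {a..b} \<Longrightarrow> (g has_real_derivative g' x) (at x)"
    and cont: "continuous_on {a..b} g'"
    and nonneg: "\<And>x. x \<in> {a..b} \<Longrightarrow> 0 \<le> g' x"
    and ab: "a < b"
    and eq: "\<And>x. x \<in> {a<..<b} \<Longrightarrow> f (g x) * ennreal (g' x) = h x"
  shows "(\<integral>\<^sup>+x. f x * indicator {g a..g b} x \<partial>lborel) = (\<integral>\<^sup>+x. h x * indicator {a..b} x \<partial>lborel)"
proof -
  have "(\<integral>\<^sup>+x. f x * indicator {g a..g b} x \<partial>lborel)
      = (\<integral>\<^sup>+x. f (g x) * ennreal (g' x) * indicator {a..b} x \<partial>lborel)"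
    by (rule nn_integral_substitution_aux[OF f _ deriv cont nonneg ab]) simp_all
  also have "\<dots> = (\<integral>\<^sup>+x. h x * indicator {a..b} x \<partial>lborel)"
  proof (rule nn_integral_cong_AE)
    show "AE x in lborel. f (g x) * ennreal (g' x) * indicator {a..b} x = h x * indicator {a..b} x"
      using AE_lborel_singleton[of a] AE_lborel_singleton[of b]
    proof eventually_elim
      case (elim x)
      show ?case
      proof (cases "x \<in> {a..b}")
        case True
        hence "x \<in> {a<..<b}" using elim by auto
        from eq[OF this] show ?thesis by simp
      qed simp
    qed
  qed
  finally show ?thesis .
qed

lemma quadratic_pos:
  fixes t :: real
  shows "1 + t + t\<^sup>2 > 0" "1 - t + t\<^sup>2 > 0"
proof -
  have "1 + t + t\<^sup>2 = (t + 1/2)\<^sup>2 + 3/4" "1 - t + t\<^sup>2 = (t - 1/2)\<^sup>2 + 3/4"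
    by (simp_all add: power2_eq_square field_simps)
  moreover have "(t + 1/2)\<^sup>2 \<ge> 0" "(t - 1/2)\<^sup>2 \<ge> 0" by simp_all
  ultimately show "1 + t + t\<^sup>2 > 0" "1 - t + t\<^sup>2 > 0" by linarith+
qed

section \<open>Relations between logarithmic integrals over the unit interval\<close>

definition log_int :: "(real \<Rightarrow> real) \<Rightarrow> ennreal" where
  "log_int f = (\<integral>\<^sup>+t. ennreal (f t) * indicator {0..1} t \<partial>lborel)"

lemma log_int_cong:
  assumes "\<And>t. 0 < t \<Longrightarrow> t < 1 \<Longrightarrow> f t = g t"
  shows "log_int f = log_int g"
  unfolding log_int_def
proof (rule nn_integral_cong_AE)
  show "AE t in lborel. ennreal (f t) * indicator {0..1} t = ennreal (g t) * indicator {0..1} t"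
    using AE_lborel_singleton[of "0 :: real"] AE_lborel_singleton[of "1 :: real"]
  proof eventually_elim
    case (elim t)
    thus ?case using assms[of t] by (auto split: split_indicator)
  qed
qed

lemma log_int_add:
  assumes [measurable]: "f \<in> borel_measurable borel" "g \<in> borel_measurable borel"
    and "\<And>t. 0 < t \<Longrightarrow> t < 1 \<Longrightarrow> 0 \<le> f t" "\<And>t. 0 < t \<Longrightarrow> t < 1 \<Longrightarrow> 0 \<le> g t"
  shows "log_int (\<lambda>t. f t + g t) = log_int f + log_int g"
  unfolding log_int_def
proof (subst nn_integral_add[symmetric], simp, simp, rule nn_integral_cong_AE)
  show "AE t in lborel. ennreal (f t + g t) * indicator {0..1} t
     = ennreal (f t) * indicator {0..1} t + ennreal (g t) * indicator {0..1} t"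
    using AE_lborel_singleton[of "0 :: real"] AE_lborel_singleton[of "1 :: real"]
  proof eventually_elim
    case (elim t)
    thus ?case using assms(3,4)[of t] by (auto split: split_indicator)
  qed
qed

lemma log_int_double:
  assumes [measurable]: "f \<in> borel_measurable borel"
  shows "log_int (\<lambda>t. 2 * f t) = 2 * log_int f"
proof -
  have "ennreal (2 * c) = 2 * ennreal c" for c
    by (simp add: ennreal_mult')
  thus ?thesis
    unfolding log_int_def by (simp only: mult.assoc) (rule nn_integral_cmult, measurable)
qed

text \<open>The map \<open>(1 - t) / (1 + 2 * t)\<close> is an involution of the unit interval that
  swaps the complex roots of \<open>1 + t + t\<^sup>2\<close>. Hence it preserves the form
  \<open>dt / (1 + t + t\<^sup>2)\<close> up to orientation, and it takes
  \<open>(2 + t) / (1 - t)\<close> to \<open>(1 + t) / t\<close>.\<close>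

lemma log_int_reflect:
  "log_int (\<lambda>t. (ln (2 + t) - ln (1 - t)) / (1 + t + t\<^sup>2)) = log_int (\<lambda>t. (ln (1 + t) - ln t) / (1 + t + t\<^sup>2))"
proof -
  let ?g = "\<lambda>t :: real. (1 - t) / (1 + 2 * t)"
  let ?g' = "\<lambda>t :: real. 3 / (1 + 2 * t)\<^sup>2"
  have "(\<integral>\<^sup>+t. ennreal ((ln (2 + t) - ln (1 - t)) / (1 + t + t\<^sup>2)) * indicator {?g 1..?g 0} t \<partial>lborel)
    = (\<integral>\<^sup>+t. ennreal ((ln (1 + t) - ln t) / (1 + t + t\<^sup>2)) * indicator {0..1} t \<partial>lborel)"
  proof (rule nn_integral_substitution_antimono)
    fix t :: real assume t: "t \<in> {0..1}"
    show "(?g has_real_derivative - ?g' t) (at t)"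
      using t by (auto intro!: derivative_eq_intros simp: power2_eq_square divide_simps algebra_simps)
  next
    show "continuous_on {0..1} ?g'" by (auto intro!: continuous_intros)
  next
    fix t :: real assume t: "t \<in> {0<..<1}"
    define d where "d = 1 + 2 * t"
    have d: "d > 0" using t by (simp add: d_def)
    have 1: "2 + ?g t = 3 * (1 + t) / d" "1 - ?g t = 3 * t / d"
      using d by (simp_all add: d_def field_simps)
    have 2: "1 + ?g t + (?g t)\<^sup>2 = 3 * (1 + t + t\<^sup>2) / d\<^sup>2"
    proof -
      have "1 + ?g t + (?g t)\<^sup>2 = (d\<^sup>2 + (1 - t) * d + (1 - t)\<^sup>2) / d\<^sup>2"
        using d unfolding d_def[symmetric] by (simp add: field_simps power2_eq_square)
      also have "d\<^sup>2 + (1 - t) * d + (1 - t)\<^sup>2 = 3 * (1 + t + t\<^sup>2)"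
        by (simp add: d_def power2_eq_square algebra_simps)
      finally show ?thesis .
    qed
    have 3: "ln (2 + ?g t) - ln (1 - ?g t) = ln (1 + t) - ln t"
      unfolding 1 using t d by (simp add: ln_div ln_mult del: distrib_left_numeral)
    have "((ln (2 + ?g t) - ln (1 - ?g t)) / (1 + ?g t + (?g t)\<^sup>2)) * ?g' t
       = (ln (1 + t) - ln t) / (1 + t + t\<^sup>2)"
    proof -
      have "l / (3 * k / d\<^sup>2) * (3 / d\<^sup>2) = l / k" for l k :: real using d by simp
      thus ?thesis unfolding 2 3 unfolding d_def .
    qed
    thus "ennreal ((ln (2 + ?g t) - ln (1 - ?g t)) / (1 + ?g t + (?g t)\<^sup>2)) * ennreal (?g' t)
       = ennreal ((ln (1 + t) - ln t) / (1 + t + t\<^sup>2))"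
      by (subst ennreal_mult''[symmetric]) auto
  qed auto
  thus ?thesis by (simp add: log_int_def)
qed

text \<open>Splitting at \<open>1 / 2\<close>: the lower half is parametrised by
  \<open>t / (1 + t)\<close>, the upper half by \<open>1 / (1 + t)\<close>, and both turn
  \<open>du / (1 - u + u\<^sup>2)\<close> into \<open>dt / (1 + t + t\<^sup>2)\<close> up to
  orientation.\<close>

lemma log_int_halves:
  "log_int (\<lambda>u. - ln u / (1 - u + u\<^sup>2)) =
     log_int (\<lambda>t. (ln (1 + t) - ln t) / (1 + t + t\<^sup>2)) + log_int (\<lambda>t. ln (1 + t) / (1 + t + t\<^sup>2))"
proof -
  let ?f = "\<lambda>u :: real. ennreal (- ln u / (1 - u + u\<^sup>2))"
  have q0: "1 - s / d + (s / d)\<^sup>2 = (d\<^sup>2 - s * d + s\<^sup>2) / d\<^sup>2" if "d \<noteq> 0" for s d :: real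
    using that by (simp add: field_simps power2_eq_square)
  have q: "1 - t / (1 + t) + (t / (1 + t))\<^sup>2 = (1 + t + t\<^sup>2) / (1 + t)\<^sup>2"
    "1 - 1 / (1 + t) + (1 / (1 + t))\<^sup>2 = (1 + t + t\<^sup>2) / (1 + t)\<^sup>2" if "t > 0" for t :: real
  proof -
    have "(1 + t)\<^sup>2 - t * (1 + t) + t\<^sup>2 = 1 + t + t\<^sup>2" "(1 + t)\<^sup>2 - 1 * (1 + t) + 1\<^sup>2 = 1 + t + t\<^sup>2"
      by (simp_all add: power2_eq_square algebra_simps)
    thus "1 - t / (1 + t) + (t / (1 + t))\<^sup>2 = (1 + t + t\<^sup>2) / (1 + t)\<^sup>2"
      "1 - 1 / (1 + t) + (1 / (1 + t))\<^sup>2 = (1 + t + t\<^sup>2) / (1 + t)\<^sup>2"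
      using q0[of "1 + t" t] q0[of "1 + t" 1] that by simp_all
  qed
  have "(\<integral>\<^sup>+u. ?f u * indicator {0 / (1 + 0)..1 / (1 + 1)} u \<partial>lborel)
      = (\<integral>\<^sup>+t. ennreal ((ln (1 + t) - ln t) / (1 + t + t\<^sup>2)) * indicator {0..1} t \<partial>lborel)"
  proof (rule nn_integral_substitution_mono[where g = "\<lambda>t. t / (1 + t)" and g' = "\<lambda>t. 1 / (1 + t)\<^sup>2"])
    fix t :: real assume t: "t \<in> {0..1}"
    show "((\<lambda>t. t / (1 + t)) has_real_derivative 1 / (1 + t)\<^sup>2) (at t)"
      using t by (auto intro!: derivative_eq_intros simp: power2_eq_square divide_simps)
  next
    fix t :: real assume t: "t \<in> {0<..<1}"
    have "- ln (t / (1 + t)) / (1 - t / (1 + t) + (t / (1 + t))\<^sup>2) * (1 / (1 + t)\<^sup>2)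
       = (ln (1 + t) - ln t) / (1 + t + t\<^sup>2)"
      using t by (simp add: q ln_div)
    thus "ennreal (- ln (t / (1 + t)) / (1 - t / (1 + t) + (t / (1 + t))\<^sup>2)) * ennreal (1 / (1 + t)\<^sup>2)
       = ennreal ((ln (1 + t) - ln t) / (1 + t + t\<^sup>2))"
      by (subst ennreal_mult''[symmetric]) auto
  qed (auto intro!: continuous_intros)
  moreover have "(\<integral>\<^sup>+u. ?f u * indicator {1 / (1 + 1)..1 / (1 + 0)} u \<partial>lborel)
      = (\<integral>\<^sup>+t. ennreal (ln (1 + t) / (1 + t + t\<^sup>2)) * indicator {0..1} t \<partial>lborel)"
  proof (rule nn_integral_substitution_antimono[where g = "\<lambda>t. 1 / (1 + t)" and g' = "\<lambda>t. 1 / (1 + t)\<^sup>2"])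
    fix t :: real assume t: "t \<in> {0..1}"
    show "((\<lambda>t. 1 / (1 + t)) has_real_derivative - (1 / (1 + t)\<^sup>2)) (at t)"
      using t by (auto intro!: derivative_eq_intros simp: power2_eq_square divide_simps)
  next
    fix t :: real assume t: "t \<in> {0<..<1}"
    have "- ln (1 / (1 + t)) / (1 - 1 / (1 + t) + (1 / (1 + t))\<^sup>2) * (1 / (1 + t)\<^sup>2)
       = ln (1 + t) / (1 + t + t\<^sup>2)"
      using t by (simp add: q ln_div)
    thus "ennreal (- ln (1 / (1 + t)) / (1 - 1 / (1 + t) + (1 / (1 + t))\<^sup>2)) * ennreal (1 / (1 + t)\<^sup>2)
       = ennreal (ln (1 + t) / (1 + t + t\<^sup>2))"
      by (subst ennreal_mult''[symmetric]) auto
  qed (auto intro!: continuous_intros)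
  moreover have "log_int (\<lambda>u. - ln u / (1 - u + u\<^sup>2)) =
     (\<integral>\<^sup>+u. ?f u * indicator {0..1/2} u \<partial>lborel) + (\<integral>\<^sup>+u. ?f u * indicator {1/2..1} u \<partial>lborel)"
    unfolding log_int_def
  proof (subst nn_integral_add[symmetric], simp, simp, rule nn_integral_cong_AE)
    show "AE u in lborel. ?f u * indicator {0..1} u = ?f u * indicator {0..1/2} u + ?f u * indicator {1/2..1} u"
      using AE_lborel_singleton[of "1/2 :: real"]
      by eventually_elim (auto split: split_indicator)
  qed
  ultimately show ?thesis by (simp add: log_int_def)
qed

text \<open>With \<open>a = 1 + t + t\<^sup>2\<close> and \<open>b = 1 - t + t\<^sup>2\<close>, the
  substitution \<open>t\<^sup>2\<close> produces the denominator \<open>a * b\<close>, and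
  \<open>2 * t / (a * b) = 1 / b - 1 / a\<close>. So the left integral \<open>S\<close> and the
  right integral \<open>D\<close> satisfy \<open>S = 2 * D - 2 * S\<close>; adding
  \<open>2 * S\<close> to both sides avoids the subtraction.\<close>

lemma log_int_square:
  "3 * log_int (\<lambda>t. - ln t / (1 + t + t\<^sup>2)) = 2 * log_int (\<lambda>t. - ln t / (1 - t + t\<^sup>2))"
proof -
  let ?S = "\<lambda>t :: real. - ln t / (1 + t + t\<^sup>2)"
  let ?h = "\<lambda>t :: real. - 4 * t * ln t / ((1 + t + t\<^sup>2) * (1 - t + t\<^sup>2))"
  have "(\<integral>\<^sup>+t. ennreal (?S t) * indicator {0\<^sup>2..1\<^sup>2} t \<partial>lborel) = (\<integral>\<^sup>+t. ennreal (?h t) * indicator {0..1} t \<partial>lborel)"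
  proof (rule nn_integral_substitution_mono[where g' = "\<lambda>t. 2 * t"])
    fix t :: real assume t: "t \<in> {0<..<1}"
    have "1 + t\<^sup>2 + (t\<^sup>2)\<^sup>2 = (1 + t + t\<^sup>2) * (1 - t + t\<^sup>2)"
      by (simp add: power2_eq_square algebra_simps)
    moreover have "ln (t\<^sup>2) = 2 * ln t" using t by (simp add: ln_realpow)
    ultimately have "?S (t\<^sup>2) * (2 * t) = ?h t" by simp
    thus "ennreal (?S (t\<^sup>2)) * ennreal (2 * t) = ennreal (?h t)"
      using t by (subst ennreal_mult''[symmetric]) auto
  qed (auto intro!: derivative_eq_intros continuous_intros)
  hence "log_int ?S = log_int ?h" by (simp add: log_int_def)
  hence "3 * log_int ?S = log_int ?h + 2 * log_int ?S"
  proof -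
    have "3 * x = x + 2 * x" for x :: ennreal
    proof -
      have "3 * x = (1 + 2) * x" by simp
      also have "\<dots> = x + 2 * x" by (simp only: distrib_right mult_1)
      finally show ?thesis .
    qed
    from this[of "log_int ?S"] \<open>log_int ?S = log_int ?h\<close> show ?thesis by simp
  qed
  also have "2 * log_int ?S = log_int (\<lambda>t. 2 * ?S t)"
    by (rule log_int_double[symmetric]) simp
  also have "log_int ?h + log_int (\<lambda>t. 2 * ?S t) = log_int (\<lambda>t. ?h t + 2 * ?S t)"
  proof (rule log_int_add[symmetric])
    fix t :: real assume t: "0 < t" "t < 1"
    have l: "ln t < 0" using t by simp
    have "- 4 * t * ln t > 0" using t l by (simp add: mult_less_0_iff)
    thus "0 \<le> ?h t" using quadratic_pos[of t] by (intro divide_nonneg_pos mult_pos_pos) auto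
    show "0 \<le> 2 * ?S t" using quadratic_pos[of t] l by (simp add: divide_nonpos_pos)
  qed simp_all
  also have "\<dots> = log_int (\<lambda>t. 2 * (- ln t / (1 - t + t\<^sup>2)))"
  proof (rule log_int_cong)
    fix t :: real
    have "- 4 * t * l / (a * b) + 2 * (- l / a) = 2 * (- l / b)"
      if "a > 0" "b > 0" "a = b + 2 * t" for a b l :: real
    proof -
      have "2 * (- l / b) = - 2 * l * a / (a * b)" "2 * (- l / a) = - 2 * l * b / (a * b)"
        using that(1,2) by simp_all
      moreover have "- 4 * t * l + - 2 * l * b = - 2 * l * a" by (simp add: that(3) algebra_simps)
      ultimately show ?thesis by (metis add_divide_distrib)
    qed
    from this[OF quadratic_pos] show "?h t + 2 * ?S t = 2 * (- ln t / (1 - t + t\<^sup>2))" by simp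
  qed
  also have "\<dots> = 2 * log_int (\<lambda>t. - ln t / (1 - t + t\<^sup>2))"
    by (rule log_int_double) simp
  finally show ?thesis .
qed

section \<open>Rational enclosure of the remaining integral\<close>

lemma has_integral_ln_power:
  "((\<lambda>t. - ln t * t ^ k) has_integral 1 / (real k + 1)\<^sup>2) {0..1::real}"
proof -
  define n where "n = real k + 1"
  have n: "n > 0" by (simp add: n_def)
  let ?F = "\<lambda>t :: real. t ^ (k + 1) / n\<^sup>2 - t ^ (k + 1) * ln t / n"
  have "continuous (at x within {0..1}) (\<lambda>t. t * ln t)" if x: "x \<in> {0..1}" for x :: real
  proof (cases "x = 0")
    case True
    have "\<forall>\<^sub>F t :: real in at 0 within {0..1}. norm (t * ln t) \<le> 2 * sqrt t"
      unfolding eventually_at_filter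
    proof (rule always_eventually, intro allI impI)
      fix t :: real assume t: "t \<noteq> 0" "t \<in> {0..1}"
      \<comment> \<open>Taking the square root first lets the crude bound
        \<open>ln x \<le> x\<close> give the majorant \<open>2 * sqrt t\<close>, which tends to
        \<open>0\<close>.\<close>
      have "- ln t = 2 * ln (1 / sqrt t)" using t by (simp add: ln_div ln_sqrt)
      also have "\<dots> \<le> 2 * (1 / sqrt t)" using t ln_le_minus_one[of "1 / sqrt t"] by simp
      finally have "t * (- ln t) \<le> t * (2 * (1 / sqrt t))" using t by (intro mult_left_mono) auto
      also have "\<dots> = 2 * (t / sqrt t)" by simp
      also have "t / sqrt t = sqrt t" using t by (simp add: real_div_sqrt)
      finally have "t * (- ln t) \<le> 2 * sqrt t" .
      moreover have "norm (t * ln t) = t * (- ln t)"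
      proof -
        have "\<bar>t\<bar> = t" "\<bar>ln t\<bar> = - ln t" using t by auto
        thus ?thesis by (simp only: real_norm_def abs_mult)
      qed
      ultimately show "norm (t * ln t) \<le> 2 * sqrt t" by linarith
    qed
    moreover have "((\<lambda>t :: real. 2 * sqrt t) \<longlongrightarrow> 2 * sqrt 0) (at 0 within {0..1})"
      by (intro tendsto_intros)
    hence "((\<lambda>t :: real. 2 * sqrt t) \<longlongrightarrow> 0) (at 0 within {0..1})" by simp
    ultimately have "((\<lambda>t :: real. t * ln t) \<longlongrightarrow> 0) (at 0 within {0..1})"
      by (rule Lim_null_comparison)
    thus ?thesis using True by (simp add: continuous_within)
  next
    case False
    hence "x > 0" using x by simp
    from DERIV_isCont[OF DERIV_mult[OF DERIV_ident DERIV_ln[OF this]]] show ?thesis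
      by (rule continuous_at_imp_continuous_at_within)
  qed
  hence "continuous_on {0..1} (\<lambda>t :: real. t * ln t)"
    unfolding continuous_on_eq_continuous_within by blast
  hence "continuous_on {0..1} (\<lambda>t :: real. t ^ k * (t * ln t))"
    by (rule continuous_on_mult[OF continuous_on_power[OF continuous_on_id]])
  moreover have "(\<lambda>t :: real. t ^ k * (t * ln t)) = (\<lambda>t. t ^ (k + 1) * ln t)"
    by (rule ext) simp
  ultimately have "continuous_on {0..1} (\<lambda>t :: real. t ^ (k + 1) * ln t)"
    by (simp only:)
  hence "continuous_on {0..1} ?F"
    using n by (intro continuous_on_diff continuous_on_divide[OF _ continuous_on_const]
        continuous_on_power[OF continuous_on_id]) simp_all
  moreover have "(?F has_vector_derivative - ln t * t ^ k) (at t)" if t: "t \<in> {0<..<1}" for t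
  proof -
    have "((\<lambda>t. t ^ (k + 1)) has_real_derivative n * t ^ k) (at t)"
      using DERIV_pow[of "k + 1" t UNIV] by (simp add: n_def add.commute)
    moreover have "(ln has_real_derivative 1 / t) (at t)"
      using t by (intro DERIV_ln_divide) simp
    ultimately have "((\<lambda>t. t ^ (k + 1) / n\<^sup>2 - t ^ (k + 1) * ln t / n) has_real_derivative
       n * t ^ k / n\<^sup>2 - (n * t ^ k * ln t + 1 / t * t ^ (k + 1)) / n) (at t)"
      using DERIV_diff[OF DERIV_cdivide DERIV_cdivide[OF DERIV_mult]] by blast
    moreover have "n * t ^ k / n\<^sup>2 - (n * t ^ k * ln t + 1 / t * t ^ (k + 1)) / n = - ln t * t ^ k"
    proof -
      have "n * p / n\<^sup>2 - (n * p * l + p) / n = - l * p" for p l :: real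
        using n by (simp add: power2_eq_square add_divide_distrib)
      moreover have "1 / t * t ^ (k + 1) = t ^ k" using t by simp
      ultimately show ?thesis by (simp only:)
    qed
    ultimately show ?thesis
      unfolding has_real_derivative_iff_has_vector_derivative by (simp only:)
  qed
  ultimately have "((\<lambda>t. - ln t * t ^ k) has_integral (?F 1 - ?F 0)) {0..1}"
    by (intro fundamental_theorem_of_calculus_interior) auto
  thus ?thesis by (simp add: n_def)
qed

lemma log_int_has_integral:
  assumes "(f has_integral I) {0..1}" "\<And>t. 0 \<le> t \<Longrightarrow> t \<le> 1 \<Longrightarrow> 0 \<le> f t"
  shows "log_int f = ennreal I"
proof -
  have "log_int f = (\<integral>\<^sup>+t. ennreal (indicator {0..1} t * f t) \<partial>lborel)"
    unfolding log_int_def by (intro nn_integral_cong) (auto split: split_indicator)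
  also have "\<dots> = ennreal I"
    by (rule nn_integral_has_integral_lebesgue) (use assms in auto)
  finally show ?thesis .
qed

lemma log_int_mono:
  assumes "\<And>t. 0 < t \<Longrightarrow> t < 1 \<Longrightarrow> f t \<le> g t"
  shows "log_int f \<le> log_int g"
  unfolding log_int_def
proof (rule nn_integral_mono_AE)
  show "AE t in lborel. ennreal (f t) * indicator {0..1} t \<le> ennreal (g t) * indicator {0..1} t"
    using AE_lborel_singleton[of "0 :: real"] AE_lborel_singleton[of "1 :: real"]
  proof eventually_elim
    case (elim t)
    thus ?case using assms[of t] by (auto intro: ennreal_leI split: split_indicator)
  qed
qed

text \<open>These are the coefficients, cleared of the denominator \<open>3 ^ 5\<close>, of five
  terms of a geometric series for \<open>1 / (1 + t + t\<^sup>2)\<close>, expanded so that it can be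
  integrated termwise against \<open>- ln t\<close>. An odd number of terms makes the polynomial an
  upper bound. With five terms the error bound \<open>1 / 48 ^ 5\<close> is below
  \<open>4 / 10 ^ 9\<close>; the bound \<open>1 / 48 ^ 4\<close> for four terms exceeds
  \<open>10 ^ (-7)\<close> and would be too coarse.\<close>

definition approx_coeffs :: "real list" where
  "approx_coeffs = [243, -243, 0, 243, -243, 0, 243, -243, 0, 243, -242, -11, 298, -407, 319, -164, 55, -11, 1]"

definition approx_poly :: "real \<Rightarrow> real" where
  "approx_poly t = (\<Sum>k<19. approx_coeffs ! k * t ^ k) / 243"

lemma approx_poly_eq:
  "approx_poly t = (t\<^sup>2 - 3 * t + 3) / 3 * (\<Sum>j<5. (- ((t * (1 - t))\<^sup>2 / 3)) ^ j)"
proof -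
  define g where "g = (t * (1 - t))\<^sup>2"
  have "(t\<^sup>2 - 3 * t + 3) / 3 * (\<Sum>j<5. (- (g / 3)) ^ j)
    = (t\<^sup>2 - 3 * t + 3) * (81 - 27 * g + 9 * g ^ 2 - 3 * g ^ 3 + g ^ 4) / 243"
    by (simp add: eval_nat_numeral field_simps)
  also have "(t\<^sup>2 - 3 * t + 3) * (81 - 27 * g + 9 * g ^ 2 - 3 * g ^ 3 + g ^ 4)
    = 243 - 243 * t + 243 * t^3 - 243 * t^4 + 243 * t^6 - 243 * t^7 + 243 * t^9 - 242 * t^10
      - 11 * t^11 + 298 * t^12 - 407 * t^13 + 319 * t^14 - 164 * t^15 + 55 * t^16 - 11 * t^17 + t^18"
    unfolding g_def by algebra
  also have "\<dots> / 243 = approx_poly t"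
    unfolding approx_poly_def approx_coeffs_def by (simp add: eval_nat_numeral)
  finally show ?thesis by (simp add: g_def)
qed

text \<open>
  The ratio \<open>- (t * (1 - t))\<^sup>2 / 3\<close> of the geometric series equals \<open>1\<close> at the roots of
  \<open>1 + t + t\<^sup>2\<close>, so that the quotient of \<open>1\<close> minus the ratio by \<open>1 + t + t\<^sup>2\<close> is a polynomial, and it is
  at most \<open>1 / 48\<close> in absolute value on the unit interval.
\<close>

lemma approx_poly_bounds:
  fixes t :: real
  assumes t: "0 \<le> t" "t \<le> 1"
  shows "approx_poly t - 1 / 48 ^ 5 \<le> 1 / (1 + t + t\<^sup>2)" "1 / (1 + t + t\<^sup>2) \<le> approx_poly t"
proof -
  define q where "q = (t * (1 - t))\<^sup>2 / 3"
  define K where "K = 1 + t + t\<^sup>2"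
  have K: "K \<ge> 1" using t by (simp add: K_def)
  have q0: "q \<ge> 0" by (simp add: q_def)
  have "t * (1 - t) \<le> 1 / 4"
  proof -
    have "0 \<le> (t - 1 / 2)\<^sup>2" by simp
    thus ?thesis by (simp add: power2_eq_square field_simps)
  qed
  hence "(t * (1 - t))\<^sup>2 \<le> (1 / 4)\<^sup>2" using t by (intro power_mono) auto
  also have "(1 / 4 :: real)\<^sup>2 = 1 / 16" by (simp add: power2_eq_square)
  finally have q1: "q \<le> 1 / 48" unfolding q_def by linarith
  have "K * ((t\<^sup>2 - 3 * t + 3) / 3) = 1 + q"
    by (simp add: K_def q_def power2_eq_square field_simps)
  hence "K * approx_poly t = (1 + q) * (\<Sum>j<5. (- q) ^ j)"
    unfolding approx_poly_eq q_def[symmetric] by (metis mult.assoc)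
  also have "\<dots> = 1 + q ^ 5" by (simp add: eval_nat_numeral algebra_simps)
  finally have "approx_poly t = (1 + q ^ 5) / K" using K by (simp add: field_simps)
  hence e: "approx_poly t = 1 / K + q ^ 5 / K" by (simp add: add_divide_distrib)
  have "q ^ 5 / K \<le> q ^ 5 / 1" using K q0 by (intro divide_left_mono) auto
  also have "q ^ 5 \<le> (1 / 48) ^ 5" using q1 q0 by (intro power_mono) auto
  finally have "q ^ 5 / K \<le> 1 / 48 ^ 5" by (simp add: power_divide)
  moreover have "q ^ 5 / K \<ge> 0" using K q0 by simp
  ultimately show "approx_poly t - 1 / 48 ^ 5 \<le> 1 / (1 + t + t\<^sup>2)" "1 / (1 + t + t\<^sup>2) \<le> approx_poly t"
    using e by (simp_all add: K_def)
qed

lemma has_integral_approx: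
  "((\<lambda>t. - ln t * approx_poly t) has_integral 1062889886133797 / 1360407785733360) {0..1}"
proof -
  have "((\<lambda>t. \<Sum>k<19. (- ln t * t ^ k) * (approx_coeffs ! k / 243)) has_integral
     (\<Sum>k<19. 1 / (real k + 1)\<^sup>2 * (approx_coeffs ! k / 243))) {0..1}"
    by (intro has_integral_sum has_integral_mult_left has_integral_ln_power) auto
  also have "(\<Sum>k<19. 1 / (real k + 1)\<^sup>2 * (approx_coeffs ! k / 243)) = 1062889886133797 / 1360407785733360"
    unfolding approx_coeffs_def by (simp add: eval_nat_numeral)
  also have "(\<lambda>t. \<Sum>k<19. (- ln t * t ^ k) * (approx_coeffs ! k / 243)) = (\<lambda>t. - ln t * approx_poly t)"
    unfolding approx_poly_def by (simp add: sum_distrib_left sum_divide_distrib mult_ac)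
  finally show ?thesis .
qed

text \<open>The integral of \<open>- ln t\<close> is \<open>1\<close>, so the uniform error of the
  polynomial carries over unchanged to \<open>s\<close>. The decimal fraction is the exact rational
  integral rounded down.\<close>

lemma log_int_ln_bounds:
  obtains s where "log_int (\<lambda>t. - ln t / (1 + t + t\<^sup>2)) = ennreal s"
    "781302413 / 10 ^ 9 - 1 / 48 ^ 5 \<le> s" "s \<le> 1062889886133797 / 1360407785733360"
proof -
  let ?S = "log_int (\<lambda>t. - ln t / (1 + t + t\<^sup>2))"
  let ?I = "1062889886133797 / 1360407785733360 :: real"
  have ap: "approx_poly t \<ge> 0" "- ln t \<ge> 0" if t: "0 \<le> t" "t \<le> 1" for t
  proof -
    have "0 \<le> 1 / (1 + t + t\<^sup>2)" using quadratic_pos[of t] by simp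
    thus "approx_poly t \<ge> 0" using approx_poly_bounds(2)[OF t] by linarith
    show "- ln t \<ge> 0" using t by (cases "t = 0") simp_all
  qed
  have 1: "log_int (\<lambda>t. - ln t * approx_poly t) = ennreal ?I"
    by (rule log_int_has_integral[OF has_integral_approx], rule mult_nonneg_nonneg) (use ap in auto)
  have "log_int (\<lambda>t. - ln t * t ^ 0) = ennreal (1 / (real 0 + 1)\<^sup>2)"
    by (rule log_int_has_integral[OF has_integral_ln_power]) (use ap in auto)
  hence one: "log_int (\<lambda>t. - ln t) = 1" by simp
  have up: "?S \<le> ennreal ?I" unfolding 1[symmetric]
  proof (rule log_int_mono)
    fix t :: real assume t: "0 < t" "t < 1"
    thus "- ln t / (1 + t + t\<^sup>2) \<le> - ln t * approx_poly t"
      using mult_left_mono[OF approx_poly_bounds(2)[of t], of "- ln t"] by simp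
  qed
  then obtain s where s: "?S = ennreal s" "s \<ge> 0" by (cases ?S) (auto simp: top_unique)
  have "ennreal ?I \<le> log_int (\<lambda>t. - ln t / (1 + t + t\<^sup>2) + 1 / 48 ^ 5 * (- ln t))" unfolding 1[symmetric]
  proof (rule log_int_mono)
    fix t :: real assume t: "0 < t" "t < 1"
    have "- ln t * (approx_poly t - 1 / 48 ^ 5) \<le> - ln t * (1 / (1 + t + t\<^sup>2))"
      using approx_poly_bounds(1)[of t] t by (intro mult_left_mono) auto
    thus "- ln t * approx_poly t \<le> - ln t / (1 + t + t\<^sup>2) + 1 / 48 ^ 5 * (- ln t)"
      by (simp add: algebra_simps)
  qed
  also have "\<dots> = ?S + log_int (\<lambda>t. 1 / 48 ^ 5 * (- ln t))"
  proof (rule log_int_add)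
    fix t :: real assume t: "0 < t" "t < 1"
    have l: "- ln t \<ge> 0" using t by simp
    show "0 \<le> - ln t / (1 + t + t\<^sup>2)" by (rule divide_nonneg_pos[OF l quadratic_pos(1)])
    show "0 \<le> 1 / 48 ^ 5 * (- ln t)" using l by (intro mult_nonneg_nonneg) simp_all
  qed simp_all
  also have "log_int (\<lambda>t. 1 / 48 ^ 5 * (- ln t)) = ennreal (1 / 48 ^ 5)"
  proof -
    have "((\<lambda>t. 1 / 48 ^ 5 * (- ln t)) has_integral (1 / 48 ^ 5 * 1)) {0..1::real}"
      using has_integral_ln_power[of 0] by (intro has_integral_mult_right) simp
    from log_int_has_integral[OF this] ap(2) show ?thesis by simp
  qed
  also have "?S + ennreal (1 / 48 ^ 5) = ennreal (s + 1 / 48 ^ 5)" using s by simp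
  finally have "?I \<le> s + 1 / 48 ^ 5" using s by (subst (asm) ennreal_le_iff) auto
  moreover have "s \<le> ?I" using up s by (simp add: ennreal_le_iff)
  ultimately show ?thesis using that[of s] s by simp
qed

text \<open>Let \<open>D\<close> be the integral of \<open>- ln u / (1 - u + u\<^sup>2)\<close>. The
  cube integral is \<open>2 * A\<close>, and the relations \<open>A = S + C\<close>,
  \<open>D = A + C\<close>, \<open>3 * S = 2 * D\<close> give
  \<open>4 * A = 2 * (A + C) + 2 * S = 5 * S\<close>.\<close>

lemma log_int_cube_integrand:
  "2 * log_int cube_integrand = 5 * log_int (\<lambda>t. - ln t / (1 + t + t\<^sup>2))"
proof -
  define S A C where "S = log_int (\<lambda>t. - ln t / (1 + t + t\<^sup>2))"
    and "A = log_int (\<lambda>t. (ln (1 + t) - ln t) / (1 + t + t\<^sup>2))"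
    and "C = log_int (\<lambda>t. ln (1 + t) / (1 + t + t\<^sup>2))"
  have nn: "0 \<le> - ln t / (1 + t + t\<^sup>2)" "0 \<le> ln (1 + t) / (1 + t + t\<^sup>2)"
    "0 \<le> (ln (1 + t) - ln t) / (1 + t + t\<^sup>2)" "0 \<le> (ln (2 + t) - ln (1 - t)) / (1 + t + t\<^sup>2)"
    if t: "0 < t" "t < 1" for t :: real
    using t quadratic_pos(1)[of t] by (simp_all add: divide_nonpos_pos)
  have AC: "A = S + C"
  proof -
    have "A = log_int (\<lambda>t. - ln t / (1 + t + t\<^sup>2) + ln (1 + t) / (1 + t + t\<^sup>2))"
      unfolding A_def by (rule log_int_cong) (simp add: diff_divide_distrib)
    also have "\<dots> = S + C" unfolding S_def C_def
      by (rule log_int_add, simp, simp, erule (1) nn, erule (1) nn)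
    finally show ?thesis .
  qed
  have "log_int cube_integrand = log_int (\<lambda>t. (ln (1 + t) - ln t) / (1 + t + t\<^sup>2) +
      (ln (2 + t) - ln (1 - t)) / (1 + t + t\<^sup>2))"
    by (rule log_int_cong) (simp add: cube_integrand_def add_divide_distrib diff_divide_distrib)
  also have "\<dots> = A + A"
    unfolding A_def
    by (subst log_int_add, simp, simp, erule (1) nn, erule (1) nn, simp add: log_int_reflect)
  finally have "2 * log_int cube_integrand = 2 * (A + C) + 2 * S"
    using AC by (simp add: distrib_left mult_2 add_ac)
  also have "2 * (A + C) = 3 * S"
    using log_int_square log_int_halves by (simp add: A_def S_def C_def)
  also have "3 * S + 2 * S = 5 * S"
    by (simp add: distrib_right[symmetric])
  finally show ?thesis by (simp add: S_def)
qed

lemma emeasure_solid436_bounds: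
  obtains s where "emeasure hvolume solid436 = ennreal (15 * sqrt 3 / 4 * s)" "s > 0"
    "\<bar>2 / (3 * s) - 0.85327609\<bar> \<le> 5 / 10 ^ 9"
proof -
  obtain s where s: "log_int (\<lambda>t. - ln t / (1 + t + t\<^sup>2)) = ennreal s"
    "781302413 / 10 ^ 9 - 1 / 48 ^ 5 \<le> s" "s \<le> 1062889886133797 / 1360407785733360"
    by (rule log_int_ln_bounds)
  have s0: "s > 0" by (rule less_le_trans[OF _ s(2)]) simp
  have i: "2 * log_int cube_integrand = ennreal (5 * s)"
    unfolding log_int_cube_integrand s(1) using s0 by (simp add: ennreal_mult')
  \<comment> \<open>The factor \<open>2\<close> is cancelled in the reals, after an infinite
    integral has been excluded.\<close>
  have I: "log_int cube_integrand = ennreal (5 / 2 * s)"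
  proof (cases "log_int cube_integrand")
    case (real x)
    hence "ennreal (2 * x) = ennreal (5 * s)" using i by (simp add: ennreal_mult')
    hence "2 * x = 5 * s" using real s0 by (subst (asm) ennreal_inj) auto
    thus ?thesis using real by simp
  qed (use i in \<open>simp add: ennreal_mult_top\<close>)
  have "(\<integral>\<^sup>+t. ennreal (cube_integrand t) * indicator {0<..<1} t \<partial>lborel) = log_int cube_integrand"
    unfolding log_int_def
  proof (rule nn_integral_cong_AE)
    show "AE t in lborel. ennreal (cube_integrand t) * indicator {0<..<1} t = ennreal (cube_integrand t) * indicator {0..1} t"
      using AE_lborel_singleton[of "0 :: real"] AE_lborel_singleton[of "1 :: real"]
      by eventually_elim (auto split: split_indicator)
  qed
  hence "emeasure hvolume solid436 = ennreal (3 * sqrt 3 / 2) * ennreal (5 / 2 * s)"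
    by (simp only: emeasure_solid436 I)
  also have "\<dots> = ennreal (15 * sqrt 3 / 4 * s)"
    using s0 by (subst ennreal_mult[symmetric]) simp_all
  finally have vol: "emeasure hvolume solid436 = ennreal (15 * sqrt 3 / 4 * s)" .
  have "2 / (3 * s) \<le> 0.85327609 + 5 / 10 ^ 9"
  proof -
    have "2 \<le> (0.85327609 + 5 / 10 ^ 9) * (3 * (781302413 / 10 ^ 9 - 1 / 48 ^ 5 :: real))" by simp
    also have "\<dots> \<le> (0.85327609 + 5 / 10 ^ 9) * (3 * s)" using s(2) by (intro mult_left_mono) auto
    finally show ?thesis using s0 by (simp add: pos_divide_le_eq)
  qed
  moreover have "0.85327609 - 5 / 10 ^ 9 \<le> 2 / (3 * s)"
  proof -
    have "(0.85327609 - 5 / 10 ^ 9) * (3 * s) \<le> (0.85327609 - 5 / 10 ^ 9) * (3 * (1062889886133797 / 1360407785733360))"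
      using s(3) by (intro mult_left_mono) auto
    also have "\<dots> \<le> 2" by simp
    finally show ?thesis using s0 by (simp add: pos_le_divide_eq)
  qed
  ultimately have "\<bar>2 / (3 * s) - 0.85327609\<bar> \<le> 5 / 10 ^ 9" by linarith
  thus ?thesis using that vol s0 by blast
qed

section \<open>Tangency of horoballs\<close>

lemma vert_norm:
  assumes "E \<in> verts436"
  shows "E \<bullet> E = 1" "norm E = 1"
proof -
  have p: "is_perm3 1 2 3" by (simp add: is_perm3_def)
  show "E \<bullet> E = 1"
    unfolding inner_vec_def sum_perm3[OF p] inner_real_def vert_nth(2)[OF assms] by simp
  thus "norm E = 1" by (simp add: norm_eq_1)
qed

lemma horoball_eq_hball:
  assumes E: "norm E = 1"
  shows "horoball E c = hball E (exp (2 * c))"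
proof -
  have "busemann E x \<le> c \<longleftrightarrow> (1 - x \<bullet> E)\<^sup>2 \<le> exp (2 * c) * (1 - x \<bullet> x)" if x: "x \<in> hspace" for x
  proof -
    have w: "1 - x \<bullet> x > 0" using x by (simp add: hspace_iff)
    have "\<bar>x \<bullet> E\<bar> < 1"
      using Cauchy_Schwarz_ineq2[of x E] x E by (simp add: hspace_def)
    hence X: "1 - x \<bullet> E > 0" by simp
    have "busemann E x \<le> c \<longleftrightarrow> (1 - x \<bullet> E) / sqrt (1 - x \<bullet> x) \<le> exp c"
    proof -
      have v: "(1 - x \<bullet> E) / sqrt (1 - x \<bullet> x) > 0" using w X by simp
      show ?thesis unfolding busemann_eq[OF E x] using exp_le_cancel_iff exp_ln[OF v] by metis
    qed
    also have "\<dots> \<longleftrightarrow> 1 - x \<bullet> E \<le> exp c * sqrt (1 - x \<bullet> x)"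
      using w by (simp add: pos_divide_le_eq)
    also have "\<dots> \<longleftrightarrow> (1 - x \<bullet> E)\<^sup>2 \<le> (exp c * sqrt (1 - x \<bullet> x))\<^sup>2"
      using X w by (intro power_mono_iff[symmetric]) auto
    also have "(exp c * sqrt (1 - x \<bullet> x))\<^sup>2 = exp (2 * c) * (1 - x \<bullet> x)"
      using w by (simp add: power_mult_distrib exp_double)
    finally show ?thesis .
  qed
  thus ?thesis by (auto simp: horoball_def hball_def)
qed

lemma inner_lt_1:
  fixes x E :: "real^3"
  assumes "x \<in> hspace" "norm E = 1"
  shows "1 - x \<bullet> E > 0"
  using Cauchy_Schwarz_ineq2[of x E] assms by (simp add: hspace_def)

lemma inner_unit_lt_1:
  fixes E F :: "real^3"
  assumes "norm E = 1" "norm F = 1" "E \<noteq> F"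
  shows "1 - E \<bullet> F > 0"
proof -
  have "0 < (E - F) \<bullet> (E - F)" using assms(3) by simp
  also have "(E - F) \<bullet> (E - F) = E \<bullet> E + F \<bullet> F - 2 * (E \<bullet> F)"
    by (simp add: inner_diff inner_commute)
  finally show ?thesis using assms by (simp add: norm_eq_1)
qed

text \<open>
  Decompose the timelike vector \<open>(1, x)\<close> as a combination of the lightlike vectors \<open>(1, E)\<close> and
  \<open>(1, F)\<close> plus a remainder orthogonal to both, whose Minkowski square is nonnegative.
\<close>

lemma inner_product_levels:
  fixes x E F :: "real^3"
  assumes EF: "E \<bullet> E = 1" "F \<bullet> F = 1" and g: "1 - E \<bullet> F > 0"
  defines "g \<equiv> 1 - E \<bullet> F" and "X \<equiv> 1 - x \<bullet> E" and "Y \<equiv> 1 - x \<bullet> F"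
  defines "s \<equiv> x - (Y / g) *\<^sub>R E - (X / g) *\<^sub>R F"
  shows "g / 2 * (s \<bullet> s) \<le> 2 * X * Y / g - (1 - x \<bullet> x)"
    "s = 0 \<Longrightarrow> (1 - x \<bullet> x) * g = 2 * X * Y \<Longrightarrow> X + Y = g"
proof -
  define a b where "a = Y / g" and "b = X / g"
  have g0: "g > 0" using g by (simp add: g_def)
  have ag: "a * g = Y" "b * g = X" using g0 by (simp_all add: a_def b_def)
  have FE: "F \<bullet> E = 1 - g" "E \<bullet> F = 1 - g" by (simp_all add: g_def inner_commute)
  have xE: "x \<bullet> E = 1 - b * g" "E \<bullet> x = 1 - b * g" using ag by (simp_all add: X_def inner_commute)
  have xF: "x \<bullet> F = 1 - a * g" "F \<bullet> x = 1 - a * g" using ag by (simp_all add: Y_def inner_commute)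
  have s: "s = x - a *\<^sub>R E - b *\<^sub>R F" by (simp add: s_def a_def b_def)
  have sE: "s \<bullet> E = 1 - a - b" by (simp add: s inner_simps EF FE xE xF algebra_simps)
  have sF: "s \<bullet> F = 1 - a - b" by (simp add: s inner_simps EF FE xE xF algebra_simps)
  have "s \<bullet> s = x \<bullet> x - a * (1 - b * g) - b * (1 - a * g) - a * (s \<bullet> E) - b * (s \<bullet> F)"
    by (simp add: s inner_simps EF FE xE xF algebra_simps inner_commute)
  hence ss: "s \<bullet> s - (1 - a - b)\<^sup>2 = 2 * a * b * g - (1 - x \<bullet> x)"
    unfolding sE sF by (simp add: power2_eq_square algebra_simps)
  \<comment> \<open>Cauchy-Schwarz against \<open>E + F\<close>, whose square
    \<open>4 - 2 * g\<close> is less than \<open>4\<close>. The slack becomes the term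
    \<open>g / 2 * (s \<bullet> s)\<close>, which forces \<open>s = 0\<close> when two horoballs
    touch.\<close>
  have "s \<bullet> (E + F) = 2 * (1 - a - b)" unfolding inner_add_right sE sF by simp
  hence "(2 * (1 - a - b))\<^sup>2 = (s \<bullet> (E + F))\<^sup>2" by (simp only:)
  also have "\<dots> \<le> (s \<bullet> s) * ((E + F) \<bullet> (E + F))" by (rule Cauchy_Schwarz_ineq)
  also have "(E + F) \<bullet> (E + F) = 4 - 2 * g" by (simp add: inner_simps EF FE)
  finally have "(1 - a - b)\<^sup>2 \<le> (s \<bullet> s) * (1 - g / 2)" by (simp add: power2_eq_square algebra_simps)
  moreover have abg: "2 * a * b * g = 2 * X * Y / g"
    using g0 by (simp add: a_def b_def)
  ultimately show "g / 2 * (s \<bullet> s) \<le> 2 * X * Y / g - (1 - x \<bullet> x)"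
    using ss by (simp add: algebra_simps)
  assume s0: "s = 0" and w: "(1 - x \<bullet> x) * g = 2 * X * Y"
  hence "1 - x \<bullet> x = 2 * X * Y / g" using g0 by (simp add: field_simps)
  hence "(1 - a - b)\<^sup>2 = 0" using ss s0 abg by simp
  hence "(1 - a - b) * g = 0" by simp
  thus "X + Y = g" using ag by (simp add: algebra_simps)
qed

text \<open>The point of the geodesic from \<open>E\<close> to \<open>F\<close> at which
  \<open>1 - x \<bullet> E\<close> and \<open>1 - x \<bullet> F\<close> are in the ratio of
  \<open>a\<close> to \<open>b\<close>, as they are at a common boundary point of the two
  horoballs.\<close>

definition touch_pt :: "real^3 \<Rightarrow> real \<Rightarrow> real^3 \<Rightarrow> real \<Rightarrow> real^3" where
  "touch_pt E a F b = (1 / (a + b)) *\<^sub>R (b *\<^sub>R E + a *\<^sub>R F)"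

lemma touch_pt_levels:
  assumes EF: "norm E = 1" "norm F = 1" and ab: "a > 0" "b > 0"
  shows "1 - touch_pt E a F b \<bullet> E = a * (1 - E \<bullet> F) / (a + b)"
    "1 - touch_pt E a F b \<bullet> F = b * (1 - E \<bullet> F) / (a + b)"
    "1 - touch_pt E a F b \<bullet> touch_pt E a F b = 2 * a * b * (1 - E \<bullet> F) / (a + b)\<^sup>2"
proof -
  have 1: "E \<bullet> E = 1" "F \<bullet> F = 1" using EF by (simp_all add: norm_eq_1)
  have FE: "F \<bullet> E = E \<bullet> F" by (rule inner_commute)
  have s: "a + b > 0" using ab by simp
  show "1 - touch_pt E a F b \<bullet> E = a * (1 - E \<bullet> F) / (a + b)"
    "1 - touch_pt E a F b \<bullet> F = b * (1 - E \<bullet> F) / (a + b)"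
  proof -
    have "touch_pt E a F b \<bullet> E = (b + a * (E \<bullet> F)) / (a + b)"
      "touch_pt E a F b \<bullet> F = (a + b * (E \<bullet> F)) / (a + b)"
      by (simp_all add: touch_pt_def inner_simps 1 FE add_divide_distrib)
    thus "1 - touch_pt E a F b \<bullet> E = a * (1 - E \<bullet> F) / (a + b)"
      "1 - touch_pt E a F b \<bullet> F = b * (1 - E \<bullet> F) / (a + b)"
      using s by (simp_all add: field_simps)
  qed
  have "touch_pt E a F b \<bullet> touch_pt E a F b = (b * b + 2 * a * b * (E \<bullet> F) + a * a) / (a + b)\<^sup>2"
  proof -
    have "(b *\<^sub>R E + a *\<^sub>R F) \<bullet> (b *\<^sub>R E + a *\<^sub>R F) = b * b + 2 * a * b * (E \<bullet> F) + a * a"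
      by (simp add: inner_simps 1 FE algebra_simps)
    moreover have "touch_pt E a F b \<bullet> touch_pt E a F b = (b *\<^sub>R E + a *\<^sub>R F) \<bullet> (b *\<^sub>R E + a *\<^sub>R F) / (a + b)\<^sup>2"
      by (simp add: touch_pt_def power2_eq_square)
    ultimately show ?thesis by (simp only:)
  qed
  hence "1 - touch_pt E a F b \<bullet> touch_pt E a F b =
      ((a + b)\<^sup>2 - (b * b + 2 * a * b * (E \<bullet> F) + a * a)) / (a + b)\<^sup>2"
    using s by (simp add: diff_divide_distrib)
  also have "(a + b)\<^sup>2 - (b * b + 2 * a * b * (E \<bullet> F) + a * a) = 2 * a * b * (1 - E \<bullet> F)"
    by (simp add: power2_eq_square algebra_simps)
  finally show "1 - touch_pt E a F b \<bullet> touch_pt E a F b = 2 * a * b * (1 - E \<bullet> F) / (a + b)\<^sup>2" .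
qed

text \<open>The strict inequality defines an open set, which exhibits interior points without an
  exact description of the interior.\<close>

definition hball_core :: "real^3 \<Rightarrow> real \<Rightarrow> (real^3) set" where
  "hball_core E A = {x \<in> hspace. (1 - x \<bullet> E)\<^sup>2 < A * (1 - x \<bullet> x)}"

lemma hball_core_subset_interior: "hball_core E A \<subseteq> interior (hball E A)"
proof (rule interior_maximal)
  have "hball_core E A = hspace \<inter> {x. (1 - x \<bullet> E)\<^sup>2 < A * (1 - x \<bullet> x)}" by (auto simp: hball_core_def)
  moreover have "open \<dots>" unfolding hspace_def
    by (intro open_Int open_ball open_Collect_less continuous_intros)
  ultimately show "open (hball_core E A)" by simp
qed (auto simp: hball_core_def hball_def)

text \<open>Multiplying the two horoball inequalities gives
  \<open>X * Y \<le> a * b * w\<^sup>2\<close>, while the lightlike decomposition gives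
  \<open>w\<^sup>2 \<le> 2 * X * Y / g\<close>. A common point thus needs
  \<open>2 * a * b \<ge> g\<close>. In case of equality all estimates are tight, the remainder
  \<open>s\<close> vanishes, and \<open>x\<close> becomes a determined combination of
  \<open>E\<close> and \<open>F\<close>.\<close>

lemma hball_Int_subset:
  assumes EF: "norm E = 1" "norm F = 1" "E \<noteq> F" and ab: "a > 0" "b > 0"
    and le: "a * b \<le> (1 - E \<bullet> F) / 2"
  shows "hball E (a\<^sup>2) \<inter> hball F (b\<^sup>2) \<subseteq> (if a * b = (1 - E \<bullet> F) / 2 then {touch_pt E a F b} else {})"
proof
  fix x assume x: "x \<in> hball E (a\<^sup>2) \<inter> hball F (b\<^sup>2)"
  define g X Y w where "g = 1 - E \<bullet> F" and "X = 1 - x \<bullet> E" and "Y = 1 - x \<bullet> F" and "w = sqrt (1 - x \<bullet> x)"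
  define s where "s = x - (Y / g) *\<^sub>R E - (X / g) *\<^sub>R F"
  have hs: "x \<in> hspace" using x by (simp add: hball_def)
  have w2: "w\<^sup>2 = 1 - x \<bullet> x" and w: "w > 0" using hs by (simp_all add: w_def hspace_iff)
  have XY: "X > 0" "Y > 0" using inner_lt_1[OF hs] EF by (simp_all add: X_def Y_def)
  have g: "g > 0" using inner_unit_lt_1[OF EF] by (simp add: g_def)
  have 1: "E \<bullet> E = 1" "F \<bullet> F = 1" using EF by (simp_all add: norm_eq_1)
  have "X\<^sup>2 \<le> (a * w)\<^sup>2" "Y\<^sup>2 \<le> (b * w)\<^sup>2"
    using x by (simp_all add: hball_def X_def Y_def power_mult_distrib w2)
  hence le1: "X \<le> a * w" "Y \<le> b * w" using ab w by (auto intro: power2_le_imp_le)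
  have le2: "X * Y \<le> (a * w) * (b * w)" using le1 XY by (intro mult_mono) auto
  have "g / 2 * (s \<bullet> s) \<le> 2 * X * Y / g - w\<^sup>2"
    using inner_product_levels(1)[OF 1, of x] g unfolding g_def X_def Y_def s_def w2 by simp
  moreover have "0 \<le> g / 2 * (s \<bullet> s)" using g by (intro mult_nonneg_nonneg) auto
  ultimately have p: "w\<^sup>2 \<le> 2 * X * Y / g" and q: "g / 2 * (s \<bullet> s) \<le> 2 * X * Y / g - w\<^sup>2" by simp_all
  have r: "2 * X * Y / g \<le> (2 * (a * b) / g) * w\<^sup>2"
    using le2 g by (simp add: divide_le_cancel power2_eq_square mult_ac)
  show "x \<in> (if a * b = (1 - E \<bullet> F) / 2 then {touch_pt E a F b} else {})"
  proof (cases "a * b = (1 - E \<bullet> F) / 2")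
    case False
    hence "2 * (a * b) / g < 1" using le g by (simp add: g_def)
    hence "(2 * (a * b) / g) * w\<^sup>2 < 1 * w\<^sup>2" using w by (intro mult_strict_right_mono) auto
    thus ?thesis using p r by simp
  next
    case True
    hence "2 * (a * b) = g" by (simp add: g_def)
    hence "2 * (a * b) / g = 1" using g by simp
    hence "2 * X * Y / g \<le> w\<^sup>2" using r by (simp only: mult_1)
    hence e: "2 * X * Y / g = w\<^sup>2" using p by (rule antisym)
    hence "g / 2 * (s \<bullet> s) \<le> 0" using q by simp
    hence s0: "s = 0" using g by (simp add: mult_le_0_iff not_le) (smt (verit) inner_ge_zero inner_eq_zero_iff)
    have e': "w\<^sup>2 * g = 2 * X * Y" using e g by (simp add: field_simps)
    have XYg: "X + Y = g"
      using inner_product_levels(2)[OF 1, of x] g s0 e' unfolding g_def X_def Y_def s_def w2 by simp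
    have "X * Y = (a * w) * (b * w)"
    proof -
      have "2 * (X * Y) = w\<^sup>2 * (2 * (a * b))" using e' \<open>2 * (a * b) = g\<close> by simp
      thus ?thesis by (simp add: power2_eq_square mult_ac)
    qed
    have "X = a * w"
    proof (rule ccontr)
      assume "X \<noteq> a * w"
      hence "X * Y < (a * w) * Y" using le1 XY by (intro mult_strict_right_mono) auto
      also have "\<dots> \<le> (a * w) * (b * w)" using le1 ab w by (intro mult_left_mono) auto
      finally show False using \<open>X * Y = (a * w) * (b * w)\<close> by simp
    qed
    have "Y = b * w" using \<open>X * Y = (a * w) * (b * w)\<close> \<open>X = a * w\<close> ab w by simp
    have gw: "g = (a + b) * w" using XYg \<open>X = a * w\<close> \<open>Y = b * w\<close> by (simp add: algebra_simps)
    have "Y / g = b / (a + b)" "X / g = a / (a + b)"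
      unfolding gw \<open>X = a * w\<close> \<open>Y = b * w\<close> using w by simp_all
    hence "x = (b / (a + b)) *\<^sub>R E + (a / (a + b)) *\<^sub>R F" using s0 by (simp add: s_def algebra_simps)
    also have "\<dots> = touch_pt E a F b" by (simp add: touch_pt_def scaleR_add_right)
    finally show ?thesis using True by simp
  qed
qed

lemma touch_pt_in_hball:
  assumes EF: "norm E = 1" "norm F = 1" "E \<noteq> F" and ab: "a > 0" "b > 0"
  shows "a * b = (1 - E \<bullet> F) / 2 \<Longrightarrow> touch_pt E a F b \<in> hball E (a\<^sup>2) \<inter> hball F (b\<^sup>2)"
    "a * b > (1 - E \<bullet> F) / 2 \<Longrightarrow> touch_pt E a F b \<in> hball_core E (a\<^sup>2) \<inter> hball_core F (b\<^sup>2)"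
proof -
  define g where "g = 1 - E \<bullet> F"
  let ?x = "touch_pt E a F b"
  have g: "g > 0" using inner_unit_lt_1[OF EF] by (simp add: g_def)
  note lev = touch_pt_levels[OF EF(1,2) ab, folded g_def]
  have s: "a + b > 0" using ab by simp
  have hs: "?x \<in> hspace"
  proof -
    have "1 - ?x \<bullet> ?x > 0" unfolding lev using ab g s by (intro divide_pos_pos mult_pos_pos) auto
    thus ?thesis by (simp add: hspace_iff)
  qed
  have e: "a\<^sup>2 * (1 - ?x \<bullet> ?x) = (a\<^sup>2 * g / (a + b)\<^sup>2) * (2 * (a * b))"
    "(1 - ?x \<bullet> E)\<^sup>2 = (a\<^sup>2 * g / (a + b)\<^sup>2) * g"
    "b\<^sup>2 * (1 - ?x \<bullet> ?x) = (b\<^sup>2 * g / (a + b)\<^sup>2) * (2 * (a * b))"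
    "(1 - ?x \<bullet> F)\<^sup>2 = (b\<^sup>2 * g / (a + b)\<^sup>2) * g"
    unfolding lev by (simp_all add: power_divide power_mult_distrib power2_eq_square mult_ac)
  have p: "a\<^sup>2 * g / (a + b)\<^sup>2 > 0" "b\<^sup>2 * g / (a + b)\<^sup>2 > 0" using ab g s by simp_all
  show "?x \<in> hball E (a\<^sup>2) \<inter> hball F (b\<^sup>2)" if "a * b = (1 - E \<bullet> F) / 2"
  proof -
    have "2 * (a * b) = g" using that by (simp add: g_def)
    thus ?thesis using hs unfolding hball_def Int_iff mem_Collect_eq e by simp
  qed
  show "?x \<in> hball_core E (a\<^sup>2) \<inter> hball_core F (b\<^sup>2)" if "a * b > (1 - E \<bullet> F) / 2"
  proof -
    have "g < 2 * (a * b)" using that by (simp add: g_def)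
    hence "(1 - ?x \<bullet> E)\<^sup>2 < a\<^sup>2 * (1 - ?x \<bullet> ?x)" "(1 - ?x \<bullet> F)\<^sup>2 < b\<^sup>2 * (1 - ?x \<bullet> ?x)"
      unfolding e using p by (intro mult_strict_left_mono; simp)+
    thus ?thesis using hs unfolding hball_core_def by simp
  qed
qed

lemma interior_subset_singleton:
  fixes S :: "(real^3) set"
  assumes "open S" "S \<subseteq> {p}"
  shows "S = {}"
proof (rule ccontr)
  assume "S \<noteq> {}"
  with assms(2) have "S = {p}" by (simp add: subset_singleton_iff)
  thus False using assms(1) not_open_singleton[of p] by simp
qed

text \<open>An open set inside a single point is empty, so mere contact is harmless; beyond contact,
  \<open>touch_pt\<close> is interior to both horoballs.\<close>

lemma interiors_disjoint_iff:
  assumes EF: "norm E = 1" "norm F = 1" "E \<noteq> F" and ab: "a > 0" "b > 0"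
  shows "interior (hball E (a\<^sup>2)) \<inter> interior (hball F (b\<^sup>2)) = {} \<longleftrightarrow> a * b \<le> (1 - E \<bullet> F) / 2"
proof
  assume *: "interior (hball E (a\<^sup>2)) \<inter> interior (hball F (b\<^sup>2)) = {}"
  show "a * b \<le> (1 - E \<bullet> F) / 2"
  proof (rule ccontr)
    assume "\<not> a * b \<le> (1 - E \<bullet> F) / 2"
    hence "touch_pt E a F b \<in> hball_core E (a\<^sup>2) \<inter> hball_core F (b\<^sup>2)"
      by (intro touch_pt_in_hball(2)[OF EF ab]) simp
    thus False using * hball_core_subset_interior[of E "a\<^sup>2"] hball_core_subset_interior[of F "b\<^sup>2"] by blast
  qed
next
  assume "a * b \<le> (1 - E \<bullet> F) / 2"
  from hball_Int_subset[OF EF ab this]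
  have "hball E (a\<^sup>2) \<inter> hball F (b\<^sup>2) \<subseteq> {touch_pt E a F b}"
    by (rule order.trans) simp
  hence "interior (hball E (a\<^sup>2)) \<inter> interior (hball F (b\<^sup>2)) \<subseteq> {touch_pt E a F b}"
    using interior_subset by blast
  thus "interior (hball E (a\<^sup>2)) \<inter> interior (hball F (b\<^sup>2)) = {}"
    by (intro interior_subset_singleton open_Int open_interior)
qed

lemma hball_Int_eq:
  assumes EF: "norm E = 1" "norm F = 1" "E \<noteq> F" and ab: "a > 0" "b > 0"
    and le: "a * b \<le> (1 - E \<bullet> F) / 2"
  shows "hball E (a\<^sup>2) \<inter> hball F (b\<^sup>2) = (if a * b = (1 - E \<bullet> F) / 2 then {touch_pt E a F b} else {})"
proof (cases "a * b = (1 - E \<bullet> F) / 2")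
  case True
  show ?thesis using hball_Int_subset[OF EF ab le] touch_pt_in_hball(1)[OF EF ab True]
    unfolding if_P[OF True] by blast
next
  case False
  show ?thesis using hball_Int_subset[OF EF ab le] unfolding if_not_P[OF False] by blast
qed

section \<open>The face lattice of the cube\<close>

text \<open>Vertices are named by signs relative to a base vertex \<open>E\<close>, so that an
  analysis around one vertex serves for all of them.\<close>

definition vt :: "real^3 \<Rightarrow> real \<Rightarrow> real \<Rightarrow> real \<Rightarrow> real^3" where
  "vt E a b c = coords3 1 2 3 (a * E $ 1) (b * E $ 2) (c * E $ 3)"

lemma is_perm3_123: "is_perm3 1 2 3"
  by (simp add: is_perm3_def)

lemma vt_nth [simp]: "vt E a b c $ 1 = a * E $ 1" "vt E a b c $ 2 = b * E $ 2" "vt E a b c $ 3 = c * E $ 3"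
  by (simp_all add: vt_def coords3_nth[OF is_perm3_123])

lemma vec3_eq_iff: "x = y \<longleftrightarrow> x $ 1 = y $ 1 \<and> x $ 2 = y $ 2 \<and> x $ 3 = (y $ 3 :: real)"
  for x y :: "real^3"
  by (simp add: vec_eq_iff forall_3)

lemma inner3: "x \<bullet> y = x $ 1 * y $ 1 + x $ 2 * y $ 2 + x $ 3 * y $ 3" for x y :: "real^3"
  by (simp add: inner_vec_def sum_perm3[OF is_perm3_123] inner_real_def)

lemma vt_in_verts:
  assumes "E \<in> verts436" "\<bar>a\<bar> = 1" "\<bar>b\<bar> = 1" "\<bar>c\<bar> = 1"
  shows "vt E a b c \<in> verts436"
  using assms vert_nth(1)[OF assms(1)] by (simp add: verts436_def forall_3 abs_mult)

lemma inner_vt: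
  assumes "E \<in> verts436"
  shows "vt E a b c \<bullet> vt E a' b' c' = (a * a' + b * b' + c * c') / 3"
    "E \<bullet> vt E a b c = (a + b + c) / 3" "vt E a b c \<bullet> E = (a + b + c) / 3"
proof -
  have *: "s * E $ l * (t * E $ l) = s * t / 3" "E $ l * (t * E $ l) = t / 3" "t * E $ l * E $ l = t / 3" for s t l
    using vert_nth(2)[OF assms, of l] by (simp_all add: mult_ac)
  show "vt E a b c \<bullet> vt E a' b' c' = (a * a' + b * b' + c * c') / 3"
    "E \<bullet> vt E a b c = (a + b + c) / 3" "vt E a b c \<bullet> E = (a + b + c) / 3"
    by (simp_all add: inner3 * add_divide_distrib)
qed

lemma vt_eq_iff:
  assumes "E \<in> verts436"
  shows "vt E a b c = vt E a' b' c' \<longleftrightarrow> a = a' \<and> b = b' \<and> c = c'"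
  using vert_nth(3)[OF assms] by (simp add: vec3_eq_iff)

lemma vt_self [simp]: "vt E 1 1 1 = E"
  by (simp add: vec3_eq_iff)

lemma vertE:
  assumes E: "E \<in> verts436" and F: "F \<in> verts436"
  obtains a b c where "a \<in> {1, -1}" "b \<in> {1, -1}" "c \<in> {1, -1}" "F = vt E a b c"
proof -
  have "\<exists>a\<in>{1, -1}. F $ l = a * E $ l" for l
    using vert_nth(1)[OF E, of l] vert_nth(1)[OF F, of l] by (auto simp: abs_eq_iff)
  then obtain a b c where "a \<in> {1, -1}" "b \<in> {1, -1}" "c \<in> {1, -1}"
    "F $ 1 = a * E $ 1" "F $ 2 = b * E $ 2" "F $ 3 = c * E $ 3" by metis
  thus ?thesis using that by (simp add: vec3_eq_iff)
qed

lemma verts436_eq: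
  assumes E: "E \<in> verts436"
  shows "verts436 = {vt E 1 1 1, vt E (-1) 1 1, vt E 1 (-1) 1, vt E 1 1 (-1),
     vt E (-1) (-1) 1, vt E (-1) 1 (-1), vt E 1 (-1) (-1), vt E (-1) (-1) (-1)}" (is "_ = ?S")
proof
  show "verts436 \<subseteq> ?S"
  proof
    fix F assume "F \<in> verts436"
    from E this show "F \<in> ?S"
      by (rule vertE) (elim insertE emptyE; simp only: insert_iff simp_thms)
  qed
  show "?S \<subseteq> verts436" by (simp add: vt_in_verts[OF E] E)
qed

lemma sum_verts436:
  fixes f :: "real^3 \<Rightarrow> 'a :: comm_monoid_add"
  assumes E: "E \<in> verts436"
  shows "sum f verts436 = f E + (f (vt E (-1) 1 1) + (f (vt E 1 (-1) 1) + (f (vt E 1 1 (-1)) +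
     (f (vt E (-1) (-1) 1) + (f (vt E (-1) 1 (-1)) + (f (vt E 1 (-1) (-1)) + f (vt E (-1) (-1) (-1))))))))"
  by (subst verts436_eq[OF E]) (simp add: vt_eq_iff[OF E] del: vt_self, simp)

lemma inner_verts:
  assumes "E \<in> verts436" "F \<in> verts436"
  shows "E \<bullet> F \<in> {1, 1 / 3, - 1 / 3, - 1}"
  by (rule vertE[OF assms]) (auto simp: inner_vt[OF assms(1)])

lemma solid436_convex: "convex solid436" and solid436_interior: "0 \<in> interior solid436"
proof -
  have *: "solid436 = cbox (\<chi> i. - (1 / sqrt 3)) (\<chi> i. 1 / sqrt 3)"
    by (auto simp: solid436_def mem_box_cart abs_le_iff minus_le_iff)
  show "convex solid436" unfolding * by (rule convex_box)
  show "0 \<in> interior solid436" unfolding * by (simp add: mem_box_cart)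
qed

text \<open>The nontrivial inclusion is an affine image of the fact that the unit box is the convex
  hull of its 0-1 points.\<close>

lemma cube436_eq: "cube436 = solid436"
proof
  have "verts436 \<subseteq> solid436" by (auto simp: verts436_def solid436_def)
  thus "cube436 \<subseteq> solid436" unfolding cube436_def by (rule hull_minimal[where S = convex]) (rule solid436_convex)
next
  define h :: real where "h = 1 / sqrt 3"
  have h: "h > 0" by (simp add: h_def)
  let ?f = "\<lambda>y :: real^3. (\<chi> i. - h) + (2 * h) *\<^sub>R y"
  let ?U = "{x :: real^3. \<forall>i. x $ i = 0 \<or> x $ i = 1}"
  show "solid436 \<subseteq> cube436"
  proof
    fix x assume x: "x \<in> solid436"
    have xi: "\<bar>x $ i\<bar> \<le> h" for i using x by (simp add: solid436_def h_def)
    define y :: "real^3" where "y = (\<chi> i. (x $ i + h) / (2 * h))"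
    have yi: "0 \<le> y $ i \<and> y $ i \<le> 1" for i using xi[of i] h by (simp add: y_def abs_le_iff)
    have "y \<in> cbox 0 One"
      unfolding mem_box
    proof (intro ballI)
      fix b :: "real^3" assume b: "b \<in> Basis"
      then obtain i where "b = axis i 1" by (auto simp: Basis_vec_def)
      have "One \<bullet> b = 1"
        using b by (simp add: inner_sum_left inner_Basis sum.If_cases)
      thus "0 \<bullet> b \<le> y \<bullet> b \<and> y \<bullet> b \<le> One \<bullet> b"
        unfolding \<open>b = axis i 1\<close> using yi[of i] by (simp add: inner_axis)
    qed
    moreover have "?U = {x. \<forall>i\<in>Basis. x \<bullet> i = 0 \<or> x \<bullet> i = 1}"
      by (auto simp: Basis_vec_def inner_axis)
    ultimately have "y \<in> convex hull ?U" by (simp only: unit_interval_convex_hull)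
    moreover have "x = ?f y" using h by (simp add: vec_eq_iff y_def field_simps)
    ultimately have "x \<in> ?f ` (convex hull ?U)" by blast
    also have "\<dots> = convex hull (?f ` ?U)" by (rule convex_hull_affinity[symmetric])
    also have "\<dots> \<subseteq> convex hull verts436"
    proof (rule hull_mono, rule subsetI)
      fix z assume "z \<in> ?f ` ?U"
      then obtain u where u: "z = ?f u" "\<forall>i. u $ i = 0 \<or> u $ i = 1" by blast
      have "\<bar>z $ i\<bar> = h" for i using u(2)[rule_format, of i] h by (auto simp: u(1))
      thus "z \<in> verts436" by (simp add: verts436_def h_def)
    qed
    finally show "x \<in> cube436" by (simp add: cube436_def)
  qed
qed

definition side436 :: "3 \<Rightarrow> real \<Rightarrow> (real^3) set" where
  "side436 l t = {x \<in> solid436. t * x $ l = 1 / sqrt 3}"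

text \<open>The explicit description of facets demands an irredundant system of half-spaces. Each of
  the six is indispensable because \<open>pt (l, t)\<close>, placed beyond the corresponding face on
  its axis, violates that half-space alone.\<close>

lemma facet_of_cube436_iff:
  "\<Phi> facet_of cube436 \<longleftrightarrow> (\<exists>l t. (t = 1 \<or> t = - 1) \<and> \<Phi> = side436 l t)"
proof -
  define h :: real where "h = 1 / sqrt 3"
  have h: "h > 0" by (simp add: h_def)
  let ?I = "(UNIV :: 3 set) \<times> {1, - 1 :: real}"
  define H where "H = (\<lambda>(l :: 3, t :: real). {x :: real^3. t * x $ l \<le> h})"
  define pt :: "3 \<times> real \<Rightarrow> real^3" where "pt = (\<lambda>(l, t). axis l (2 * h * t))"
  have notin: "pt p \<notin> H p" if "p \<in> ?I" for p
    using that h by (auto simp: pt_def H_def axis_def)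
  have isin: "pt p \<in> H q" if "p \<in> ?I" "q \<in> ?I" "p \<noteq> q" for p q
  proof -
    obtain l t m u where p: "p = (l, t)" and q: "q = (m, u)" by (cases p, cases q)
    have "u * (if m = l then 2 * h * t else 0) \<le> h"
      using that h by (cases "m = l") (auto simp: p q)
    thus ?thesis by (simp add: p q pt_def H_def axis_def)
  qed
  have inj: "inj_on H ?I" using notin isin by (intro inj_onI) blast
  \<comment> \<open>The normal has to be a function of the half-space as a set, so its index is
    recovered through the injectivity of \<open>H\<close>.\<close>
  define a where "a X = (case inv_into ?I H X of (l, t) \<Rightarrow> axis l t)" for X :: "(real^3) set"
  have aH: "a (H p) = axis (fst p) (snd p)" if "p \<in> ?I" for p
    using inv_into_f_f[OF inj that] by (simp add: a_def case_prod_beta)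
  have seq: "solid436 = affine hull solid436 \<inter> \<Inter> (H ` ?I)"
  proof -
    have "affine hull solid436 = UNIV"
      using solid436_interior by (intro affine_hull_nonempty_interior) blast
    thus ?thesis by (auto simp: solid436_def H_def h_def abs_le_iff minus_le_iff)
  qed
  have "\<Phi> facet_of solid436 \<longleftrightarrow> (\<exists>X. X \<in> H ` ?I \<and> \<Phi> = solid436 \<inter> {x. a X \<bullet> x = h})"
  proof (rule facet_of_polyhedron_explicit[OF _ seq])
    fix X assume "X \<in> H ` ?I"
    then obtain p where p: "p \<in> ?I" "X = H p" by blast
    have "snd p \<noteq> 0" using p by auto
    thus "a X \<noteq> 0 \<and> X = {x. a X \<bullet> x \<le> h}"
      using aH[OF p(1)] p by (auto simp: H_def case_prod_beta inner_axis' axis_eq_0_iff)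
  next
    fix F' assume F': "F' \<subset> H ` ?I"
    then obtain p where p: "p \<in> ?I" "H p \<notin> F'" by blast
    have "pt p \<in> \<Inter> F'"
    proof
      fix X assume "X \<in> F'"
      then obtain q where "q \<in> ?I" "X = H q" using F' by blast
      thus "pt p \<in> X" using isin[OF p(1)] p(2) \<open>X \<in> F'\<close> by metis
    qed
    moreover have "pt p \<notin> solid436" using notin[OF p(1)] seq p(1) by blast
    moreover have "affine hull solid436 = UNIV"
      using solid436_interior by (intro affine_hull_nonempty_interior) blast
    moreover have "solid436 \<subseteq> \<Inter> F'" using seq F' by blast
    ultimately show "solid436 \<subset> affine hull solid436 \<inter> \<Inter> F'" by blast
  qed simp
  also have "\<dots> \<longleftrightarrow> (\<exists>p\<in>?I. \<Phi> = solid436 \<inter> {x. axis (fst p) (snd p) \<bullet> x = h})"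
    using aH by auto
  also have "\<dots> \<longleftrightarrow> (\<exists>l t. (t = 1 \<or> t = - 1) \<and> \<Phi> = side436 l t)"
  proof -
    have "solid436 \<inter> {x. axis l t \<bullet> x = h} = side436 l t" for l t
      by (auto simp: inner_axis' side436_def h_def)
    thus ?thesis by auto
  qed
  finally show ?thesis by (simp only: cube436_eq)
qed

lemma vert_on_side_iff:
  assumes "E \<in> verts436" "t = 1 \<or> t = - 1"
  shows "E \<notin> side436 l t \<longleftrightarrow> t * E $ l = - (1 / sqrt 3)"
proof -
  have "E \<in> solid436" using assms by (simp add: verts436_def solid436_def)
  thus ?thesis using assms(2) vert_nth(1)[OF assms(1), of l]
    by (auto simp: side436_def abs_if split: if_splits)
qed

section \<open>Edges of the cube\<close>

definition flip :: "3 \<Rightarrow> real^3 \<Rightarrow> real^3" where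
  "flip i E = (\<chi> l. if l = i then - E $ l else E $ l)"

lemma flip_in_verts: "E \<in> verts436 \<Longrightarrow> flip i E \<in> verts436"
  by (auto simp: flip_def verts436_def)

lemma inner_flip:
  assumes "E \<in> verts436"
  shows "E \<bullet> flip i E = 1 / 3"
  using exhaust_3[of i] vert_nth(2)[OF assms] by (auto simp: inner3 flip_def)

lemma adjacent_flip:
  assumes E: "E \<in> verts436" and F: "F \<in> verts436"
  shows "E \<bullet> F = 1 / 3 \<longleftrightarrow> (\<exists>i. F = flip i E)"
proof
  assume *: "E \<bullet> F = 1 / 3"
  show "\<exists>i. F = flip i E"
  proof (rule vertE[OF E F])
    fix a b c :: real assume abc: "a \<in> {1, -1}" "b \<in> {1, -1}" "c \<in> {1, -1}" "F = vt E a b c"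
    hence "(a + b + c) / 3 = 1 / 3" using * by (simp add: inner_vt[OF E])
    hence "(a = -1 \<and> b = 1 \<and> c = 1) \<or> (a = 1 \<and> b = -1 \<and> c = 1) \<or> (a = 1 \<and> b = 1 \<and> c = -1)"
      using abc by auto
    hence "F = flip 1 E \<or> F = flip 2 E \<or> F = flip 3 E"
      using abc(4) by (auto simp: vec3_eq_iff flip_def)
    thus ?thesis by blast
  qed
qed (use inner_flip[OF E] in auto)

text \<open>If \<open>E\<close> and \<open>F\<close> differ in coordinate \<open>i\<close> alone,
  the functional \<open>E + F\<close> has no component along \<open>i\<close>, and it attains its
  maximum \<open>4 / 3\<close> over the cube exactly on the segment. Conversely, exchanging between
  the ends of an edge just one coordinate in which they differ keeps the midpoint; the face property
  puts \<open>flip i E\<close> on the edge, and coordinate \<open>i\<close> shows that it is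
  \<open>F\<close>.\<close>

lemma adjacent436_iff:
  assumes E: "E \<in> verts436" and F: "F \<in> verts436"
  shows "adjacent436 E F \<longleftrightarrow> E \<bullet> F = 1 / 3"
proof
  assume "E \<bullet> F = 1 / 3"
  then obtain i where Fi: "F = flip i E" using adjacent_flip[OF E F] by blast
  have le: "E $ l * x $ l \<le> 1 / 3" "E $ l * x $ l = 1 / 3 \<Longrightarrow> x $ l = E $ l" "- (1 / 3) \<le> E $ l * x $ l"
    if "x \<in> solid436" for x l
  proof -
    have "\<bar>E $ l * x $ l\<bar> \<le> 1 / sqrt 3 * (1 / sqrt 3)"
      unfolding abs_mult vert_nth(1)[OF E] using that by (intro mult_left_mono) (auto simp: solid436_def)
    also have "1 / sqrt 3 * (1 / sqrt 3) = (1 / 3 :: real)" by simp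
    finally show "E $ l * x $ l \<le> 1 / 3" "- (1 / 3) \<le> E $ l * x $ l" by linarith+
    show "x $ l = E $ l" if "E $ l * x $ l = 1 / 3"
      using that vert_nth(2,3)[OF E, of l] by (metis mult_left_cancel)
  qed
  have eq: "(E + F) \<bullet> x = 2 * (\<Sum>l\<in>UNIV - {i}. E $ l * x $ l)" for x
  proof -
    have "(E + F) \<bullet> x = (\<Sum>l\<in>UNIV. (E $ l + F $ l) * x $ l)" by (simp add: inner_vec_def)
    also have "\<dots> = (\<Sum>l\<in>UNIV - {i}. (E $ l + F $ l) * x $ l)"
      by (rule sum.mono_neutral_right) (auto simp: Fi flip_def)
    also have "\<dots> = (\<Sum>l\<in>UNIV - {i}. 2 * (E $ l * x $ l))"
      by (rule sum.cong) (auto simp: Fi flip_def)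
    finally show ?thesis by (simp add: sum_distrib_left)
  qed
  have card: "card (UNIV - {i} :: 3 set) = 2" by (simp add: card_Diff_singleton)
  have sup: "(E + F) \<bullet> x \<le> 4 / 3" if "x \<in> solid436" for x
  proof -
    have "(\<Sum>l\<in>UNIV - {i}. E $ l * x $ l) \<le> (\<Sum>l\<in>UNIV - {i}. 1 / 3)"
      by (intro sum_mono le(1) that)
    thus ?thesis using eq[of x] card by simp
  qed
  have seg: "closed_segment E F = solid436 \<inter> {x. (E + F) \<bullet> x = 4 / 3}"
  proof
    have "E \<in> solid436" "F \<in> solid436" using E F by (auto simp: verts436_def solid436_def)
    hence "closed_segment E F \<subseteq> solid436" by (intro closed_segment_subset solid436_convex)
    moreover have "closed_segment E F \<subseteq> {x. (E + F) \<bullet> x = 4 / 3}"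
    proof (rule closed_segment_subset)
      show "E \<in> {x. (E + F) \<bullet> x = 4 / 3}" "F \<in> {x. (E + F) \<bullet> x = 4 / 3}"
        using vert_norm(1)[OF E] vert_norm(1)[OF F] inner_flip[OF E, of i] inner_commute[of F E]
        by (simp_all add: inner_add_left Fi[symmetric])
    qed (rule convex_hyperplane)
    ultimately show "closed_segment E F \<subseteq> solid436 \<inter> {x. (E + F) \<bullet> x = 4 / 3}" by blast
  next
    show "solid436 \<inter> {x. (E + F) \<bullet> x = 4 / 3} \<subseteq> closed_segment E F"
    proof
      fix x assume "x \<in> solid436 \<inter> {x. (E + F) \<bullet> x = 4 / 3}"
      hence x: "x \<in> solid436" "(E + F) \<bullet> x = 4 / 3" by auto
      have "(\<Sum>l\<in>UNIV - {i}. 1 / 3 - E $ l * x $ l) = 0"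
        using x(2) card unfolding eq by (simp add: sum_subtractf)
      hence "\<forall>l\<in>UNIV - {i}. 1 / 3 - E $ l * x $ l = 0"
        using le(1)[OF x(1)] by (subst (asm) sum_nonneg_eq_0_iff) auto
      hence xl: "x $ l = E $ l" if "l \<noteq> i" for l using that le(2)[OF x(1), of l] by simp
      define u where "u = (1 - 3 * (E $ i * x $ i)) / 2"
      have u: "0 \<le> u" "u \<le> 1" using le(1,3)[OF x(1), of i] by (simp_all add: u_def)
      have "E $ i * (E $ i * x $ i) = x $ i / 3" using vert_nth(2)[OF E, of i] by (simp add: mult.assoc[symmetric])
      hence "x $ i = (1 - u) * E $ i + u * (- E $ i)"
        by (simp add: u_def field_simps)
      hence "x = (1 - u) *\<^sub>R E + u *\<^sub>R F"
        using xl by (auto simp: vec_eq_iff Fi flip_def algebra_simps)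
      thus "x \<in> closed_segment E F" using u by (auto simp: in_segment)
    qed
  qed
  have "closed_segment E F face_of solid436"
    unfolding seg by (intro face_of_Int_supporting_hyperplane_le solid436_convex sup)
  moreover have "aff_dim (closed_segment E F) = 1"
  proof -
    have "E \<noteq> F" using vert_norm(1)[OF E] \<open>E \<bullet> F = 1 / 3\<close> by auto
    thus ?thesis by (simp add: segment_convex_hull aff_dim_convex_hull aff_dim_2)
  qed
  ultimately show "adjacent436 E F" by (simp add: adjacent436_def edge_of_def cube436_eq)
next
  assume "adjacent436 E F"
  hence face: "closed_segment E F face_of solid436" and dim: "aff_dim (closed_segment E F) = 1"
    by (simp_all add: adjacent436_def edge_of_def cube436_eq)
  have "E \<noteq> F" using dim by auto
  then obtain i where i: "E $ i \<noteq> F $ i" by (auto simp: vec_eq_iff)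
  hence Fi: "F $ i = - E $ i" using vert_nth(1)[OF E, of i] vert_nth(1)[OF F, of i] by (auto simp: abs_eq_iff)
  have ne: "flip i E \<noteq> flip i F" using i by (auto simp: vec_eq_iff flip_def intro!: exI[of _ i])
  have "midpoint (flip i E) (flip i F) = midpoint E F"
    using Fi by (auto simp: midpoint_def vec_eq_iff flip_def)
  hence "midpoint E F \<in> open_segment (flip i E) (flip i F)"
    using ne by (metis midpoint_in_open_segment)
  moreover have "flip i E \<in> solid436" "flip i F \<in> solid436"
    using flip_in_verts[OF E] flip_in_verts[OF F] by (auto simp: verts436_def solid436_def)
  ultimately have "flip i E \<in> closed_segment E F"
    using face midpoint_in_closed_segment[of E F] unfolding face_of_def by blast
  then obtain u where u: "flip i E = (1 - u) *\<^sub>R E + u *\<^sub>R F" by (auto simp: in_segment)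
  have "- E $ i = (1 - u) * E $ i + u * F $ i"
    using arg_cong[OF u, of "\<lambda>x. x $ i"] by (simp add: flip_def)
  hence "(1 - u) * (2 * E $ i) = 0" unfolding Fi by (simp add: algebra_simps)
  hence "u = 1" using vert_nth(3)[OF E, of i] by simp
  hence "F = flip i E" using u by simp
  thus "E \<bullet> F = 1 / 3" using inner_flip[OF E] by simp
qed

section \<open>Admissible radii and the optimal density\<close>

text \<open>Contact with a plane is reduced to contact of two horoballs. The hyperbolic reflection
  takes the lightlike vector \<open>(1, E)\<close> to \<open>3\<close> times \<open>(1, F)\<close>,
  hence the horoball of radius \<open>a\<close> at \<open>E\<close> to the one of radius
  \<open>a / 3\<close> at \<open>F\<close>. Beyond the side, the horoball at \<open>E\<close> lies
  inside this mirror image, and \<open>a * (a / 3) = (1 - E \<bullet> F) / 2 = 2 / 3\<close> means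
  \<open>a\<^sup>2 = 2\<close>.\<close>

lemma hball_beyond_side:
  assumes E: "E \<in> verts436" and t: "t = 1 \<or> t = - 1" and side: "t * E $ l = - (1 / sqrt 3)"
    and a: "a > 0"
  defines "p \<equiv> (1 / 2) *\<^sub>R (E + sqrt 3 *\<^sub>R axis l t)"
  shows "a\<^sup>2 \<le> 2 \<Longrightarrow> hball E (a\<^sup>2) \<inter> {x. t * x $ l \<ge> 1 / sqrt 3} \<subseteq> (if a\<^sup>2 = 2 then {p} else {})"
    "p \<in> side436 l t" "a\<^sup>2 = 2 \<Longrightarrow> p \<in> hball E (a\<^sup>2)" "a\<^sup>2 > 2 \<Longrightarrow> p \<in> hball_core E (a\<^sup>2)"
proof -
  note nE = vert_norm[OF E]
  have s3: "sqrt 3 * sqrt 3 = (3::real)" by simp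
  have t2: "t * t = 1" using t by auto
  define u where "u = (axis l t :: real^3)"
  have uu: "u \<bullet> u = 1" by (simp add: u_def inner_axis_axis t2)
  have ux: "u \<bullet> x = t * x $ l" for x by (simp add: u_def inner_axis')
  have Eu: "E \<bullet> u = - (1 / sqrt 3)" "u \<bullet> E = - (1 / sqrt 3)" using side ux[of E] by (simp_all add: inner_commute)
  have s3': "sqrt 3 * (E \<bullet> u) = - 1" "sqrt 3 * (u \<bullet> E) = - 1" by (simp_all add: Eu)
  text \<open>The mirror image of \<open>E\<close> in the plane of the side.\<close>
  define F where "F = (1 / 3) *\<^sub>R (E + (2 * sqrt 3) *\<^sub>R u)"
  have "(E + (2 * sqrt 3) *\<^sub>R u) \<bullet> (E + (2 * sqrt 3) *\<^sub>R u)
      = E \<bullet> E + 2 * (sqrt 3 * (E \<bullet> u)) + 2 * (sqrt 3 * (u \<bullet> E)) + 4 * (sqrt 3 * sqrt 3) * (u \<bullet> u)"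
    by (simp add: inner_add_left inner_add_right algebra_simps)
  hence "F \<bullet> F = 1" unfolding s3' s3 uu nE(1) by (simp add: F_def)
  hence nF: "norm F = 1" by (simp add: norm_eq_1)
  have EF: "E \<bullet> F = - 1 / 3"
  proof -
    have "E \<bullet> F = (E \<bullet> E + 2 * (sqrt 3 * (E \<bullet> u))) / 3" by (simp add: F_def inner_add_right)
    thus ?thesis unfolding s3' nE(1) by simp
  qed
  have ne: "E \<noteq> F" using EF nE(1) by auto
  \<comment> \<open>Only the ratio of the two radii enters, so the candidate for the touching point
    is the same for every \<open>a\<close>.\<close>
  have pa: "p = touch_pt E a F (a / 3)"
  proof -
    have "touch_pt E a F (a / 3) = (1 / (a * 4 / 3)) *\<^sub>R (a / 3) *\<^sub>R (E + E + (2 * sqrt 3) *\<^sub>R u)"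
      by (simp add: touch_pt_def F_def scaleR_add_right algebra_simps)
    also have "\<dots> = (1 / 4) *\<^sub>R (E + E + (2 * sqrt 3) *\<^sub>R u)" using a by simp
    also have "\<dots> = p" by (simp add: p_def u_def vec_eq_iff)
    finally show ?thesis ..
  qed
  show "hball E (a\<^sup>2) \<inter> {x. t * x $ l \<ge> 1 / sqrt 3} \<subseteq> (if a\<^sup>2 = 2 then {p} else {})" if a2: "a\<^sup>2 \<le> 2"
  proof -
    have "hball E (a\<^sup>2) \<inter> {x. t * x $ l \<ge> 1 / sqrt 3} \<subseteq> hball E (a\<^sup>2) \<inter> hball F ((a / 3)\<^sup>2)"
    proof
      fix x assume x: "x \<in> hball E (a\<^sup>2) \<inter> {x. t * x $ l \<ge> 1 / sqrt 3}"
      hence hs: "x \<in> hspace" by (simp add: hball_def)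
      have "sqrt 3 * (1 / sqrt 3) \<le> sqrt 3 * (t * x $ l)" using x by (intro mult_left_mono) auto
      hence "1 \<le> sqrt 3 * (x \<bullet> u)" by (simp add: ux inner_commute)
      moreover have "3 * (1 - x \<bullet> F) = 3 - x \<bullet> E - 2 * (sqrt 3 * (x \<bullet> u))"
        by (simp add: F_def inner_add_right field_simps)
      ultimately have "1 - x \<bullet> F \<le> (1 - x \<bullet> E) / 3" by simp
      hence "(1 - x \<bullet> F)\<^sup>2 \<le> ((1 - x \<bullet> E) / 3)\<^sup>2" using inner_lt_1[OF hs nF] by (intro power_mono) auto
      also have "\<dots> = (1 - x \<bullet> E)\<^sup>2 / 9" by (simp add: power_divide)
      also have "\<dots> \<le> a\<^sup>2 * (1 - x \<bullet> x) / 9" using x by (simp add: hball_def)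
      also have "\<dots> = (a / 3)\<^sup>2 * (1 - x \<bullet> x)" by (simp add: power_divide)
      finally show "x \<in> hball E (a\<^sup>2) \<inter> hball F ((a / 3)\<^sup>2)" using x hs by (simp add: hball_def)
    qed
    also have "\<dots> \<subseteq> (if a * (a / 3) = (1 - E \<bullet> F) / 2 then {touch_pt E a F (a / 3)} else {})"
      by (rule hball_Int_subset[OF nE(2) nF ne]) (use a a2 EF in \<open>auto simp: power2_eq_square\<close>)
    also have "a * (a / 3) = (1 - E \<bullet> F) / 2 \<longleftrightarrow> a\<^sup>2 = 2" by (simp add: EF power2_eq_square)
    finally show ?thesis unfolding pa[symmetric] .
  qed
  \<comment> \<open>\<open>p\<close> lies in the square face itself and not just in its plane, so a
    horoball that is too large really meets the face.\<close>
  show "p \<in> side436 l t"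
  proof -
    have pl: "t * p $ l = 1 / sqrt 3"
    proof -
      have "sqrt 3 = 3 / sqrt 3" using s3 by (simp add: field_simps)
      moreover have "t * p $ l = (t * E $ l + sqrt 3 * (t * t)) / 2" by (simp add: p_def axis_def algebra_simps)
      ultimately show ?thesis unfolding side t2 by simp
    qed
    have "\<bar>t\<bar> * \<bar>p $ l\<bar> = 1 / sqrt 3" unfolding abs_mult[symmetric] pl by simp
    moreover have "\<bar>t\<bar> = 1" using t by auto
    ultimately have "\<bar>p $ l\<bar> = 1 / sqrt 3" by simp
    moreover have "\<bar>p $ m\<bar> \<le> 1 / sqrt 3" if "m \<noteq> l" for m
    proof -
      have "\<bar>p $ m\<bar> = (1 / sqrt 3) / 2" using that vert_nth(1)[OF E, of m] by (simp add: p_def axis_def)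
      thus ?thesis by simp
    qed
    ultimately have "\<bar>p $ m\<bar> \<le> 1 / sqrt 3" for m by (cases "m = l") simp_all
    hence "p \<in> solid436" by (simp add: solid436_def)
    thus ?thesis using pl by (simp add: side436_def)
  qed
  show "p \<in> hball E (a\<^sup>2)" if "a\<^sup>2 = 2"
    using touch_pt_in_hball(1)[OF nE(2) nF ne a, of "a / 3"] a that EF unfolding pa
    by (simp add: power2_eq_square)
  show "p \<in> hball_core E (a\<^sup>2)" if "a\<^sup>2 > 2"
    using touch_pt_in_hball(2)[OF nE(2) nF ne a, of "a / 3"] a that EF unfolding pa
    by (simp add: power2_eq_square)
qed

text \<open>For \<open>a\<^sup>2 \<le> 2\<close> the horoball has at most one point on or beyond the
  plane. Its interior is therefore contained in the closed half-space, hence in the interior of that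
  half-space, which misses the plane.\<close>

lemma interior_hball_side_iff:
  assumes E: "E \<in> verts436" and t: "t = 1 \<or> t = - 1" and E': "E \<notin> side436 l t" and a: "a > 0"
  shows "interior (hball E (a\<^sup>2)) \<inter> side436 l t = {} \<longleftrightarrow> a\<^sup>2 \<le> 2"
proof -
  have side: "t * E $ l = - (1 / sqrt 3)" using vert_on_side_iff[OF E t] E' by blast
  note h = hball_beyond_side[OF E t side a]
  let ?p = "(1 / 2) *\<^sub>R (E + sqrt 3 *\<^sub>R axis l t)"
  show ?thesis
  proof
    assume *: "interior (hball E (a\<^sup>2)) \<inter> side436 l t = {}"
    show "a\<^sup>2 \<le> 2"
    proof (rule ccontr)
      assume "\<not> a\<^sup>2 \<le> 2"
      hence "?p \<in> interior (hball E (a\<^sup>2))" using h(4) hball_core_subset_interior by auto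
      thus False using h(2) * by blast
    qed
  next
    assume a2: "a\<^sup>2 \<le> 2"
    let ?H = "{x :: real^3. t * x $ l \<le> 1 / sqrt 3}"
    have sub: "interior (hball E (a\<^sup>2)) \<inter> {x. t * x $ l \<ge> 1 / sqrt 3} \<subseteq> {?p}"
    proof -
      have "interior (hball E (a\<^sup>2)) \<inter> {x. t * x $ l \<ge> 1 / sqrt 3} \<subseteq> hball E (a\<^sup>2) \<inter> {x. t * x $ l \<ge> 1 / sqrt 3}"
        using interior_subset by blast
      also note h(1)[OF a2]
      also have "(if a\<^sup>2 = 2 then {?p} else {}) \<subseteq> {?p}" by simp
      finally show ?thesis .
    qed
    have ax: "axis l t \<noteq> (0 :: real^3)" using t by (auto simp: axis_eq_0_iff)
    have "interior (hball E (a\<^sup>2)) \<inter> {x. t * x $ l > 1 / sqrt 3} = {}"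
    proof (rule interior_subset_singleton)
      show "open (interior (hball E (a\<^sup>2)) \<inter> {x. t * x $ l > 1 / sqrt 3})"
        by (intro open_Int open_interior open_Collect_less continuous_intros)
      show "interior (hball E (a\<^sup>2)) \<inter> {x. t * x $ l > 1 / sqrt 3} \<subseteq> {?p}" using sub by fastforce
    qed
    hence "interior (hball E (a\<^sup>2)) \<subseteq> ?H" by fastforce
    hence "interior (hball E (a\<^sup>2)) \<subseteq> interior ?H" by (rule interior_maximal) simp
    also have "?H = {x. axis l t \<bullet> x \<le> 1 / sqrt 3}" by (simp add: inner_axis')
    also have "interior \<dots> = {x. axis l t \<bullet> x < 1 / sqrt 3}" by (rule interior_halfspace_le[OF ax])
    finally show "interior (hball E (a\<^sup>2)) \<inter> side436 l t = {}"
      by (auto simp: side436_def inner_axis')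
  qed
qed

lemma vert_has_opposite_side:
  assumes "E \<in> verts436"
  obtains l t where "t = 1 \<or> t = - 1" "E \<notin> side436 l t"
proof -
  define t :: real where "t = (if E $ 1 < 0 then 1 else - 1)"
  have "t * E $ 1 = - (1 / sqrt 3)" using vert_nth(1)[OF assms, of 1] by (simp add: t_def abs_if split: if_splits)
  moreover have t: "t = 1 \<or> t = - 1" by (simp add: t_def)
  ultimately show ?thesis using that vert_on_side_iff[OF assms t] by blast
qed

definition radii_ok :: "(real^3 \<Rightarrow> real) \<Rightarrow> bool" where
  "radii_ok a \<longleftrightarrow> (\<forall>E\<in>verts436. 0 < a E \<and> (a E)\<^sup>2 \<le> 2) \<and>
     (\<forall>E\<in>verts436. \<forall>F\<in>verts436. E \<noteq> F \<longrightarrow> a E * a F \<le> (1 - E \<bullet> F) / 2)"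

lemma hball_eq_horoball:
  assumes "norm E = 1" "a > 0"
  shows "hball E (a\<^sup>2) = horoball E (ln a)"
  using horoball_eq_hball[OF assms(1), of "ln a"] assms(2) by (simp add: exp_double)

text \<open>All faces not incident with a vertex impose the same bound on its radius, so it can be
  read off from any one of them.\<close>

lemma admissible436_iff:
  "admissible436 B \<longleftrightarrow> (\<exists>a. radii_ok a \<and> (\<forall>E\<in>verts436. B E = hball E ((a E)\<^sup>2)))"
proof
  assume adm: "admissible436 B"
  hence "\<forall>E\<in>verts436. \<exists>c. B E = horoball E c" by (simp add: admissible436_def)
  then obtain c where c: "\<And>E. E \<in> verts436 \<Longrightarrow> B E = horoball E (c E)" by metis
  define a where "a E = exp (c E)" for E
  have B: "B E = hball E ((a E)\<^sup>2)" if "E \<in> verts436" for E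
    using c[OF that] horoball_eq_hball[OF vert_norm(2)[OF that]] by (simp add: a_def exp_double)
  have a0: "a E > 0" for E by (simp add: a_def)
  have "(a E)\<^sup>2 \<le> 2" if E: "E \<in> verts436" for E
  proof -
    obtain l t where lt: "t = 1 \<or> t = - 1" "E \<notin> side436 l t" by (rule vert_has_opposite_side[OF E])
    hence "side436 l t facet_of cube436" by (auto simp: facet_of_cube436_iff)
    hence "interior (B E) \<inter> side436 l t = {}" using adm E lt(2) by (simp add: admissible436_def)
    thus ?thesis using interior_hball_side_iff[OF E lt a0] by (simp add: B[OF E])
  qed
  moreover have "a E * a F \<le> (1 - E \<bullet> F) / 2" if "E \<in> verts436" "F \<in> verts436" "E \<noteq> F" for E F
  proof -
    have "interior (B E) \<inter> interior (B F) = {}" using adm that by (simp add: admissible436_def)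
    thus ?thesis using interiors_disjoint_iff[OF vert_norm(2) vert_norm(2) that(3) a0 a0] that B by simp
  qed
  ultimately have "radii_ok a" using a0 by (simp add: radii_ok_def)
  thus "\<exists>a. radii_ok a \<and> (\<forall>E\<in>verts436. B E = hball E ((a E)\<^sup>2))" using B by blast
next
  assume "\<exists>a. radii_ok a \<and> (\<forall>E\<in>verts436. B E = hball E ((a E)\<^sup>2))"
  then obtain a where a: "radii_ok a" and B: "\<And>E. E \<in> verts436 \<Longrightarrow> B E = hball E ((a E)\<^sup>2)" by blast
  show "admissible436 B"
    unfolding admissible436_def
  proof (intro conjI ballI allI impI)
    fix E assume E: "E \<in> verts436"
    hence a0: "a E > 0" "(a E)\<^sup>2 \<le> 2" using a by (auto simp: radii_ok_def)
    show "\<exists>c. B E = horoball E c" using B[OF E] hball_eq_horoball[OF vert_norm(2)[OF E] a0(1)] by metis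
    show "interior (B E) \<inter> \<Phi> = {}" if \<Phi>: "\<Phi> facet_of cube436 \<and> E \<notin> \<Phi>" for \<Phi>
    proof -
      have "\<exists>l t. (t = 1 \<or> t = - 1) \<and> \<Phi> = side436 l t"
        using \<Phi> unfolding facet_of_cube436_iff by (rule conjunct1)
      then obtain l t where lt: "t = 1 \<or> t = - 1" "\<Phi> = side436 l t" by metis
      hence "E \<notin> side436 l t" using \<Phi> by simp
      from interior_hball_side_iff[OF E lt(1) this a0(1)] show ?thesis
        unfolding B[OF E] lt(2) using a0(2) by blast
    qed
    show "interior (B E) \<inter> interior (B F) = {}" if F: "F \<in> verts436" and ne: "E \<noteq> F" for F
    proof -
      have "a F > 0" "a E * a F \<le> (1 - E \<bullet> F) / 2" using a E F ne by (auto simp: radii_ok_def)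
      thus ?thesis using interiors_disjoint_iff[OF vert_norm(2)[OF E] vert_norm(2)[OF F] ne a0(1)]
        by (simp add: B[OF E] B[OF F])
    qed
  qed
qed

text \<open>The same \<open>s\<close> serves all arrangements, so comparing densities amounts to
  comparing sums of squared radii.\<close>

lemma density436_eq:
  obtains s where "s > 0" "\<bar>2 / (3 * s) - 0.85327609\<bar> \<le> 5 / 10 ^ 9"
    "\<And>B a. radii_ok a \<Longrightarrow> (\<And>E. E \<in> verts436 \<Longrightarrow> B E = hball E ((a E)\<^sup>2)) \<Longrightarrow>
       density436 B = (\<Sum>E\<in>verts436. (a E)\<^sup>2) / (5 * s)"
proof -
  obtain s where s: "emeasure hvolume solid436 = ennreal (15 * sqrt 3 / 4 * s)" "s > 0"
    "\<bar>2 / (3 * s) - 0.85327609\<bar> \<le> 5 / 10 ^ 9"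
    by (rule emeasure_solid436_bounds)
  have P: "P436 = solid436 \<inter> hspace" by (simp add: P436_def cube436_eq)
  have "emeasure hvolume P436 = emeasure hvolume solid436"
    unfolding P by (simp add: emeasure_hvolume Int_assoc)
  hence vP: "hvol P436 = 15 * sqrt 3 / 4 * s" using s by (simp add: measure_def)
  have "density436 B = (\<Sum>E\<in>verts436. (a E)\<^sup>2) / (5 * s)"
    if a: "radii_ok a" and B: "\<And>E. E \<in> verts436 \<Longrightarrow> B E = hball E ((a E)\<^sup>2)" for B a
  proof -
    have "hvol (B E \<inter> P436) = 3 * sqrt 3 / 4 * (a E)\<^sup>2" if E: "E \<in> verts436" for E
    proof -
      have "B E \<inter> P436 = hball E ((a E)\<^sup>2) \<inter> solid436" unfolding B[OF E] P by (auto simp: hball_def)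
      moreover have "0 < a E" "(a E)\<^sup>2 \<le> 2" using a E by (auto simp: radii_ok_def)
      ultimately show ?thesis using emeasure_hball[OF E, of "(a E)\<^sup>2"] by (simp add: measure_def)
    qed
    hence "(\<Sum>E\<in>verts436. hvol (B E \<inter> P436)) = (\<Sum>E\<in>verts436. 3 * sqrt 3 / 4 * (a E)\<^sup>2)"
      by (rule sum.cong[OF refl])
    hence "density436 B = (\<Sum>E\<in>verts436. 3 * sqrt 3 / 4 * (a E)\<^sup>2) / (15 * sqrt 3 / 4 * s)"
      unfolding density436_def vP by (simp only:)
    also have "\<dots> = 3 * sqrt 3 / 4 * (\<Sum>E\<in>verts436. (a E)\<^sup>2) / (3 * sqrt 3 / 4 * (5 * s))"
      by (simp add: sum_distrib_left)
    also have "\<dots> = (\<Sum>E\<in>verts436. (a E)\<^sup>2) / (5 * s)"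
      by (rule mult_divide_mult_cancel_left) simp
    finally show ?thesis .
  qed
  thus ?thesis using that s by blast
qed

section \<open>The maximum of the sum of squared radii\<close>

lemma sum_le_of_prod_le:
  fixes x y M k :: real
  assumes "x \<le> M" "y \<le> M" "x * y \<le> k" "0 < M"
  shows "x + y \<le> M + k / M"
proof -
  have "0 \<le> (M - x) * (M - y)" using assms by (intro mult_nonneg_nonneg) auto
  hence "(x + y) * M \<le> M * M + k" using assms(3) by (simp add: algebra_simps)
  thus ?thesis using assms(4) by (simp add: field_simps)
qed

text \<open>\<open>m\<close> is the squared radius at one vertex; \<open>q\<close>,
  \<open>p\<close>, \<open>r\<close> are those at its neighbours, across the face diagonals and at
  the antipode. Equality holds for \<open>m = 2\<close>, \<open>q = 1 / 18\<close>,
  \<open>p = 2 / 9\<close>, \<open>r = 1 / 2\<close> and for \<open>m = 2 / 3\<close>,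
  \<open>q = 1 / 6\<close>, \<open>p = 2 / 3\<close>, \<open>r = 1 / 6\<close>, so the estimates
  must be sharp at both points.\<close>

lemma sum_with_large_value:
  fixes m q1 q2 q3 p1 p2 p3 r :: real
  assumes pos: "0 < q1" "0 < q2" "0 < q3" "0 < p1" "0 < p2" "0 < p3" "0 < r"
    and m: "2 / 3 \<le> m" "m \<le> 2"
    and q: "m * q1 \<le> 1 / 9" "m * q2 \<le> 1 / 9" "m * q3 \<le> 1 / 9"
    and p: "m * p1 \<le> 4 / 9" "m * p2 \<le> 4 / 9" "m * p3 \<le> 4 / 9"
    and r: "m * r \<le> 1" and pr: "p1 * r \<le> 1 / 9" "p2 * r \<le> 1 / 9" "p3 * r \<le> 1 / 9"
  shows "m + (q1 + q2 + q3) + (p1 + p2 + p3) + r \<le> 10 / 3"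
proof -
  have m0: "m > 0" using m by simp
  \<comment> \<open>Raising all \<open>p\<close> to the largest one only enlarges the sum, and the
    largest one still satisfies the bounds against \<open>m\<close> and \<open>r\<close>.\<close>
  define t where "t = max p1 (max p2 p3)"
  have t: "t > 0" "m * t \<le> 4 / 9" "t * r \<le> 1 / 9" "p1 + p2 + p3 \<le> 3 * t"
    using pos p pr by (auto simp: t_def max_def)
  have qs: "m * (q1 + q2 + q3) \<le> 1 / 3" using q by (simp add: algebra_simps)
  have "(m - 2) * (m - 2 / 3) \<le> 0" using m by (intro mult_nonpos_nonneg) auto
  hence quad: "3 * (m * m) \<le> 8 * m - 4" by (simp add: field_simps)
  have main: "m * (m + 3 * t + r) \<le> 10 / 3 * m - 1 / 3"
  \<comment> \<open>\<open>r\<close> is bounded by \<open>1 / m\<close> and by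
    \<open>1 / (9 * t)\<close>; the cases tell which bound is the stronger one.\<close>
  proof (cases "9 * t \<le> m")
    case True
    have "m * (9 * t) \<le> m * m" using True m0 by (intro mult_left_mono) auto
    hence "m * (m + 3 * t + r) \<le> 4 / 3 * (m * m) + 1" using r by (simp add: algebra_simps)
    also have "\<dots> \<le> 10 / 3 * m - 1 / 3" using quad m by linarith
    finally show ?thesis .
  next
    case False
    \<comment> \<open>With \<open>r\<close> replaced by \<open>1 / (9 * t)\<close> the sum is convex
      in \<open>t\<close>. This product bounds \<open>t\<^sup>2\<close> by its chord over the
      interval from \<open>m / 9\<close> to \<open>4 / (9 * m)\<close>.\<close>
    have "(9 * t - m) * (m * t - 4 / 9) \<le> 0" using False t by (intro mult_nonneg_nonpos) auto
    hence "9 * (t * (m * t)) + 4 / 9 * m \<le> 4 * t + t * (m * m)"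
      by (simp add: field_simps)
    moreover have "m * (t * r) \<le> m * (1 / 9)" using t m0 by (intro mult_left_mono) auto
    moreover have "t * (20 - 40 * m + 16 * (m * m)) \<le> 4 / 9 * m"
    proof -
      \<comment> \<open>Five times \<open>quad\<close> reads
        \<open>20 - 40 * m + 15 * (m * m) \<le> 0\<close>.\<close>
      have "t * (20 - 40 * m + 16 * (m * m)) \<le> t * (m * m)"
        using quad t by (intro mult_left_mono) linarith+
      also have "\<dots> = m * (m * t)" by simp
      also have "\<dots> \<le> m * (4 / 9)" using t m0 by (intro mult_left_mono) auto
      finally show ?thesis by simp
    qed
    ultimately have "t * (m * (3 * t + r)) \<le> t * (10 / 3 * m - 1 / 3 - m * m)"
      by (simp add: algebra_simps)
    hence "m * (3 * t + r) \<le> 10 / 3 * m - 1 / 3 - m * m" using t by simp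
    thus ?thesis by (simp add: algebra_simps)
  qed
  have "m * (m + (q1 + q2 + q3) + (p1 + p2 + p3) + r) \<le> m * (m + 3 * t + r) + 1 / 3"
    using qs mult_left_mono[OF t(4), of m] m0 by (simp add: algebra_simps)
  also have "\<dots> \<le> m * (10 / 3)" using main by simp
  finally show ?thesis using m0 by simp
qed

lemma radii_prod:
  assumes a: "radii_ok a" and EF: "E \<in> verts436" "F \<in> verts436" "E \<bullet> F = c" "c < 1"
  shows "(a E)\<^sup>2 * (a F)\<^sup>2 \<le> ((1 - c) / 2)\<^sup>2"
proof -
  have "E \<noteq> F" using EF(3,4) vert_norm(1)[OF EF(1)] by auto
  hence "a E * a F \<le> (1 - c) / 2" "0 < a E" "0 < a F" using a EF unfolding radii_ok_def by auto
  hence "(a E * a F)\<^sup>2 \<le> ((1 - c) / 2)\<^sup>2" by (intro power_mono) auto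
  thus ?thesis by (simp add: power_mult_distrib)
qed

lemma sum_radii_le:
  assumes a: "radii_ok a"
  shows "(\<Sum>E\<in>verts436. (a E)\<^sup>2) \<le> 10 / 3"
proof -
  have pos: "0 < (a E)\<^sup>2" "(a E)\<^sup>2 \<le> 2" if "E \<in> verts436" for E
    using a that by (auto simp: radii_ok_def)
  show ?thesis
  proof (cases "\<exists>E\<in>verts436. 2 / 3 \<le> (a E)\<^sup>2")
    case True
    then obtain E where E: "E \<in> verts436" "2 / 3 \<le> (a E)\<^sup>2" by blast
    note v = vt_in_verts[OF E(1)] and i = inner_vt[OF E(1)]
    have adj: "(a F)\<^sup>2 * (a G)\<^sup>2 \<le> 1 / 9" if "F \<in> verts436" "G \<in> verts436" "F \<bullet> G = 1 / 3" for F G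
      using radii_prod[OF a that] by (simp add: power2_eq_square)
    have diag: "(a F)\<^sup>2 * (a G)\<^sup>2 \<le> 4 / 9" if "F \<in> verts436" "G \<in> verts436" "F \<bullet> G = - 1 / 3" for F G
      using radii_prod[OF a that] by (simp add: power2_eq_square)
    have opp: "(a F)\<^sup>2 * (a G)\<^sup>2 \<le> 1" if "F \<in> verts436" "G \<in> verts436" "F \<bullet> G = - 1" for F G
      using radii_prod[OF a that] by (simp add: power2_eq_square)
    have mem: "vt E (-1) 1 1 \<in> verts436" "vt E 1 (-1) 1 \<in> verts436" "vt E 1 1 (-1) \<in> verts436"
      "vt E (-1) (-1) 1 \<in> verts436" "vt E (-1) 1 (-1) \<in> verts436" "vt E 1 (-1) (-1) \<in> verts436"
      "vt E (-1) (-1) (-1) \<in> verts436"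
      by (simp_all add: v)
    have "(a E)\<^sup>2 + ((a (vt E (-1) 1 1))\<^sup>2 + (a (vt E 1 (-1) 1))\<^sup>2 + (a (vt E 1 1 (-1)))\<^sup>2) +
      ((a (vt E (-1) (-1) 1))\<^sup>2 + (a (vt E (-1) 1 (-1)))\<^sup>2 + (a (vt E 1 (-1) (-1)))\<^sup>2) +
      (a (vt E (-1) (-1) (-1)))\<^sup>2 \<le> 10 / 3"
      by (rule sum_with_large_value[OF pos(1)[OF mem(1)] pos(1)[OF mem(2)] pos(1)[OF mem(3)]
            pos(1)[OF mem(4)] pos(1)[OF mem(5)] pos(1)[OF mem(6)] pos(1)[OF mem(7)] E(2) pos(2)[OF E(1)]
            adj[OF E(1) mem(1)] adj[OF E(1) mem(2)] adj[OF E(1) mem(3)]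
            diag[OF E(1) mem(4)] diag[OF E(1) mem(5)] diag[OF E(1) mem(6)] opp[OF E(1) mem(7)]
            adj[OF mem(4) mem(7)] adj[OF mem(5) mem(7)] adj[OF mem(6) mem(7)]]) (simp_all add: i)
    thus ?thesis by (simp add: sum_verts436[OF E(1)] add_ac)
  next
    case False
    define E :: "real^3" where "E = (\<chi> i. 1 / sqrt 3)"
    have E: "E \<in> verts436" by (simp add: E_def verts436_def)
    note v = vt_in_verts[OF E] and i = inner_vt[OF E]
    \<comment> \<open>The bound is \<open>2 / 3 + (1 / 9) / (2 / 3)\<close>; four disjoint parallel
      edges then give exactly \<open>10 / 3\<close>, which is why the case distinction is made at
      \<open>2 / 3\<close>.\<close>
    have edge: "(a F)\<^sup>2 + (a G)\<^sup>2 \<le> 5 / 6" if FG: "F \<in> verts436" "G \<in> verts436" "F \<bullet> G = 1 / 3" for F G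
    proof -
      have "(a F)\<^sup>2 * (a G)\<^sup>2 \<le> 1 / 9" using radii_prod[OF a FG] by (simp add: power2_eq_square)
      moreover have "(a F)\<^sup>2 \<le> 2 / 3" "(a G)\<^sup>2 \<le> 2 / 3" using False FG by force+
      ultimately show ?thesis using sum_le_of_prod_le[of "(a F)\<^sup>2" "2 / 3" "(a G)\<^sup>2" "1 / 9"] by simp
    qed
    have "(a E)\<^sup>2 + (a (vt E (-1) 1 1))\<^sup>2 \<le> 5 / 6"
      "(a (vt E 1 (-1) 1))\<^sup>2 + (a (vt E (-1) (-1) 1))\<^sup>2 \<le> 5 / 6"
      "(a (vt E 1 1 (-1)))\<^sup>2 + (a (vt E (-1) 1 (-1)))\<^sup>2 \<le> 5 / 6"
      "(a (vt E 1 (-1) (-1)))\<^sup>2 + (a (vt E (-1) (-1) (-1)))\<^sup>2 \<le> 5 / 6"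
      by (rule edge; simp add: v i E)+
    thus ?thesis by (simp add: sum_verts436[OF E])
  qed
qed

section \<open>The two arrangements\<close>

lemma radii_touch_iff:
  assumes a: "radii_ok a" and B: "\<And>E. E \<in> verts436 \<Longrightarrow> B E = hball E ((a E)\<^sup>2)"
    and EF: "E \<in> verts436" "F \<in> verts436" "E \<noteq> F"
  shows "B E \<inter> B F \<noteq> {} \<longleftrightarrow> a E * a F = (1 - E \<bullet> F) / 2"
    "a E * a F = (1 - E \<bullet> F) / 2 \<Longrightarrow> B E \<inter> B F = {touch_pt E (a E) F (a F)}"
proof -
  have r: "0 < a E" "0 < a F" "a E * a F \<le> (1 - E \<bullet> F) / 2" using a EF by (auto simp: radii_ok_def)
  have "B E \<inter> B F = (if a E * a F = (1 - E \<bullet> F) / 2 then {touch_pt E (a E) F (a F)} else {})"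
    unfolding B[OF EF(1)] B[OF EF(2)]
    by (rule hball_Int_eq[OF vert_norm(2)[OF EF(1)] vert_norm(2)[OF EF(2)] EF(3) r])
  thus "B E \<inter> B F \<noteq> {} \<longleftrightarrow> a E * a F = (1 - E \<bullet> F) / 2"
    "a E * a F = (1 - E \<bullet> F) / 2 \<Longrightarrow> B E \<inter> B F = {touch_pt E (a E) F (a F)}"
    by simp_all
qed

lemma tangent_nonempty: "tangent A S \<Longrightarrow> A \<inter> S \<noteq> {}"
  by (auto simp: tangent_def tangent_at_def)

lemma uminus_vt: "- vt E a b c = vt E (- a) (- b) (- c)"
  by (simp add: vec3_eq_iff)

text \<open>The contacts determine all radii. From one vertex of \<open>T\<close>, non-adjacency
  decides on which side every other vertex lies. Contacts along triangles in \<open>T\<close> make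
  the large radii equal, with square \<open>2 / 3\<close>, and contact with a neighbour in
  \<open>T\<close> gives each remaining vertex the square \<open>1 / 6\<close>.\<close>

lemma arrangement436_3_radii:
  assumes "arrangement436_3 B"
  obtains a where "radii_ok a" "\<And>E. E \<in> verts436 \<Longrightarrow> B E = hball E ((a E)\<^sup>2)"
    "(\<Sum>E\<in>verts436. (a E)\<^sup>2) = 10 / 3" "\<And>E. E \<in> verts436 \<Longrightarrow> B E \<inter> B (- E) = {}"
proof -
  from assms obtain T where adm: "admissible436 B"
    and T: "tetrahedral436 T" "tetrahedral436 (verts436 - T)"
    and touch: "\<And>E F. E \<in> T \<Longrightarrow> F \<in> T \<Longrightarrow> E \<noteq> F \<Longrightarrow> tangent_at (B E) (B F) (midpoint E F)"
    and tan: "\<And>E F. E \<in> verts436 - T \<Longrightarrow> F \<in> T \<Longrightarrow> adjacent436 E F \<Longrightarrow> tangent (B E) (B F)"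
    unfolding arrangement436_3_def by blast
  from adm obtain a where a: "radii_ok a" and B: "\<And>E. E \<in> verts436 \<Longrightarrow> B E = hball E ((a E)\<^sup>2)"
    unfolding admissible436_iff by blast
  have TV: "T \<subseteq> verts436" "card T = 4" using T(1) by (auto simp: tetrahedral436_def)
  have na: "F \<bullet> G \<noteq> 1 / 3" if "F \<in> T" "G \<in> T" for F G
  proof -
    have "\<not> adjacent436 F G" using T(1) that unfolding tetrahedral436_def by blast
    thus ?thesis using adjacent436_iff[of F G] that TV(1) by blast
  qed
  have nb: "F \<bullet> G \<noteq> 1 / 3" if "F \<in> verts436 - T" "G \<in> verts436 - T" for F G
  proof -
    have "\<not> adjacent436 F G" using T(2) that unfolding tetrahedral436_def by blast
    thus ?thesis using adjacent436_iff[of F G] that by blast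
  qed
  obtain E where ET: "E \<in> T" using TV(2) by fastforce
  hence E: "E \<in> verts436" using TV by blast
  note i = inner_vt[OF E]
  have v: "vt E (-1) 1 1 \<in> verts436" "vt E 1 (-1) 1 \<in> verts436" "vt E 1 1 (-1) \<in> verts436"
    "vt E (-1) (-1) 1 \<in> verts436" "vt E (-1) 1 (-1) \<in> verts436" "vt E 1 (-1) (-1) \<in> verts436"
    "vt E (-1) (-1) (-1) \<in> verts436"
    by (simp_all add: vt_in_verts[OF E])
  have q: "vt E (-1) 1 1 \<in> verts436 - T" "vt E 1 (-1) 1 \<in> verts436 - T" "vt E 1 1 (-1) \<in> verts436 - T"
    using na[OF ET, of "vt E (-1) 1 1"] na[OF ET, of "vt E 1 (-1) 1"] na[OF ET, of "vt E 1 1 (-1)"] v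
    by (auto simp: i)
  have p: "vt E (-1) (-1) 1 \<in> T" "vt E (-1) 1 (-1) \<in> T" "vt E 1 (-1) (-1) \<in> T"
    using nb[OF q(1), of "vt E (-1) (-1) 1"] nb[OF q(1), of "vt E (-1) 1 (-1)"]
      nb[OF q(2), of "vt E 1 (-1) (-1)"] v by (auto simp: i)
  have r: "vt E (-1) (-1) (-1) \<in> verts436 - T"
    using na[OF p(1), of "vt E (-1) (-1) (-1)"] v by (auto simp: i)
  have TT: "a F * a G = 2 / 3" if FG: "F \<in> T" "G \<in> T" and ne: "F \<bullet> G = - 1 / 3" for F G
  proof -
    have V: "F \<in> verts436" "G \<in> verts436" using FG TV by auto
    have "F \<noteq> G" using ne vert_norm(1)[OF V(1)] by auto
    moreover from touch[OF FG this] have "B F \<inter> B G \<noteq> {}" by (auto simp: tangent_at_def)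
    ultimately show ?thesis using radii_touch_iff(1)[OF a B V] ne by simp
  qed
  have QT: "a F * a G = 1 / 3" if FG: "F \<in> verts436 - T" "G \<in> T" and ne: "F \<bullet> G = 1 / 3" for F G
  proof -
    have V: "F \<in> verts436" "G \<in> verts436" using FG TV by auto
    have "F \<noteq> G" using ne vert_norm(1)[OF V(1)] by auto
    moreover have "B F \<inter> B G \<noteq> {}"
      using tan[OF FG] adjacent436_iff[OF V] ne by (intro tangent_nonempty) blast
    ultimately show ?thesis using radii_touch_iff(1)[OF a B V] ne by simp
  qed
  have pos: "a F > 0" if "F \<in> verts436" for F using a that by (simp add: radii_ok_def)
  let ?p0 = "a E" and ?p1 = "a (vt E (-1) (-1) 1)" and ?p2 = "a (vt E (-1) 1 (-1))" and ?p3 = "a (vt E 1 (-1) (-1))"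
  have pp: "?p0 * ?p1 = 2 / 3" "?p0 * ?p2 = 2 / 3" "?p0 * ?p3 = 2 / 3" "?p1 * ?p2 = 2 / 3"
    by (rule TT; simp add: ET p i)+
  have "?p0 > 0" "?p1 > 0" "?p2 > 0" "?p3 > 0" using pos E v by auto
  hence "?p2 = ?p1" "?p3 = ?p1" "?p0 = ?p1" using pp
    by (metis mult_left_cancel mult.commute less_numeral_extra(3))+
  moreover from this have "?p1\<^sup>2 = 2 / 3" using pp(1) by (simp add: power2_eq_square)
  ultimately have psq: "?p0\<^sup>2 = 2 / 3" "?p1\<^sup>2 = 2 / 3" "?p2\<^sup>2 = 2 / 3" "?p3\<^sup>2 = 2 / 3" by simp_all
  have QTsq: "(a F)\<^sup>2 = 1 / 6" if "F \<in> verts436 - T" "G \<in> T" "F \<bullet> G = 1 / 3" "(a G)\<^sup>2 = 2 / 3" for F G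
  proof -
    have "(a F * a G)\<^sup>2 = (1 / 3)\<^sup>2" using QT[OF that(1-3)] by simp
    thus ?thesis using that(4) by (simp add: power_mult_distrib power2_eq_square[of "1 / 3"])
  qed
  have qsq: "(a (vt E (-1) 1 1))\<^sup>2 = 1 / 6" "(a (vt E 1 (-1) 1))\<^sup>2 = 1 / 6" "(a (vt E 1 1 (-1)))\<^sup>2 = 1 / 6"
    using QTsq[OF q(1) ET] QTsq[OF q(2) ET] QTsq[OF q(3) ET] psq by (simp_all add: i)
  have rsq: "(a (vt E (-1) (-1) (-1)))\<^sup>2 = 1 / 6"
    using QTsq[OF r p(1)] psq by (simp add: i)
  have sum: "(\<Sum>F\<in>verts436. (a F)\<^sup>2) = 10 / 3"
    by (simp add: sum_verts436[OF E] psq qsq rsq)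
  have "B F \<inter> B (- F) = {}" if F: "F \<in> verts436" for F
  proof -
    have F': "- F \<in> verts436" using F by (simp add: verts436_def)
    have "(a F)\<^sup>2 * (a (- F))\<^sup>2 = 1 / 9"
      using F unfolding verts436_eq[OF E]
      by (elim insertE emptyE; simp only: uminus_vt minus_minus; simp add: psq qsq rsq)
    hence sq: "(a F * a (- F))\<^sup>2 = (1 / 3)\<^sup>2" by (simp add: power_mult_distrib power2_eq_square[of "1 / 3"])
    \<comment> \<open>Contact of antipodal horoballs would need the product \<open>1\<close>. One of
      them is large and the other small, so the product is \<open>1 / 3\<close>.\<close>
    have "a F * a (- F) \<noteq> 1"
    proof
      assume "a F * a (- F) = 1"
      thus False using sq by (simp add: power2_eq_square)
    qed
    moreover have "F \<noteq> - F" using vert_nth(3)[OF F, of 1] by (auto simp: vec_eq_iff)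
    moreover have "F \<bullet> - F = - 1" using vert_norm(1)[OF F] by simp
    ultimately show ?thesis using radii_touch_iff(1)[OF a B F F'] by simp
  qed
  thus ?thesis using that a B sum by blast
qed

text \<open>Contact with a face forces \<open>a\<^sup>2 = 2\<close> at \<open>E\<close>. Contact
  with this horoball then gives the squares \<open>1 / 18\<close>, \<open>2 / 9\<close> and
  \<open>1 / 2\<close> at the neighbours, across the face diagonals and at the antipode.\<close>

lemma arrangement436_4_radii:
  assumes "arrangement436_4 B"
  obtains a E where "radii_ok a" "\<And>E. E \<in> verts436 \<Longrightarrow> B E = hball E ((a E)\<^sup>2)"
    "(\<Sum>E\<in>verts436. (a E)\<^sup>2) = 10 / 3" "E \<in> verts436" "\<And>F. F \<in> verts436 \<Longrightarrow> B F \<inter> B E \<noteq> {}"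
proof -
  from assms obtain E where adm: "admissible436 B" and E: "E \<in> verts436"
    and face: "\<And>\<Phi>. \<Phi> facet_of cube436 \<Longrightarrow> E \<notin> \<Phi> \<Longrightarrow> tangent_face (B E) \<Phi>"
    and tan: "\<And>F. F \<in> verts436 - {E} \<Longrightarrow> tangent (B F) (B E)"
    unfolding arrangement436_4_def by blast
  from adm obtain a where a: "radii_ok a" and B: "\<And>E. E \<in> verts436 \<Longrightarrow> B E = hball E ((a E)\<^sup>2)"
    unfolding admissible436_iff by blast
  have a0: "a E > 0" "(a E)\<^sup>2 \<le> 2" using a E by (auto simp: radii_ok_def)
  obtain l t where lt: "t = 1 \<or> t = - 1" "E \<notin> side436 l t" by (rule vert_has_opposite_side[OF E])
  hence "side436 l t facet_of cube436" by (auto simp: facet_of_cube436_iff)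
  hence "tangent_face (B E) (side436 l t)" using face lt by blast
  then obtain x where x: "x \<in> side436 l t" "x \<in> hball E ((a E)\<^sup>2)"
    unfolding B[OF E] tangent_face_def tangent_at_def by blast
  have "t * E $ l = - (1 / sqrt 3)" using vert_on_side_iff[OF E lt(1)] lt(2) by blast
  from hball_beyond_side(1)[OF E lt(1) this a0] x have aE: "(a E)\<^sup>2 = 2"
    by (auto simp: side436_def split: if_splits)
  have "B F \<inter> B E \<noteq> {}" if "F \<in> verts436" for F
    using tangent_nonempty[OF tan, of F] that x(2) B[OF E] by (cases "F = E") auto
  note ne = this
  have sq: "(a F)\<^sup>2 = (1 - F \<bullet> E)\<^sup>2 / 8" if F: "F \<in> verts436" "F \<noteq> E" for F
  proof -
    have "a F * a E = (1 - F \<bullet> E) / 2" using radii_touch_iff(1)[OF a B F(1) E F(2)] ne[OF F(1)] by blast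
    hence "(a F)\<^sup>2 * (a E)\<^sup>2 = ((1 - F \<bullet> E) / 2)\<^sup>2" unfolding power_mult_distrib[symmetric] by (simp only:)
    thus ?thesis unfolding aE by (simp add: power_divide)
  qed
  have val: "(a (vt E b c d))\<^sup>2 = ((3 - (b + c + d)) / 3)\<^sup>2 / 8"
    if "\<bar>b\<bar> = 1" "\<bar>c\<bar> = 1" "\<bar>d\<bar> = 1" "\<not> (b = 1 \<and> c = 1 \<and> d = 1)" for b c d
  proof -
    have "vt E b c d \<noteq> E" using that vt_eq_iff[OF E, of b c d 1 1 1] by simp
    thus ?thesis
      using sq[OF vt_in_verts[OF E that(1-3)]] by (simp add: inner_vt[OF E] diff_divide_distrib)
  qed
  have "(\<Sum>F\<in>verts436. (a F)\<^sup>2) = 10 / 3"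
    by (simp add: sum_verts436[OF E] aE val power_divide)
  thus ?thesis using that a B E ne by blast
qed

text \<open>Equivalence compares the arrangements as sets of horoballs, so the distinguishing
  property is expressed by which members meet; injectivity of the symmetry on the ball transports
  disjointness.\<close>

lemma not_equivalent436:
  assumes B3: "arrangement436_3 B3" and B4: "arrangement436_4 B4"
  shows "\<not> equivalent436 B3 B4"
proof
  assume "equivalent436 B3 B4"
  then obtain f where f: "symmetry436 f" "(\<lambda>E. f ` B3 E) ` verts436 = B4 ` verts436"
    by (auto simp: equivalent436_def)
  have inj: "inj_on f hspace" using f(1) by (simp add: symmetry436_def hisometry_def bij_betw_def)
  obtain a where B3': "\<And>E. E \<in> verts436 \<Longrightarrow> B3 E = hball E ((a E)\<^sup>2)"
    "\<And>E. E \<in> verts436 \<Longrightarrow> B3 E \<inter> B3 (- E) = {}"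
    by (rule arrangement436_3_radii[OF B3]) blast
  obtain E4 where E4: "E4 \<in> verts436" "\<And>F. F \<in> verts436 \<Longrightarrow> B4 F \<inter> B4 E4 \<noteq> {}"
    by (rule arrangement436_4_radii[OF B4]) blast
  have "B4 E4 \<in> (\<lambda>E. f ` B3 E) ` verts436" unfolding f(2) using E4(1) by (rule imageI)
  then obtain E where E: "E \<in> verts436" "B4 E4 = f ` B3 E" by blast
  have E': "- E \<in> verts436" using E(1) by (simp add: verts436_def)
  have "f ` B3 (- E) \<in> B4 ` verts436" unfolding f(2)[symmetric] using E' by (rule imageI)
  then obtain F where F: "F \<in> verts436" "f ` B3 (- E) = B4 F" by blast
  have sub: "B3 E \<subseteq> hspace" "B3 (- E) \<subseteq> hspace" using B3'(1)[OF E(1)] B3'(1)[OF E'] by (auto simp: hball_def)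
  have "B4 F \<inter> B4 E4 = f ` (B3 (- E) \<inter> B3 E)"
    unfolding F(2)[symmetric] E(2) by (rule inj_on_image_Int[OF inj sub(2,1), symmetric])
  thus False using B3'(2)[OF E(1)] E4(2)[OF F(1)] by (simp add: Int_commute)
qed

section \<open>Existence of the two arrangements\<close>

definition sgn_refl :: "real^3 \<Rightarrow> real^3 \<Rightarrow> real^3 \<Rightarrow> real^3" where
  "sgn_refl E F x = (\<chi> i. 3 * E $ i * F $ i * x $ i)"

text \<open>The factors \<open>3 * E $ i * F $ i\<close> are signs, so \<open>sgn_refl E F\<close>
  is the coordinate sign change that takes \<open>E\<close> to \<open>F\<close>. It preserves inner
  products, and with them the distance, the ball and the inequality that defines a horoball.\<close>

lemma same_type_hball:
  assumes E: "E \<in> verts436" and F: "F \<in> verts436"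
  shows "same_type (hball E A) (hball F A)"
proof -
  let ?f = "sgn_refl E F"
  have s: "(3 * E $ i * F $ i) * (3 * E $ i * F $ i) = 1" for i
  proof -
    have "(3 * E $ i * F $ i) * (3 * E $ i * F $ i) = 9 * (E $ i * E $ i) * (F $ i * F $ i)" by simp
    also have "\<dots> = 1" unfolding vert_nth(2)[OF E] vert_nth(2)[OF F] by simp
    finally show ?thesis .
  qed
  have inv: "?f (?f x) = x" for x
  proof -
    have "?f (?f x) $ i = ((3 * E $ i * F $ i) * (3 * E $ i * F $ i)) * x $ i" for i
      by (simp add: sgn_refl_def)
    thus ?thesis unfolding s by (simp add: vec_eq_iff)
  qed
  have ip: "?f x \<bullet> ?f y = x \<bullet> y" for x y
  proof -
    have "?f x $ i * ?f y $ i = ((3 * E $ i * F $ i) * (3 * E $ i * F $ i)) * (x $ i * y $ i)" for i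
      by (simp add: sgn_refl_def)
    thus ?thesis unfolding s by (simp add: inner3)
  qed
  have hs: "?f x \<in> hspace \<longleftrightarrow> x \<in> hspace" for x by (simp add: hspace_iff ip)
  have so: "?f x \<in> solid436 \<longleftrightarrow> x \<in> solid436" for x
  proof -
    have "\<bar>3 * E $ i * F $ i\<bar> = 1" for i
      using vert_nth(1)[OF E, of i] vert_nth(1)[OF F, of i] by (simp add: abs_mult)
    hence "\<bar>?f x $ i\<bar> = \<bar>x $ i\<bar>" for i by (simp add: sgn_refl_def abs_mult[of _ "x $ i"])
    thus ?thesis by (simp add: solid436_def)
  qed
  have fE: "?f E = F"
  proof -
    have "?f E $ i = 3 * (E $ i * E $ i) * F $ i" for i by (simp add: sgn_refl_def)
    thus ?thesis unfolding vert_nth(2)[OF E] by (simp add: vec_eq_iff)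
  qed
  have img: "?f ` S = S'" if "\<And>x. ?f x \<in> S' \<longleftrightarrow> x \<in> S" for S S'
    using that inv by (metis (no_types, lifting) image_eqI imageE subsetI subset_antisym)
  have "bij_betw ?f hspace hspace"
    using img[of hspace hspace] hs inv by (metis bij_betw_def inj_on_inverseI)
  hence "hisometry ?f" by (simp add: hisometry_def hdist_def ip)
  moreover have "?f ` P436 = P436"
    by (rule img) (simp add: P436_def cube436_eq hs so)
  ultimately have "symmetry436 ?f" by (simp add: symmetry436_def)
  moreover have "?f ` hball E A = hball F A"
  proof (rule img)
    fix x
    have "?f x \<bullet> F = x \<bullet> E" using ip[of x E] fE by simp
    thus "?f x \<in> hball F A \<longleftrightarrow> x \<in> hball E A" by (simp add: hball_def hs ip)
  qed
  ultimately show ?thesis unfolding same_type_def by blast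
qed

text \<open>Passing along an edge changes one sign, so the sign of this product separates the two
  inscribed tetrahedra.\<close>

definition vert_parity :: "real^3 \<Rightarrow> real" where
  "vert_parity E = E $ 1 * E $ 2 * E $ 3"

lemma vert_parity_vt: "vert_parity (vt E a b c) = a * b * c * vert_parity E"
  by (simp add: vert_parity_def)

lemma vert_parity_nonzero:
  assumes "E \<in> verts436"
  shows "vert_parity E \<noteq> 0"
  using vert_nth(3)[OF assms] by (simp add: vert_parity_def)

lemma inner_of_vert_parity:
  assumes E: "E \<in> verts436" and F: "F \<in> verts436"
  shows "(vert_parity E > 0) = (vert_parity F > 0) \<Longrightarrow> E \<bullet> F \<in> {1, - 1 / 3}"
    "(vert_parity E > 0) \<noteq> (vert_parity F > 0) \<Longrightarrow> E \<bullet> F \<in> {1 / 3, - 1}"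
proof -
  from E F obtain a b c where abc: "a \<in> {1, -1}" "b \<in> {1, -1}" "c \<in> {1, -1}" "F = vt E a b c"
    by (rule vertE)
  have n: "vert_parity E \<noteq> 0" by (rule vert_parity_nonzero[OF E])
  have EF: "E \<bullet> F = (a + b + c) / 3" unfolding abc(4) by (rule inner_vt(2)[OF E])
  have par: "vert_parity F = a * b * c * vert_parity E" unfolding abc(4) by (rule vert_parity_vt)
  have "a * b * c = 1 \<and> a + b + c \<in> {3, -1} \<or> a * b * c = - 1 \<and> a + b + c \<in> {1, -3}"
    using abc(1-3) by (elim insertE emptyE) simp_all
  hence *: "vert_parity F = vert_parity E \<and> E \<bullet> F \<in> {1, - 1 / 3} \<or>
      vert_parity F = - vert_parity E \<and> E \<bullet> F \<in> {1 / 3, - 1}"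
    unfolding EF par by (elim disjE conjE insertE emptyE) simp_all
  show "E \<bullet> F \<in> {1, - 1 / 3}" if "(vert_parity E > 0) = (vert_parity F > 0)"
  proof -
    have "vert_parity F \<noteq> - vert_parity E" using that n by linarith
    thus ?thesis using * by blast
  qed
  show "E \<bullet> F \<in> {1 / 3, - 1}" if "(vert_parity E > 0) \<noteq> (vert_parity F > 0)"
  proof -
    have "vert_parity F \<noteq> vert_parity E" using that by auto
    thus ?thesis using * by blast
  qed
qed

lemma card_parity_class:
  "card {E \<in> verts436. vert_parity E > 0} = 4" "card {E \<in> verts436. \<not> vert_parity E > 0} = 4"
  "finite verts436"
proof -
  define E :: "real^3" where "E = (\<chi> i. 1 / sqrt 3)"
  have E: "E \<in> verts436" by (simp add: E_def verts436_def)
  have pE: "vert_parity E > 0" by (simp add: E_def vert_parity_def)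
  show fin: "finite verts436" by (subst verts436_eq[OF E]) simp
  have "card {F \<in> verts436. P F} = (\<Sum>F\<in>verts436. if P F then 1 else 0)" for P
    by (simp only: card_eq_sum sum.inter_filter[OF fin])
  thus "card {E \<in> verts436. vert_parity E > 0} = 4" "card {E \<in> verts436. \<not> vert_parity E > 0} = 4"
    using pE by (simp_all add: sum_verts436[OF E] vert_parity_vt)
qed

lemma ex_arrangement436_3: "\<exists>B. arrangement436_3 B"
proof -
  define T where "T = {E \<in> verts436. vert_parity E > 0}"
  \<comment> \<open>Both values are forced: mutual contact of the large horoballs needs the product
    \<open>2 / 3\<close>, contact along an edge the product \<open>1 / 3\<close>.\<close>
  define a :: "real^3 \<Rightarrow> real" where "a E = (if vert_parity E > 0 then sqrt (2 / 3) else sqrt (1 / 6))" for E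
  define B where "B E = hball E ((a E)\<^sup>2)" for E
  have s: "sqrt (2 / 3) * sqrt (2 / 3) = (2 / 3 :: real)" "sqrt (1 / 6) * sqrt (1 / 6) = (1 / 6 :: real)"
    by simp_all
  have s': "sqrt (2 / 3) * sqrt (1 / 6) = (1 / 3 :: real)" "sqrt (1 / 6) * sqrt (2 / 3) = (1 / 3 :: real)"
  proof -
    have "sqrt (2 / 3) * sqrt (1 / 6) = sqrt ((1 / 3)\<^sup>2)"
      unfolding real_sqrt_mult[symmetric] by (simp add: power2_eq_square)
    also have "\<dots> = (1 / 3 :: real)" by (rule real_sqrt_abs[THEN trans]) simp
    finally show "sqrt (2 / 3) * sqrt (1 / 6) = (1 / 3 :: real)" "sqrt (1 / 6) * sqrt (2 / 3) = (1 / 3 :: real)"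
      by (simp_all add: mult.commute)
  qed
  have inner: "E \<bullet> F = - 1 / 3 \<and> a E * a F \<le> 2 / 3 \<or> E \<bullet> F \<in> {1 / 3, - 1} \<and> a E * a F = 1 / 3"
    if "E \<in> verts436" "F \<in> verts436" "E \<noteq> F" for E F
  proof (cases "(vert_parity E > 0) = (vert_parity F > 0)")
    case True
    have "E \<bullet> F \<noteq> 1" using inner_unit_lt_1[OF vert_norm(2)[OF that(1)] vert_norm(2)[OF that(2)] that(3)] by simp
    hence "E \<bullet> F = - 1 / 3" using inner_of_vert_parity(1)[OF that(1,2) True] by simp
    moreover have "a E * a F \<le> 2 / 3" using True unfolding a_def by (simp only: s split: if_splits) simp
    ultimately show ?thesis by blast
  next
    case False
    have "a E * a F = 1 / 3" using False unfolding a_def by (auto simp only: s' split: if_splits)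
    thus ?thesis using inner_of_vert_parity(2)[OF that(1,2) False] by blast
  qed
  have ok: "radii_ok a"
    unfolding radii_ok_def
  proof (intro conjI ballI impI)
    show "0 < a E" "(a E)\<^sup>2 \<le> 2" for E by (simp_all add: a_def)
    show "a E * a F \<le> (1 - E \<bullet> F) / 2" if "E \<in> verts436" "F \<in> verts436" "E \<noteq> F" for E F
      using inner[OF that] by auto
  qed
  have B: "E \<in> verts436 \<Longrightarrow> B E = hball E ((a E)\<^sup>2)" for E by (simp add: B_def)
  have Tc: "verts436 - T = {E \<in> verts436. \<not> vert_parity E > 0}" by (auto simp: T_def)
  have same: "\<not> adjacent436 E F" "same_type (B E) (B F)"
    if "E \<in> verts436" "F \<in> verts436" "(vert_parity E > 0) = (vert_parity F > 0)" for E F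
  proof -
    show "\<not> adjacent436 E F"
      unfolding adjacent436_iff[OF that(1,2)] using inner_of_vert_parity(1)[OF that] by auto
    have "a E = a F" using that(3) by (simp add: a_def)
    thus "same_type (B E) (B F)" using same_type_hball[OF that(1,2)] by (simp add: B_def)
  qed
  have "arrangement436_3 B"
    unfolding arrangement436_3_def
  proof (intro conjI exI[of _ T] ballI impI)
    show "admissible436 B" using ok B by (auto simp: admissible436_iff)
    show "tetrahedral436 T"
      unfolding tetrahedral436_def using card_parity_class(1) same(1) by (auto simp: T_def)
    show "tetrahedral436 (verts436 - T)"
      unfolding tetrahedral436_def Tc using card_parity_class(2) same(1) by auto
    show "same_type (B E) (B F)" if "E \<in> T" "F \<in> T" for E F
      using that by (intro same(2)) (auto simp: T_def)
    show "same_type (B E) (B F)" if "E \<in> verts436 - T" "F \<in> verts436 - T" for E F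
      using that by (intro same(2)) (auto simp: T_def)
    show "tangent_at (B E) (B F) (midpoint E F)" if EF: "E \<in> T" "F \<in> T" "E \<noteq> F" for E F
    proof -
      have V: "E \<in> verts436" "F \<in> verts436" and p: "vert_parity E > 0" "vert_parity F > 0"
        using EF by (auto simp: T_def)
      have aEF: "a E = sqrt (2 / 3)" "a F = sqrt (2 / 3)" using p by (simp_all add: a_def)
      have "E \<bullet> F \<in> {1, - 1 / 3}" using inner_of_vert_parity(1)[OF V] p by simp
      moreover have "E \<bullet> F \<noteq> 1" using inner_unit_lt_1[OF vert_norm(2)[OF V(1)] vert_norm(2)[OF V(2)] EF(3)] by simp
      ultimately have "a E * a F = (1 - E \<bullet> F) / 2" unfolding aEF s by auto
      from radii_touch_iff(2)[OF ok B V EF(3) this]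
      have "B E \<inter> B F = {touch_pt E (a E) F (a F)}" .
      moreover have "touch_pt E r F r = midpoint E F" if "r > 0" for r
        using that by (simp add: touch_pt_def midpoint_def vec_eq_iff field_simps)
      ultimately show ?thesis using aEF by (simp add: tangent_at_def)
    qed
    show "tangent (B E) (B F)" if EF: "E \<in> verts436 - T" "F \<in> T" "adjacent436 E F" for E F
    proof -
      have V: "E \<in> verts436" "F \<in> verts436" using EF by (auto simp: T_def)
      have EF3: "E \<bullet> F = 1 / 3" using EF(3) adjacent436_iff[OF V] by blast
      hence ne: "E \<noteq> F" using vert_norm(1)[OF V(1)] by auto
      have "a E * a F = (1 - E \<bullet> F) / 2" using inner[OF V ne] EF3 by auto
      from radii_touch_iff(2)[OF ok B V ne this] show ?thesis by (auto simp: tangent_def tangent_at_def)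
    qed
  qed
  thus ?thesis by blast
qed

lemma ex_arrangement436_4: "\<exists>B. arrangement436_4 B"
proof -
  define E :: "real^3" where "E = (\<chi> i. 1 / sqrt 3)"
  have E: "E \<in> verts436" by (simp add: E_def verts436_def)
  \<comment> \<open>\<open>sqrt 2\<close> is forced by contact with the faces, and the other values
    by contact with the horoball at \<open>E\<close>.\<close>
  define a :: "real^3 \<Rightarrow> real" where "a F = (if F = E then sqrt 2 else (1 - F \<bullet> E) / 2 / sqrt 2)" for F
  define B where "B F = hball F ((a F)\<^sup>2)" for F
  have g: "0 < 1 - F \<bullet> E" "1 - F \<bullet> E \<le> 2" if "F \<in> verts436" "F \<noteq> E" for F
    using inner_unit_lt_1[OF vert_norm(2)[OF that(1)] vert_norm(2)[OF E] that(2)] inner_verts[OF that(1) E] by auto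
  have aE: "a E = sqrt 2" "(a E)\<^sup>2 = 2" by (simp_all add: a_def)
  have aF: "a F = (1 - F \<bullet> E) / 2 / sqrt 2" if "F \<noteq> E" for F using that by (simp add: a_def)
  have prodE: "a F * a E = (1 - F \<bullet> E) / 2" if "F \<noteq> E" for F using that by (simp add: aE aF)
  \<comment> \<open>A finite check over the signs. Equality occurs when one of the two vertices is
    the antipode of \<open>E\<close> and the other is adjacent to it, so these horoballs touch as
    well.\<close>
  have pair: "(1 - F \<bullet> E) * (1 - G \<bullet> E) / 8 \<le> (1 - F \<bullet> G) / 2"
    if FG: "F \<in> verts436" "G \<in> verts436" "F \<noteq> E" "G \<noteq> E" "F \<noteq> G" for F G
  proof -
    obtain p q r where F: "p \<in> {1, -1}" "q \<in> {1, -1}" "r \<in> {1, -1}" "F = vt E p q r" by (rule vertE[OF E FG(1)])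
    obtain u v w where G: "u \<in> {1, -1}" "v \<in> {1, -1}" "w \<in> {1, -1}" "G = vt E u v w" by (rule vertE[OF E FG(2)])
    have "\<not> (p = u \<and> q = v \<and> r = w)" using FG(5) F(4) G(4) by auto
    moreover have "\<not> (p = 1 \<and> q = 1 \<and> r = 1)" "\<not> (u = 1 \<and> v = 1 \<and> w = 1)"
      using FG(3,4) F(4) G(4) by auto
    ultimately have "(3 - (p + q + r)) * (3 - (u + v + w)) \<le> 12 * (3 - (p * u + q * v + r * w))"
      using F(1-3) G(1-3) by (elim insertE emptyE) simp_all
    moreover have "(1 - F \<bullet> E) * (1 - G \<bullet> E) = (3 - (p + q + r)) * (3 - (u + v + w)) / 9"
      "1 - F \<bullet> G = (3 - (p * u + q * v + r * w)) / 3"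
      unfolding F(4) G(4) inner_vt[OF E] by (simp_all add: field_simps)
    ultimately show ?thesis by simp
  qed
  have ok: "radii_ok a"
    unfolding radii_ok_def
  proof (intro conjI ballI impI)
    fix F assume F: "F \<in> verts436"
    show "0 < a F" using g[OF F] by (cases "F = E") (simp_all add: aE aF)
    show "(a F)\<^sup>2 \<le> 2"
    proof (cases "F = E")
      case False
      have "(1 - F \<bullet> E)\<^sup>2 \<le> 2\<^sup>2" using g[OF F False] by (intro power_mono) auto
      thus ?thesis by (simp add: aF[OF False] power_divide)
    qed (simp add: aE)
    fix G assume G: "G \<in> verts436" and ne: "F \<noteq> G"
    consider "F = E" | "G = E" | "F \<noteq> E" "G \<noteq> E" by blast
    thus "a F * a G \<le> (1 - F \<bullet> G) / 2"
    proof cases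
      case 1
      thus ?thesis using prodE[of G] ne by (simp add: mult.commute inner_commute)
    next
      case 2
      thus ?thesis using prodE[of F] ne by simp
    next
      case 3
      have "a F * a G = (1 - F \<bullet> E) * (1 - G \<bullet> E) / 8" by (simp add: aF 3)
      thus ?thesis using pair[OF F G 3 ne] by simp
    qed
  qed
  have B: "F \<in> verts436 \<Longrightarrow> B F = hball F ((a F)\<^sup>2)" for F by (simp add: B_def)
  have "arrangement436_4 B"
    unfolding arrangement436_4_def
  proof (intro conjI bexI[of _ E] allI impI ballI)
    show "admissible436 B" using ok B by (auto simp: admissible436_iff)
    show "tangent_face (B E) \<Phi>" if \<Phi>: "\<Phi> facet_of cube436 \<and> E \<notin> \<Phi>" for \<Phi>
    proof -
      have "\<exists>l t. (t = 1 \<or> t = - 1) \<and> \<Phi> = side436 l t"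
        using \<Phi> unfolding facet_of_cube436_iff by (rule conjunct1)
      then obtain l t where lt: "t = 1 \<or> t = - 1" "\<Phi> = side436 l t" by metis
      have side: "t * E $ l = - (1 / sqrt 3)" using vert_on_side_iff[OF E lt(1)] \<Phi> lt(2) by blast
      have a0: "a E > 0" by (simp add: aE)
      let ?p = "(1 / 2) *\<^sub>R (E + sqrt 3 *\<^sub>R axis l t)"
      note h = hball_beyond_side[OF E lt(1) side a0, unfolded aE(2)]
      have "affine hull \<Phi> \<subseteq> {x. axis l t \<bullet> x = 1 / sqrt 3}"
        unfolding lt(2)
      proof (rule hull_minimal)
        show "side436 l t \<subseteq> {x. axis l t \<bullet> x = 1 / sqrt 3}" by (auto simp: side436_def inner_axis')
      qed (rule affine_hyperplane)
      hence "B E \<inter> affine hull \<Phi> \<subseteq> hball E 2 \<inter> {x. t * x $ l \<ge> 1 / sqrt 3}"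
        unfolding B[OF E] aE(2) by (auto simp: inner_axis')
      also have "\<dots> \<subseteq> {?p}" using h(1) by simp
      finally have "B E \<inter> affine hull \<Phi> \<subseteq> {?p}" .
      moreover have "?p \<in> B E" unfolding B[OF E] aE(2) using h(3) by simp
      moreover have "?p \<in> \<Phi>" unfolding lt(2) by (rule h(2))
      moreover from this have "?p \<in> affine hull \<Phi>" by (rule hull_inc)
      ultimately have "B E \<inter> affine hull \<Phi> = {?p}" "?p \<in> \<Phi>" by blast+
      thus ?thesis unfolding tangent_face_def tangent_at_def by blast
    qed
    show "tangent (B F) (B E)" if "F \<in> verts436 - {E}" for F
    proof -
      have F: "F \<in> verts436" "F \<noteq> E" using that by auto
      from radii_touch_iff(2)[OF ok B F(1) E F(2) prodE[OF F(2)]]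
      show ?thesis by (auto simp: tangent_def tangent_at_def)
    qed
  qed (rule E)
  thus ?thesis by blast
qed

theorem theorem4p12:
  shows "(\<exists>B3. arrangement436_3 B3) \<and> (\<exists>B4. arrangement436_4 B4) \<and>
    (\<forall>B3 B4. arrangement436_3 B3 \<and> arrangement436_4 B4 \<longrightarrow>
       optimally_dense436 B3 \<and> optimally_dense436 B4 \<and>
       \<not> equivalent436 B3 B4 \<and>
       density436 B3 = density436 B4 \<and>
       \<bar>density436 B3 - 0.85327609\<bar> \<le> 5 / 10 ^ 9)"
proof -
  obtain s where s: "s > 0" "\<bar>2 / (3 * s) - 0.85327609\<bar> \<le> 5 / 10 ^ 9"
    and dens: "\<And>B a. radii_ok a \<Longrightarrow> (\<And>E. E \<in> verts436 \<Longrightarrow> B E = hball E ((a E)\<^sup>2)) \<Longrightarrow>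
       density436 B = (\<Sum>E\<in>verts436. (a E)\<^sup>2) / (5 * s)"
    by (rule density436_eq) blast
  have opt: "optimally_dense436 B" if "admissible436 B" "density436 B = 10 / 3 / (5 * s)" for B
    unfolding optimally_dense436_def
  proof (intro conjI allI impI)
    fix B' assume "admissible436 B'"
    then obtain a where "radii_ok a" "\<forall>E\<in>verts436. B' E = hball E ((a E)\<^sup>2)"
      unfolding admissible436_iff by blast
    hence "density436 B' = (\<Sum>E\<in>verts436. (a E)\<^sup>2) / (5 * s)" "(\<Sum>E\<in>verts436. (a E)\<^sup>2) \<le> 10 / 3"
      using dens[of a B'] sum_radii_le by auto
    thus "density436 B' \<le> density436 B"
      unfolding that(2) using s(1) by (metis divide_right_mono less_imp_le mult_pos_pos zero_less_numeral)
  qed (rule that(1))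
  have d3: "density436 B = 10 / 3 / (5 * s)" if "arrangement436_3 B" for B
    by (rule arrangement436_3_radii[OF that]) (use dens in metis)
  have d4: "density436 B = 10 / 3 / (5 * s)" if "arrangement436_4 B" for B
    by (rule arrangement436_4_radii[OF that]) (use dens in metis)
  have "optimally_dense436 B3 \<and> optimally_dense436 B4 \<and> \<not> equivalent436 B3 B4 \<and>
       density436 B3 = density436 B4 \<and> \<bar>density436 B3 - 0.85327609\<bar> \<le> 5 / 10 ^ 9"
    if B: "arrangement436_3 B3" "arrangement436_4 B4" for B3 B4
  proof -
    have adm: "admissible436 B3" "admissible436 B4"
      using B by (auto simp: arrangement436_3_def arrangement436_4_def)
    have "10 / 3 / (5 * s) = 2 / (3 * s)" by simp
    thus ?thesis
      using opt[OF adm(1) d3[OF B(1)]] opt[OF adm(2) d4[OF B(2)]] not_equivalent436[OF B]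
        d3[OF B(1)] d4[OF B(2)] s(2) by metis
  qed
  thus ?thesis using ex_arrangement436_3 ex_arrangement436_4 by blast
qed

end
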